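(* Let $F$ be an algebraically closed field of characteristic $3$. Then the permutation module $F\uparrow_{\mathrm{P\Gamma L}(2,8)}^{S_9}$ does not have a Specht filtration.
   Context: $\mathrm{P\Gamma L}(2,8)$ is the split extension of $\mathrm{PGL}(2,8)$ by the Frobenius automorphism (of order $3$) of $\mathbf{F}_8$, regarded as a subgroup of $S_9$ via its natural action on the $9$ points of the projective line over $\mathbf{F}_8$. $F\uparrow_{G}^{S_9}$ is the module induced from the trivial $FG$-module. For a partition $\lambda$ of $n$, $S^\lambda$ is the Specht module over $F$ in the convention of James' lecture notes: the submodule of the permutation module on $\lambda$-tabloids spanned by the polytabloids. An $FS_n$-module $U$ has a Specht filtration if there is a chain of submodules $0\subset U_1\subset\cdots\subset U_r\subset U$ such that each successive quotient is isomorphic to a Specht module. *)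

theory Defs
  imports
    "HOL-Analysis.Cartesian_Space"
    "HOL-Algebra.Module"
    "HOL-Algebra.Sym_Groups"
    "HOL-Algebra.Algebraic_Closure_Type"
begin

section \<open>Modules for a group over a field\<close>

text \<open>
  A module for the group algebra is an \<open>F\<close>-vector space with a linear left action of the group.
  The scalars are a type \<open>'f\<close> of class \<open>field\<close>; it is seen as a ring record through
  \<^const>\<open>ring_of_type_algebra\<close>, so that \<open>submodule U ring_of_type_algebra M\<close>
  means that \<open>U\<close> is an \<open>F\<close>-subspace of \<open>M\<close>. As for every module record of
  HOL-Algebra, the fields \<open>mult\<close> and \<open>one\<close> play no role.
\<close>

record ('f, 'v, 'g) group_module = "('f, 'v) module" +
  act :: "'g \<Rightarrow> 'v \<Rightarrow> 'v"

definition linear_span ::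
  "('f::field, 'v, 'g) group_module \<Rightarrow> 'v set \<Rightarrow> 'v set" where
  "linear_span M S = \<Inter>{U. submodule U ring_of_type_algebra M \<and> S \<subseteq> U}"

definition group_submodule ::
  "('g, 'b) monoid_scheme \<Rightarrow> ('f::field, 'v, 'g) group_module \<Rightarrow> 'v set \<Rightarrow> bool" where
  "group_submodule G M U \<longleftrightarrow>
     submodule U ring_of_type_algebra M \<and> (\<forall>g\<in>carrier G. \<forall>u\<in>U. act M g u \<in> U)"

definition quotient_module ::
  "('f::field, 'v, 'g) group_module \<Rightarrow> 'v set \<Rightarrow> ('f, 'v set, 'g) group_module" where
  "quotient_module M U =
     \<lparr>carrier = a_rcosets\<^bsub>M\<^esub> U, mult = undefined, one = undefined,
      zero = U, add = set_add M,
      module.smult = (\<lambda>c A. \<Union>x\<in>A. U +>\<^bsub>M\<^esub> (c \<odot>\<^bsub>M\<^esub> x)),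
      act = (\<lambda>g A. \<Union>x\<in>A. U +>\<^bsub>M\<^esub> (act M g x))\<rparr>"

definition module_isomorphic ::
  "('g, 'b) monoid_scheme \<Rightarrow> ('f::field, 'v, 'g) group_module \<Rightarrow>
     ('f, 'w, 'g) group_module \<Rightarrow> bool" where
  "module_isomorphic G M N \<longleftrightarrow>
     (\<exists>\<phi>\<in>iso (add_monoid M) (add_monoid N).
        (\<forall>c. \<forall>u\<in>carrier M. \<phi> (c \<odot>\<^bsub>M\<^esub> u) = c \<odot>\<^bsub>N\<^esub> \<phi> u) \<and>
        (\<forall>g\<in>carrier G. \<forall>u\<in>carrier M. \<phi> (act M g u) = act N g (\<phi> u)))"

definition trivial_module :: "('f::field, 'f, 'g) group_module" where
  "trivial_module =
     \<lparr>carrier = UNIV, mult = undefined, one = undefined, zero = 0, add = (+),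
      module.smult = (*), act = (\<lambda>g x. x)\<rparr>"

definition permutation_module ::
  "('g, 'b) monoid_scheme \<Rightarrow> 'x set \<Rightarrow> ('g \<Rightarrow> 'x \<Rightarrow> 'x) \<Rightarrow>
     ('f::field, 'x \<Rightarrow> 'f, 'g) group_module" where
  \<comment> \<open>for a finite \<open>G\<close>-set \<open>\<Omega>\<close> with action \<open>\<alpha>\<close>;
     \<open>f\<close> stands for the formal sum of the \<open>f x\<close> times \<open>x\<close>, for \<open>x\<close> in \<open>\<Omega>\<close>\<close>
  "permutation_module G \<Omega> \<alpha> =
     \<lparr>carrier = {f. \<forall>x. x \<notin> \<Omega> \<longrightarrow> f x = 0}, mult = undefined, one = undefined,
      zero = (\<lambda>x. 0), add = (\<lambda>f h x. f x + h x),
      module.smult = (\<lambda>c f x. c * f x),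
      act = (\<lambda>g f x. if x \<in> \<Omega> then f (\<alpha> (inv\<^bsub>G\<^esub> g) x) else 0)\<rparr>"


section \<open>Induced modules\<close>

text \<open>
  Let \<open>H\<close> be a subgroup of the finite group \<open>G\<close> and \<open>M\<close> an \<open>FH\<close>-module. The induced module is
  the tensor product of \<open>FG\<close> and \<open>M\<close> over \<open>FH\<close>, that is, the quotient of the tensor product over
  \<open>F\<close> by the relations \<open>xh \<otimes> v = x \<otimes> hv\<close>. A function \<open>f\<close> on \<open>G\<close> with values in \<open>M\<close>
  stands for the sum of all \<open>x \<otimes> f x\<close> in the tensor product over \<open>F\<close>.
\<close>

definition group_algebra_tensor ::
  "('g, 'b) monoid_scheme \<Rightarrow> ('f::field, 'v, 'g) group_module \<Rightarrow>
     ('f, 'g \<Rightarrow> 'v, 'g) group_module" where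
  "group_algebra_tensor G M =
     \<lparr>carrier = carrier G \<rightarrow>\<^sub>E carrier M, mult = undefined, one = undefined,
      zero = (\<lambda>x\<in>carrier G. \<zero>\<^bsub>M\<^esub>),
      add = (\<lambda>f h. \<lambda>x\<in>carrier G. f x \<oplus>\<^bsub>M\<^esub> h x),
      module.smult = (\<lambda>c f. \<lambda>x\<in>carrier G. c \<odot>\<^bsub>M\<^esub> f x),
      act = (\<lambda>g f. \<lambda>x\<in>carrier G. f (inv\<^bsub>G\<^esub> g \<otimes>\<^bsub>G\<^esub> x))\<rparr>"

definition pure_tensor ::
  "('g, 'b) monoid_scheme \<Rightarrow> ('f::field, 'v, 'g) group_module \<Rightarrow> 'g \<Rightarrow> 'v \<Rightarrow> 'g \<Rightarrow> 'v" where
  "pure_tensor G M x v = (\<lambda>y\<in>carrier G. if y = x then v else \<zero>\<^bsub>M\<^esub>)"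

definition tensor_relations ::
  "('g, 'b) monoid_scheme \<Rightarrow> 'g set \<Rightarrow> ('f::field, 'v, 'g) group_module \<Rightarrow> ('g \<Rightarrow> 'v) set" where
  "tensor_relations G H M =
     {pure_tensor G M (x \<otimes>\<^bsub>G\<^esub> h) v
        \<ominus>\<^bsub>group_algebra_tensor G M\<^esub> pure_tensor G M x (act M h v)
      | x h v. x \<in> carrier G \<and> h \<in> H \<and> v \<in> carrier M}"

definition induced_module ::
  "('g, 'b) monoid_scheme \<Rightarrow> 'g set \<Rightarrow> ('f::field, 'v, 'g) group_module \<Rightarrow>
     ('f, ('g \<Rightarrow> 'v) set, 'g) group_module" where
  "induced_module G H M =
     quotient_module (group_algebra_tensor G M)
       (linear_span (group_algebra_tensor G M) (tensor_relations G H M))"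


section \<open>Specht modules and Specht filtrations\<close>

definition is_partition :: "nat \<Rightarrow> nat list \<Rightarrow> bool" where
  "is_partition n \<mu> \<longleftrightarrow> sorted_wrt (\<ge>) \<mu> \<and> 0 \<notin> set \<mu> \<and> sum_list \<mu> = n"

definition young_diagram :: "nat list \<Rightarrow> (nat \<times> nat) set" where
  "young_diagram \<mu> = {(i, j). i < length \<mu> \<and> j < \<mu> ! i}"

definition tableaux :: "nat list \<Rightarrow> (nat \<times> nat \<Rightarrow> nat) set" where
  "tableaux \<mu> =
     {t \<in> extensional (young_diagram \<mu>). bij_betw t (young_diagram \<mu>) {1..sum_list \<mu>}}"

definition tableau_act ::
  "nat list \<Rightarrow> (nat \<Rightarrow> nat) \<Rightarrow> (nat \<times> nat \<Rightarrow> nat) \<Rightarrow> nat \<times> nat \<Rightarrow> nat" where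
  "tableau_act \<mu> p t = (\<lambda>x\<in>young_diagram \<mu>. p (t x))"

definition row_stabilizer ::
  "nat list \<Rightarrow> (nat \<times> nat \<Rightarrow> nat) \<Rightarrow> (nat \<Rightarrow> nat) set" where
  "row_stabilizer \<mu> t =
     {p \<in> carrier (sym_group (sum_list \<mu>)).
        \<forall>(i, j)\<in>young_diagram \<mu>. \<exists>j'. (i, j') \<in> young_diagram \<mu> \<and> p (t (i, j)) = t (i, j')}"

definition column_stabilizer ::
  "nat list \<Rightarrow> (nat \<times> nat \<Rightarrow> nat) \<Rightarrow> (nat \<Rightarrow> nat) set" where
  "column_stabilizer \<mu> t =
     {p \<in> carrier (sym_group (sum_list \<mu>)).
        \<forall>(i, j)\<in>young_diagram \<mu>. \<exists>i'. (i', j) \<in> young_diagram \<mu> \<and> p (t (i, j)) = t (i', j)}"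

text \<open>The tabloid of \<open>t\<close> is its class under row equivalence.\<close>

definition tabloid ::
  "nat list \<Rightarrow> (nat \<times> nat \<Rightarrow> nat) \<Rightarrow> (nat \<times> nat \<Rightarrow> nat) set" where
  "tabloid \<mu> t = {tableau_act \<mu> p t | p. p \<in> row_stabilizer \<mu> t}"

definition tabloid_module ::
  "nat list \<Rightarrow> ('f::field, (nat \<times> nat \<Rightarrow> nat) set \<Rightarrow> 'f, nat \<Rightarrow> nat) group_module" where
  "tabloid_module \<mu> =
     permutation_module (sym_group (sum_list \<mu>)) (tabloid \<mu> ` tableaux \<mu>)
       (\<lambda>p T. tableau_act \<mu> p ` T)"

definition polytabloid ::
  "nat list \<Rightarrow> (nat \<times> nat \<Rightarrow> nat) \<Rightarrow> (nat \<times> nat \<Rightarrow> nat) set \<Rightarrow> 'f::field" where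
  "polytabloid \<mu> t =
     (\<lambda>T. \<Sum>p\<in>column_stabilizer \<mu> t.
            of_int (sign p) * (if T = tabloid \<mu> (tableau_act \<mu> p t) then 1 else 0))"

definition specht_module ::
  "nat list \<Rightarrow> ('f::field, (nat \<times> nat \<Rightarrow> nat) set \<Rightarrow> 'f, nat \<Rightarrow> nat) group_module" where
  "specht_module \<mu> =
     (tabloid_module \<mu>)
       \<lparr>carrier := linear_span (tabloid_module \<mu>) (polytabloid \<mu> ` tableaux \<mu>)\<rparr>"

definition has_specht_filtration ::
  "nat \<Rightarrow> ('f::field, 'v, nat \<Rightarrow> nat) group_module \<Rightarrow> bool" where
  "has_specht_filtration n M \<longleftrightarrow>
     (\<exists>r (U :: nat \<Rightarrow> 'v set).
        U 0 = {\<zero>\<^bsub>M\<^esub>} \<and> U r = carrier M \<and>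
        (\<forall>i\<le>r. group_submodule (sym_group n) M (U i)) \<and>
        (\<forall>i<r. U i \<subset> U (Suc i) \<and>
           (\<exists>\<mu>. is_partition n \<mu> \<and>
              module_isomorphic (sym_group n)
                (quotient_module (M\<lparr>carrier := U (Suc i)\<rparr>) (U i)) (specht_module \<mu>))))"


section \<open>The projective semilinear group over the field with eight elements\<close>

text \<open>
  In the definitions below \<open>'k\<close> is to be a field with eight elements, whose Frobenius automorphism is
  squaring, of order 3.
\<close>

definition projective_line :: "(('k::field)^2) set set" where
  "projective_line = {vec.span {v} | v. v \<noteq> 0}"

definition PGL2 :: "((('k::field)^2) set \<Rightarrow> ('k^2) set) set" where
  "PGL2 = {(\<lambda>L\<in>projective_line. (\<lambda>v. A *v v) ` L) | A :: 'k^2^2. invertible A}"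

definition frobenius_line :: "(('k::field)^2) set \<Rightarrow> ('k^2) set" where
  "frobenius_line L = (\<lambda>v. \<chi> i. (v $ i)\<^sup>2) ` L"

definition PGammaL2 :: "((('k::field)^2) set \<Rightarrow> ('k^2) set) set" where
  "PGammaL2 = {compose projective_line g (frobenius_line ^^ i) | g i. g \<in> PGL2 \<and> i < 3}"

text \<open>The subgroup of the symmetric group defined by a numbering \<open>b\<close> of the points.\<close>

definition PGammaL2_perms ::
  "((('k::field)^2) set \<Rightarrow> nat) \<Rightarrow> (nat \<Rightarrow> nat) set" where
  "PGammaL2_perms b =
     {p \<in> carrier (sym_group 9). \<exists>g\<in>PGammaL2. \<forall>L\<in>projective_line. p (b L) = b (g L)}"

end

theory Submission
  imports Defs "HOL-Analysis.Determinants"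
begin

text \<open>Pulling a Specht filtration of the induced module back to the functions on \<open>S\<^sub>9\<close>, every
  vector with nonzero image in the induced module acquires a nonzero image \<open>w\<close> in a Specht module
  \<open>S\<^sup>\<mu>\<close>, which inherits all its relations. Two facts about nine points of the projective line over
  \<open>F\<^sub>8\<close> rule out every \<open>\<mu>\<close>.

  The sign \<open>(-1)\<^bsup>Tr r\<^esup>\<close> of the cross ratio \<open>r\<close> of four points is invariant under \<open>P\<Gamma>L(2,8)\<close> and
  alternating, and its coboundary on five points is \<open>3\<close> or \<open>-3\<close>. Dividing by \<open>3\<close> and reducing modulo
  \<open>3\<close> gives a vector that is alternating in \<open>1, ..., 5\<close>, symmetric in \<open>6, ..., 9\<close>, and annihilated by
  \<open>id + (5 6) + (5 7) + (5 8) + (5 9)\<close>. For its image these relations force \<open>w = 0\<close> unless \<open>\<mu>\<close> has at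
  least six rows and at least three columns.

  For every numbering of the points, some involution in \<open>PGL(2,8)\<close> acts as a reflection of the
  pentagon \<open>1, ..., 5\<close> times an element of the Klein four-group on \<open>6, ..., 9\<close>. Hence, in
  characteristic \<open>3\<close>, the signed sum over the dihedral group of the pentagon times the sum over the
  Klein four-group annihilates the induced module. It does not annihilate \<open>S\<^sup>\<mu>\<close> for the remaining
  \<open>\<mu>\<close>.\<close>

section \<open>Quotients and Specht factors\<close>

text \<open>The relations imposed on w describe a cycle for the boundary map from the fifth to the
  fourth exterior power of the natural permutation module. In characteristic 0 the kernel of that
  map is the Specht module of (4,1^5), which is where the bound of six rows comes from. Over the
  integers the boundary of the coboundary c is 9 times the sign itself, so c is not a cycle. But c/3
  is still integral, and its boundary is 3 times the sign, which vanishes modulo 3. The dihedral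
  element works for every numbering because any four points of the line over F_8 become, once a
  suitable fifth point is sent to infinity, a coset of an additive subgroup of order 4. The other
  four finite points form the other coset, and the three nonzero translations by the subgroup induce
  on it all three products of two disjoint transpositions. So the pairing prescribed by the
  pentagon, seen from the point at infinity, always occurs. The sign in the signed sum is the
  character of the dihedral group that is trivial on rotations; as permutations the reflections are
  even.\<close>

definition additive_action ::
  "('g, 'b) monoid_scheme \<Rightarrow> ('f::field, 'v, 'g) group_module \<Rightarrow> bool" where
  "additive_action G M \<longleftrightarrow>
     abelian_group M \<and> (\<forall>g\<in>carrier G. act M g \<in> hom (add_monoid M) (add_monoid M))"

text \<open>Scalars are left out here and in \<open>additive_action\<close>: the relations to be
  transported have coefficients in the prime field, so they are sums of group elements with
  repetitions, and additive equivariant maps preserve them.\<close>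

definition stable_subgroup ::
  "('g, 'b) monoid_scheme \<Rightarrow> ('f::field, 'v, 'g) group_module \<Rightarrow> 'v set \<Rightarrow> bool" where
  "stable_subgroup G M U \<longleftrightarrow>
     subgroup U (add_monoid M) \<and> (\<forall>g\<in>carrier G. \<forall>u\<in>U. act M g u \<in> U)"

lemma group_submodule_stable: "group_submodule G M U \<Longrightarrow> stable_subgroup G M U"
  unfolding group_submodule_def stable_subgroup_def submodule_def by blast

lemma additive_action_restrict:
  assumes "additive_action G M" and "stable_subgroup G M U"
  shows "additive_action G (M\<lparr>carrier := U\<rparr>)"
proof -
  interpret M: abelian_group M using assms(1) by (simp add: additive_action_def)
  have sub: "subgroup U (add_monoid M)" using assms(2) by (simp add: stable_subgroup_def)
  have U: "U \<subseteq> carrier M" using subgroup.subset[OF sub] by simp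
  have "abelian_group (M\<lparr>carrier := U\<rparr>)"
  proof (rule abelian_groupI)
    fix u assume "u \<in> carrier (M\<lparr>carrier := U\<rparr>)"
    then show "\<exists>v\<in>carrier (M\<lparr>carrier := U\<rparr>). v \<oplus>\<^bsub>M\<lparr>carrier := U\<rparr>\<^esub> u = \<zero>\<^bsub>M\<lparr>carrier := U\<rparr>\<^esub>"
      using U subgroup.m_inv_closed[OF sub, of u]
      by (intro bexI[of _ "\<ominus>\<^bsub>M\<^esub> u"]) (simp_all add: subsetD M.l_neg a_inv_def)
  next
    show "u \<oplus>\<^bsub>M\<lparr>carrier := U\<rparr>\<^esub> v \<in> carrier (M\<lparr>carrier := U\<rparr>)"
      if "u \<in> carrier (M\<lparr>carrier := U\<rparr>)" "v \<in> carrier (M\<lparr>carrier := U\<rparr>)" for u v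
      using that subgroup.m_closed[OF sub] by simp
    show "\<zero>\<^bsub>M\<lparr>carrier := U\<rparr>\<^esub> \<in> carrier (M\<lparr>carrier := U\<rparr>)"
      using subgroup.one_closed[OF sub] by simp
  next
    show "u \<oplus>\<^bsub>M\<lparr>carrier := U\<rparr>\<^esub> v = v \<oplus>\<^bsub>M\<lparr>carrier := U\<rparr>\<^esub> u"
      if "u \<in> carrier (M\<lparr>carrier := U\<rparr>)" "v \<in> carrier (M\<lparr>carrier := U\<rparr>)" for u v
      using that U M.a_comm[of u v] by auto
  qed (use U in \<open>simp_all add: subsetD M.a_assoc\<close>)
  moreover have "act M g \<in> hom (add_monoid (M\<lparr>carrier := U\<rparr>)) (add_monoid (M\<lparr>carrier := U\<rparr>))"
    if "g \<in> carrier G" for g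
  proof (rule homI)
    have hom: "act M g \<in> hom (add_monoid M) (add_monoid M)"
      using assms(1) that by (simp add: additive_action_def)
    show "act M g (u \<otimes>\<^bsub>add_monoid (M\<lparr>carrier := U\<rparr>)\<^esub> v) =
        act M g u \<otimes>\<^bsub>add_monoid (M\<lparr>carrier := U\<rparr>)\<^esub> act M g v"
      if "u \<in> carrier (add_monoid (M\<lparr>carrier := U\<rparr>))" "v \<in> carrier (add_monoid (M\<lparr>carrier := U\<rparr>))" for u v
      using hom_mult[OF hom, of u v] that U by (simp add: subsetD)
  qed (use assms(2) that in \<open>simp add: stable_subgroup_def\<close>)
  ultimately show ?thesis
    by (simp add: additive_action_def)
qed

lemma stable_subgroup_restrict:
  assumes "additive_action G M" and "stable_subgroup G M U" and "stable_subgroup G M W" and "U \<subseteq> W"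
  shows "stable_subgroup G (M\<lparr>carrier := W\<rparr>) U"
proof -
  interpret M: abelian_group M using assms(1) by (simp add: additive_action_def)
  have "subgroup U (add_monoid M\<lparr>carrier := W\<rparr>)"
    using assms by (intro M.add.subgroup_incl) (auto simp: stable_subgroup_def)
  then show ?thesis using assms(2) by (simp add: stable_subgroup_def)
qed

context
  fixes G :: "('g, 'b) monoid_scheme" and M :: "('f::field, 'v, 'g) group_module" and U
  assumes action: "additive_action G M" and stable: "stable_subgroup G M U"
begin

interpretation M: abelian_group M using action by (simp add: additive_action_def)
interpretation U: abelian_subgroup U M
  using stable
  by (intro abelian_subgroupI3) (auto simp: stable_subgroup_def additive_subgroup_def M.abelian_group_axioms)

lemma quotient_coset_in_carrier: "u \<in> carrier M \<Longrightarrow> U +>\<^bsub>M\<^esub> u \<in> carrier (quotient_module M U)"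
  by (simp add: quotient_module_def M.a_rcosetsI U.a_subset)

lemma quotient_carrierE:
  assumes "A \<in> carrier (quotient_module M U)"
  obtains u where "u \<in> carrier M" "A = U +>\<^bsub>M\<^esub> u"
  using assms by (auto simp: quotient_module_def A_RCOSETS_def RCOSETS_def a_r_coset_def)

lemma quotient_coset_zero_iff:
  assumes "u \<in> carrier M"
  shows "U +>\<^bsub>M\<^esub> u = \<zero>\<^bsub>quotient_module M U\<^esub> \<longleftrightarrow> u \<in> U"
  using U.a_rcos_const U.a_rcos_self[OF assms] by (auto simp: quotient_module_def)

lemma quotient_add:
  assumes "u \<in> carrier M" "v \<in> carrier M"
  shows "(U +>\<^bsub>M\<^esub> u) \<oplus>\<^bsub>quotient_module M U\<^esub> (U +>\<^bsub>M\<^esub> v) = U +>\<^bsub>M\<^esub> (u \<oplus>\<^bsub>M\<^esub> v)"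
  using assms by (simp add: quotient_module_def U.a_rcos_sum)

lemma act_closed:
  assumes "g \<in> carrier G" "u \<in> carrier M" shows "act M g u \<in> carrier M"
  using action assms by (auto simp: additive_action_def hom_def)

lemma act_add:
  assumes "g \<in> carrier G" "u \<in> carrier M" "v \<in> carrier M"
  shows "act M g (u \<oplus>\<^bsub>M\<^esub> v) = act M g u \<oplus>\<^bsub>M\<^esub> act M g v"
  using action assms by (auto simp: additive_action_def hom_def)

text \<open>The action on the quotient is a union over the elements of a coset; stability of U makes
  all the cosets in this union equal.\<close>

lemma quotient_act:
  assumes g: "g \<in> carrier G" and u: "u \<in> carrier M"
  shows "act (quotient_module M U) g (U +>\<^bsub>M\<^esub> u) = U +>\<^bsub>M\<^esub> act M g u"
proof -
  have "U +>\<^bsub>M\<^esub> act M g x = U +>\<^bsub>M\<^esub> act M g u" if "x \<in> U +>\<^bsub>M\<^esub> u" for x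
  proof -
    from that obtain w where w: "w \<in> U" "x = w \<oplus>\<^bsub>M\<^esub> u"
      by (auto simp: a_r_coset_def r_coset_def)
    then have wM: "w \<in> carrier M" and gw: "act M g w \<in> U"
      using stable g by (auto simp: stable_subgroup_def)
    have "act M g x = act M g w \<oplus>\<^bsub>M\<^esub> act M g u"
      using w wM g u by (simp add: act_add)
    then have "act M g x \<in> U +>\<^bsub>M\<^esub> act M g u"
      using gw by (auto simp: a_r_coset_def r_coset_def)
    then show ?thesis
      using U.a_repr_independence' act_closed[OF g u] by simp
  qed
  then have "(\<Union>x\<in>U +>\<^bsub>M\<^esub> u. U +>\<^bsub>M\<^esub> act M g x) = U +>\<^bsub>M\<^esub> act M g u"
    using U.a_rcos_self[OF u] by blast
  then show ?thesis
    by (simp add: quotient_module_def)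
qed

lemma quotient_zero: "\<zero>\<^bsub>quotient_module M U\<^esub> = U +>\<^bsub>M\<^esub> \<zero>\<^bsub>M\<^esub>"
  using U.a_subset by (simp add: quotient_module_def)

lemma additive_action_quotient: "additive_action G (quotient_module M U)"
proof -
  have "abelian_group (quotient_module M U)"
  proof (rule abelian_groupI)
    show "\<zero>\<^bsub>quotient_module M U\<^esub> \<in> carrier (quotient_module M U)"
      by (simp add: quotient_zero quotient_coset_in_carrier)
  next
    fix A B assume "A \<in> carrier (quotient_module M U)" "B \<in> carrier (quotient_module M U)"
    then show "A \<oplus>\<^bsub>quotient_module M U\<^esub> B \<in> carrier (quotient_module M U)"
      by (elim quotient_carrierE) (simp add: quotient_add quotient_coset_in_carrier)
  next
    fix A B C assume "A \<in> carrier (quotient_module M U)" "B \<in> carrier (quotient_module M U)"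
      "C \<in> carrier (quotient_module M U)"
    then show "A \<oplus>\<^bsub>quotient_module M U\<^esub> B \<oplus>\<^bsub>quotient_module M U\<^esub> C =
        A \<oplus>\<^bsub>quotient_module M U\<^esub> (B \<oplus>\<^bsub>quotient_module M U\<^esub> C)"
      by (elim quotient_carrierE) (simp add: quotient_add M.a_assoc)
  next
    fix A B assume "A \<in> carrier (quotient_module M U)" "B \<in> carrier (quotient_module M U)"
    then show "A \<oplus>\<^bsub>quotient_module M U\<^esub> B = B \<oplus>\<^bsub>quotient_module M U\<^esub> A"
      by (elim quotient_carrierE) (simp only: quotient_add, subst M.a_comm, simp_all)
  next
    fix A assume A: "A \<in> carrier (quotient_module M U)"
    then show "\<zero>\<^bsub>quotient_module M U\<^esub> \<oplus>\<^bsub>quotient_module M U\<^esub> A = A"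
      by (elim quotient_carrierE) (simp only: quotient_zero quotient_add M.zero_closed M.l_zero)
    from A obtain u where "u \<in> carrier M" "A = U +>\<^bsub>M\<^esub> u" by (rule quotient_carrierE)
    then show "\<exists>B\<in>carrier (quotient_module M U). B \<oplus>\<^bsub>quotient_module M U\<^esub> A = \<zero>\<^bsub>quotient_module M U\<^esub>"
      by (intro bexI[of _ "U +>\<^bsub>M\<^esub> (\<ominus>\<^bsub>M\<^esub> u)"])
         (simp_all only: quotient_zero quotient_add quotient_coset_in_carrier M.a_inv_closed M.l_neg)
  qed
  moreover have "act (quotient_module M U) g \<in>
      hom (add_monoid (quotient_module M U)) (add_monoid (quotient_module M U))"
    if g: "g \<in> carrier G" for g
  proof (rule homI)
    fix A assume "A \<in> carrier (add_monoid (quotient_module M U))"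
    then obtain u where "u \<in> carrier M" "A = U +>\<^bsub>M\<^esub> u" using quotient_carrierE by auto
    then show "act (quotient_module M U) g A \<in> carrier (add_monoid (quotient_module M U))"
      using g by (simp add: quotient_act quotient_coset_in_carrier act_closed)
  next
    fix A B assume "A \<in> carrier (add_monoid (quotient_module M U))" "B \<in> carrier (add_monoid (quotient_module M U))"
    then obtain u v where "u \<in> carrier M" "A = U +>\<^bsub>M\<^esub> u" "v \<in> carrier M" "B = U +>\<^bsub>M\<^esub> v"
      using quotient_carrierE by (metis monoid.simps(1) partial_object.select_convs(1))
    then show "act (quotient_module M U) g (A \<otimes>\<^bsub>add_monoid (quotient_module M U)\<^esub> B) =
      act (quotient_module M U) g A \<otimes>\<^bsub>add_monoid (quotient_module M U)\<^esub> act (quotient_module M U) g B"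
      using g by (simp add: quotient_act quotient_add act_closed act_add)
  qed
  ultimately show ?thesis by (simp add: additive_action_def)
qed

lemma stable_subgroup_preimage:
  assumes "stable_subgroup G (quotient_module M U) W"
  shows "stable_subgroup G M {u \<in> carrier M. U +>\<^bsub>M\<^esub> u \<in> W}"
proof -
  interpret Q: abelian_group "quotient_module M U"
    using additive_action_quotient by (simp add: additive_action_def)
  interpret W: additive_subgroup W "quotient_module M U"
    using assms by (simp add: additive_subgroup_def stable_subgroup_def)
  have inv: "U +>\<^bsub>M\<^esub> (\<ominus>\<^bsub>M\<^esub> u) = \<ominus>\<^bsub>quotient_module M U\<^esub> (U +>\<^bsub>M\<^esub> u)" if "u \<in> carrier M" for u
  proof -
    have "(U +>\<^bsub>M\<^esub> (\<ominus>\<^bsub>M\<^esub> u)) \<oplus>\<^bsub>quotient_module M U\<^esub> (U +>\<^bsub>M\<^esub> u) = \<zero>\<^bsub>quotient_module M U\<^esub>"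
      using that by (simp add: quotient_add M.l_neg quotient_zero)
    then show ?thesis
      using that by (metis Q.minus_equality M.a_inv_closed quotient_coset_in_carrier)
  qed
  have "subgroup {u \<in> carrier M. U +>\<^bsub>M\<^esub> u \<in> W} (add_monoid M)"
  proof (rule M.add.subgroupI)
    show "{u \<in> carrier M. U +>\<^bsub>M\<^esub> u \<in> W} \<noteq> {}"
      using W.zero_closed by (auto simp only: quotient_zero M.zero_closed intro!: exI[of _ "\<zero>\<^bsub>M\<^esub>"])
  next
    fix u assume "u \<in> {u \<in> carrier M. U +>\<^bsub>M\<^esub> u \<in> W}"
    then show "\<ominus>\<^bsub>M\<^esub> u \<in> {u \<in> carrier M. U +>\<^bsub>M\<^esub> u \<in> W}"
      by (auto simp only: mem_Collect_eq inv W.a_inv_closed M.a_inv_closed)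
  next
    fix u v assume "u \<in> {u \<in> carrier M. U +>\<^bsub>M\<^esub> u \<in> W}" "v \<in> {u \<in> carrier M. U +>\<^bsub>M\<^esub> u \<in> W}"
    then show "u \<oplus>\<^bsub>M\<^esub> v \<in> {u \<in> carrier M. U +>\<^bsub>M\<^esub> u \<in> W}"
      by (auto simp only: mem_Collect_eq quotient_add[symmetric] W.a_closed M.a_closed)
  qed auto
  then show ?thesis
    using assms by (auto simp: stable_subgroup_def quotient_act[symmetric] act_closed)
qed

end

text \<open>Take the first layer of the filtration that contains the image of b. The preimage V of
  this layer maps onto its Specht factor, and minimality keeps the image of b away from that of
  zero. The comparison is with the value of \<pi> at zero, since only a bijective homomorphism onto
  the Specht module is at hand here.\<close>

lemma filtration_factor:
  fixes T :: "('f::field, 'v, nat \<Rightarrow> nat) group_module"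
  assumes T: "additive_action (sym_group n) T" and N: "stable_subgroup (sym_group n) T N"
    and filt: "has_specht_filtration n (quotient_module T N)"
    and b: "b \<in> carrier T" "b \<notin> N"
  obtains \<mu> V and \<pi> :: "'v \<Rightarrow> (nat \<times> nat \<Rightarrow> nat) set \<Rightarrow> 'f"
    where "is_partition n \<mu>" "stable_subgroup (sym_group n) T V" "N \<subseteq> V" "b \<in> V"
    "\<pi> ` V = carrier (specht_module \<mu>)"
    "\<And>f h. f \<in> V \<Longrightarrow> h \<in> V \<Longrightarrow> \<pi> (f \<oplus>\<^bsub>T\<^esub> h) = \<pi> f \<oplus>\<^bsub>specht_module \<mu>\<^esub> \<pi> h"
    "\<And>g f. g \<in> carrier (sym_group n) \<Longrightarrow> f \<in> V \<Longrightarrow>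
       \<pi> (act T g f) = act (specht_module \<mu>) g (\<pi> f)"
    "\<And>f. f \<in> N \<Longrightarrow> \<pi> f = \<pi> \<zero>\<^bsub>T\<^esub>" "\<pi> b \<noteq> \<pi> \<zero>\<^bsub>T\<^esub>"
proof -
  let ?G = "sym_group n"
  define M where "M = quotient_module T N"
  define q where "q f = N +>\<^bsub>T\<^esub> f" for f
  have M: "additive_action ?G M" unfolding M_def using T N by (rule additive_action_quotient)
  have q_carrier: "q f \<in> carrier M" if "f \<in> carrier T" for f
    unfolding q_def M_def using T N that by (rule quotient_coset_in_carrier)
  have q_zero: "q f = \<zero>\<^bsub>M\<^esub> \<longleftrightarrow> f \<in> N" if "f \<in> carrier T" for f
    unfolding q_def M_def using T N that by (rule quotient_coset_zero_iff)
  have q_add: "q (f \<oplus>\<^bsub>T\<^esub> h) = q f \<oplus>\<^bsub>M\<^esub> q h" if "f \<in> carrier T" "h \<in> carrier T" for f h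
    unfolding q_def M_def using quotient_add[OF T N that] by simp
  have q_act: "q (act T g f) = act M g (q f)" if "g \<in> carrier ?G" "f \<in> carrier T" for g f
    unfolding q_def M_def using quotient_act[OF T N that] by simp
  have q_onto: "\<exists>f\<in>carrier T. A = q f" if "A \<in> carrier M" for A
    using quotient_carrierE[OF T N that[unfolded M_def]] unfolding q_def by blast
  interpret T: abelian_group T using T by (simp add: additive_action_def)
  obtain r U where U0: "U 0 = {\<zero>\<^bsub>M\<^esub>}" and Ur: "U r = carrier M"
    and Usub: "\<And>i. i \<le> r \<Longrightarrow> group_submodule ?G M (U i)"
    and step: "\<And>i. i < r \<Longrightarrow> U i \<subset> U (Suc i) \<and> (\<exists>\<mu>. is_partition n \<mu> \<and>
       module_isomorphic ?G (quotient_module (M\<lparr>carrier := U (Suc i)\<rparr>) (U i))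
         (specht_module \<mu> :: ('f, _, _) group_module))"
    using filt unfolding has_specht_filtration_def M_def[symmetric] by blast
  have "\<exists>k\<le>r. q b \<in> U k" using Ur q_carrier[OF b(1)] by blast
  then obtain k where k: "k \<le> r" "q b \<in> U k" "\<And>j. j < k \<Longrightarrow> q b \<notin> U j"
    using exists_least_iff[of "\<lambda>k. k \<le> r \<and> q b \<in> U k"] by (metis less_imp_le_nat order_trans)
  have "k \<noteq> 0"
    using k(2) U0 q_zero[OF b(1)] b(2) by auto
  then obtain i where i: "k = Suc i" by (cases k) auto
  have "i < r" using k(1) i by simp
  define W where "W = U (Suc i)"
  have incl: "U i \<subseteq> W" using step[OF \<open>i < r\<close>] by (auto simp: W_def)
  have sU: "stable_subgroup ?G M (U i)" and sW: "stable_subgroup ?G M W"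
    using Usub[of i] Usub[of "Suc i"] \<open>i < r\<close> by (auto intro!: group_submodule_stable simp: W_def)
  have MW: "additive_action ?G (M\<lparr>carrier := W\<rparr>)" using M sW by (rule additive_action_restrict)
  have sUW: "stable_subgroup ?G (M\<lparr>carrier := W\<rparr>) (U i)"
    using M sU sW incl by (rule stable_subgroup_restrict)
  define Q where "Q = quotient_module (M\<lparr>carrier := W\<rparr>) (U i)"
  define p where "p u = U i +>\<^bsub>M\<lparr>carrier := W\<rparr>\<^esub> u" for u
  have p_carrier: "p u \<in> carrier Q" if "u \<in> W" for u
    unfolding p_def Q_def using quotient_coset_in_carrier[OF MW sUW] that by simp
  have p_zero: "p u = \<zero>\<^bsub>Q\<^esub> \<longleftrightarrow> u \<in> U i" if "u \<in> W" for u
    unfolding p_def Q_def using quotient_coset_zero_iff[OF MW sUW] that by simp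
  have p_add: "p (u \<oplus>\<^bsub>M\<^esub> v) = p u \<oplus>\<^bsub>Q\<^esub> p v" if "u \<in> W" "v \<in> W" for u v
    unfolding p_def Q_def using quotient_add[OF MW sUW, of u v] that by simp
  have p_act: "p (act M g u) = act Q g (p u)" if "g \<in> carrier ?G" "u \<in> W" for g u
    unfolding p_def Q_def using quotient_act[OF MW sUW that(1), of u] that by simp
  have p_onto: "\<exists>u\<in>W. A = p u" if "A \<in> carrier Q" for A
    using quotient_carrierE[OF MW sUW that[unfolded Q_def]] unfolding p_def by auto
  obtain \<mu> and \<phi> where \<mu>: "is_partition n \<mu>"
    and iso: "\<phi> \<in> iso (add_monoid Q) (add_monoid (specht_module \<mu> :: ('f, _, _) group_module))"
    and \<phi>_act: "\<And>g u. g \<in> carrier ?G \<Longrightarrow> u \<in> carrier Q \<Longrightarrow> \<phi> (act Q g u) = act (specht_module \<mu>) g (\<phi> u)"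
    using step[OF \<open>i < r\<close>] unfolding module_isomorphic_def W_def[symmetric] Q_def[symmetric] by blast
  have \<phi>_add: "\<phi> (u \<oplus>\<^bsub>Q\<^esub> v) = \<phi> u \<oplus>\<^bsub>specht_module \<mu>\<^esub> \<phi> v" if "u \<in> carrier Q" "v \<in> carrier Q" for u v
    using iso that by (auto simp: iso_def hom_def)
  have \<phi>_bij: "bij_betw \<phi> (carrier Q) (carrier (specht_module \<mu> :: ('f, _, _) group_module))"
    using iso by (auto simp: iso_def)
  define V where "V = {f \<in> carrier T. q f \<in> W}"
  define \<pi> where "\<pi> f = \<phi> (p (q f))" for f
  have sV: "stable_subgroup ?G T V"
    unfolding V_def q_def using stable_subgroup_preimage[OF T N] sW unfolding M_def by blast
  have zeroW: "\<zero>\<^bsub>M\<^esub> \<in> U i"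
    using subgroup.one_closed sU by (fastforce simp: stable_subgroup_def)
  have NT: "N \<subseteq> carrier T" using N subgroup.subset by (fastforce simp: stable_subgroup_def)
  have qN: "q f = \<zero>\<^bsub>M\<^esub>" if "f \<in> N" for f using q_zero that NT by blast
  have zeroN: "\<zero>\<^bsub>T\<^esub> \<in> N" using N subgroup.one_closed by (fastforce simp: stable_subgroup_def)
  show thesis
  proof (rule that[of \<mu> V \<pi>])
    show "is_partition n \<mu>" by (rule \<mu>)
    show "stable_subgroup ?G T V" by (rule sV)
    show "N \<subseteq> V" using NT qN zeroW incl by (auto simp: V_def)
    show "b \<in> V" using b(1) k(2) i by (simp add: V_def W_def)
    show "\<pi> ` V = carrier (specht_module \<mu>)"
    proof -
      have "W \<subseteq> carrier M" using sW subgroup.subset by (fastforce simp: stable_subgroup_def)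
      then have "q ` V = W" using q_onto by (fastforce simp: V_def)
      moreover have "p ` W = carrier Q" using p_onto p_carrier by blast
      moreover have "\<pi> ` V = \<phi> ` p ` q ` V" by (auto simp: \<pi>_def)
      ultimately show ?thesis using \<phi>_bij by (simp add: bij_betw_def)
    qed
    show "\<pi> (f \<oplus>\<^bsub>T\<^esub> h) = \<pi> f \<oplus>\<^bsub>specht_module \<mu>\<^esub> \<pi> h" if "f \<in> V" "h \<in> V" for f h
      using that by (simp add: \<pi>_def V_def q_add p_add \<phi>_add p_carrier)
    show "\<pi> (act T g f) = act (specht_module \<mu>) g (\<pi> f)" if "g \<in> carrier ?G" "f \<in> V" for g f
      using that by (simp add: \<pi>_def V_def q_act p_act \<phi>_act p_carrier)
    show "\<pi> f = \<pi> \<zero>\<^bsub>T\<^esub>" if "f \<in> N" for f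
      using qN[OF that] qN[OF zeroN] by (simp add: \<pi>_def)
    show "\<pi> b \<noteq> \<pi> \<zero>\<^bsub>T\<^esub>"
    proof
      assume eq: "\<pi> b = \<pi> \<zero>\<^bsub>T\<^esub>"
      have qb: "q b \<in> W" using k(2) i by (simp add: W_def)
      have q0: "q \<zero>\<^bsub>T\<^esub> \<in> W" using qN[OF zeroN] zeroW incl by auto
      have "p (q b) = p (q \<zero>\<^bsub>T\<^esub>)"
        using eq \<phi>_bij p_carrier[OF qb] p_carrier[OF q0] by (auto simp: \<pi>_def bij_betw_def inj_on_def)
      also have "\<dots> = \<zero>\<^bsub>Q\<^esub>" using p_zero[OF q0] qN[OF zeroN] zeroW by simp
      finally have "q b \<in> U i" using p_zero[OF qb] by simp
      then show False using k(3)[of i] i by simp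
    qed
  qed
qed

text \<open>An element of the group ring is given as a list: repetition supplies positive integer
  coefficients and, in characteristic 3, also -1 = 1 + 1.\<close>

definition group_sum :: "('f::field, 'v, 'g) group_module \<Rightarrow> 'g list \<Rightarrow> 'v \<Rightarrow> 'v" where
  "group_sum M gs u = foldr (\<lambda>g w. act M g u \<oplus>\<^bsub>M\<^esub> w) gs \<zero>\<^bsub>M\<^esub>"

lemma group_sum_Nil [simp]: "group_sum M [] u = \<zero>\<^bsub>M\<^esub>"
  and group_sum_Cons [simp]: "group_sum M (g # gs) u = act M g u \<oplus>\<^bsub>M\<^esub> group_sum M gs u"
  by (simp_all add: group_sum_def)

lemma group_sum_closed:
  assumes "stable_subgroup G M V" "set gs \<subseteq> carrier G" "u \<in> V"
  shows "group_sum M gs u \<in> V"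
  using assms(2)
proof (induction gs)
  case Nil
  show ?case using assms(1) subgroup.one_closed by (fastforce simp: stable_subgroup_def)
next
  case (Cons g gs)
  then show ?case
    using assms subgroup.m_closed[of V "add_monoid M" "act M g u" "group_sum M gs u"]
    by (simp add: stable_subgroup_def)
qed

lemma group_sum_hom:
  assumes "stable_subgroup G M V" "set gs \<subseteq> carrier G" "u \<in> V"
    and "\<And>f h. f \<in> V \<Longrightarrow> h \<in> V \<Longrightarrow> \<pi> (f \<oplus>\<^bsub>M\<^esub> h) = \<pi> f \<oplus>\<^bsub>S\<^esub> \<pi> h"
    and "\<And>g f. g \<in> carrier G \<Longrightarrow> f \<in> V \<Longrightarrow> \<pi> (act M g f) = act S g (\<pi> f)"
    and "\<pi> \<zero>\<^bsub>M\<^esub> = \<zero>\<^bsub>S\<^esub>"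
  shows "\<pi> (group_sum M gs u) = group_sum S gs (\<pi> u)"
  using assms(2)
proof (induction gs)
  case (Cons g gs)
  then show ?case
    using assms group_sum_closed[OF assms(1) _ assms(3), of gs] by (simp add: stable_subgroup_def)
qed (simp add: assms(6))

section \<open>The induced module as a quotient of the group algebra\<close>

text \<open>Since \<open>induction_data\<close> assumes only a subset H, left cosets are replaced by
  the classes of the equivalence relation generated by right multiplication by elements of H. For a
  subgroup these are the left cosets.\<close>

definition linked :: "('g, 'b) monoid_scheme \<Rightarrow> 'g set \<Rightarrow> ('g \<times> 'g) set" where
  "linked G H = (let r = {(x, x \<otimes>\<^bsub>G\<^esub> h) | x h. x \<in> carrier G \<and> h \<in> H} in (r \<union> r\<inverse>)\<^sup>*)"

definition class_sum ::
  "('g, 'b) monoid_scheme \<Rightarrow> 'g set \<Rightarrow> ('g \<Rightarrow> 'f::field) \<Rightarrow> 'g \<Rightarrow> 'f" where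
  "class_sum G H f x = (\<Sum>y\<in>linked G H `` {x}. f y)"

text \<open>This is the span of the tensor relations (\<open>linear_span_relations\<close>). The
  class sums are therefore coordinates on the induced module, which becomes the space of functions
  on the classes.\<close>

definition relation_kernel ::
  "('g, 'b) monoid_scheme \<Rightarrow> 'g set \<Rightarrow> ('g \<Rightarrow> 'f::field) set" where
  "relation_kernel G H = {f \<in> carrier G \<rightarrow>\<^sub>E UNIV. \<forall>x\<in>carrier G. class_sum G H f x = 0}"

locale induction_data = group G for G (structure) +
  fixes H
  assumes finite_carrier: "finite (carrier G)" and H_subset: "H \<subseteq> carrier G"
begin

abbreviation F :: "('f::field, 'f, 'a) group_module" where "F \<equiv> trivial_module"
abbreviation T :: "('f::field, 'a \<Rightarrow> 'f, 'a) group_module" where "T \<equiv> group_algebra_tensor G F"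

lemma F_zero: "\<zero>\<^bsub>F\<^esub> = 0" and F_act: "act F g v = v"
  by (simp_all add: trivial_module_def)

lemma T_carrier: "carrier T = carrier G \<rightarrow>\<^sub>E UNIV"
  and T_zero: "\<zero>\<^bsub>T\<^esub> = (\<lambda>x\<in>carrier G. 0)"
  and T_add: "f \<oplus>\<^bsub>T\<^esub> h = (\<lambda>x\<in>carrier G. f x + h x)"
  and T_smult: "c \<odot>\<^bsub>T\<^esub> f = (\<lambda>x\<in>carrier G. c * f x)"
  and T_act: "act T g f = (\<lambda>x\<in>carrier G. f (inv g \<otimes> x))"
  by (simp_all add: group_algebra_tensor_def trivial_module_def)

lemma T_abelian_group: "abelian_group (T :: ('f::field, _, _) group_module)"
proof (rule abelian_groupI)
  fix f :: "'a \<Rightarrow> 'f" assume "f \<in> carrier T"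
  then show "\<exists>h\<in>carrier T. h \<oplus>\<^bsub>T\<^esub> f = \<zero>\<^bsub>T\<^esub>"
    by (intro bexI[of _ "\<lambda>x\<in>carrier G. - f x"]) (auto simp: T_carrier T_zero T_add)
qed (auto simp: T_carrier T_zero T_add PiE_def extensional_def fun_eq_iff algebra_simps)

lemma T_additive_action: "additive_action G (T :: ('f::field, _, _) group_module)"
  using T_abelian_group
  by (auto simp: additive_action_def hom_def T_carrier T_add T_act)

lemma T_uminus:
  fixes f :: "'a \<Rightarrow> 'f::field"
  assumes "f \<in> carrier T"
  shows "\<ominus>\<^bsub>T\<^esub> f = (\<lambda>x\<in>carrier G. - f x)"
proof -
  interpret T: abelian_group "T :: ('f, _, _) group_module" by (rule T_abelian_group)
  show ?thesis
    using assms by (intro T.minus_equality) (auto simp: T_carrier T_add T_zero)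
qed

lemma linked_refl: "(x, x) \<in> linked G H"
  by (simp add: linked_def Let_def)

lemma linked_trans: "(x, y) \<in> linked G H \<Longrightarrow> (y, z) \<in> linked G H \<Longrightarrow> (x, z) \<in> linked G H"
  unfolding linked_def Let_def by (rule rtrancl_trans)

lemma linked_sym: "(x, y) \<in> linked G H \<Longrightarrow> (y, x) \<in> linked G H"
proof -
  assume "(x, y) \<in> linked G H"
  moreover have "sym (linked G H)"
    unfolding linked_def Let_def by (intro sym_rtrancl sym_Un_converse)
  ultimately show ?thesis by (rule symD[rotated])
qed

lemma linked_step: "x \<in> carrier G \<Longrightarrow> h \<in> H \<Longrightarrow> (x, x \<otimes> h) \<in> linked G H"
  unfolding linked_def Let_def by (rule r_into_rtrancl) blast

lemma linked_induct [consumes 1, case_names refl step unstep]: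
  assumes "(x, y) \<in> linked G H" and "P x"
    and "\<And>z h. z \<in> carrier G \<Longrightarrow> h \<in> H \<Longrightarrow> P z \<Longrightarrow> P (z \<otimes> h)"
    and "\<And>z h. z \<in> carrier G \<Longrightarrow> h \<in> H \<Longrightarrow> P (z \<otimes> h) \<Longrightarrow> P z"
  shows "P y"
  using assms(1) unfolding linked_def Let_def
  by (induction rule: rtrancl_induct) (use assms in auto)

lemma linked_closed:
  assumes "(x, y) \<in> linked G H" and "x \<in> carrier G"
  shows "y \<in> carrier G"
  using assms(1) by (induction rule: linked_induct) (use assms(2) H_subset in auto)

lemma linked_mult:
  assumes "(x, y) \<in> linked G H" and "g \<in> carrier G" "x \<in> carrier G"
  shows "(g \<otimes> x, g \<otimes> y) \<in> linked G H"
proof -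
  have "y \<in> carrier G \<and> (g \<otimes> x, g \<otimes> y) \<in> linked G H"
    using assms(1)
  proof (induction rule: linked_induct)
    case refl then show ?case using assms(3) linked_refl by simp
  next
    case (step z h)
    then have "h \<in> carrier G" using H_subset by blast
    moreover have "(g \<otimes> z, g \<otimes> z \<otimes> h) \<in> linked G H"
      using step assms(2) by (intro linked_step) auto
    ultimately show ?case using step assms(2) linked_trans by (auto simp: m_assoc)
  next
    case (unstep z h)
    then have "h \<in> carrier G" using H_subset by blast
    moreover have "(g \<otimes> z \<otimes> h, g \<otimes> z) \<in> linked G H"
      using unstep assms(2) by (intro linked_sym[OF linked_step]) auto
    ultimately show ?case using unstep assms(2) linked_trans by (auto simp: m_assoc)
  qed
  then show ?thesis by simp
qed

lemma finite_class: "x \<in> carrier G \<Longrightarrow> finite (linked G H `` {x})"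
  using linked_closed by (intro finite_subset[OF _ finite_carrier]) auto

lemma class_eq: "(x, y) \<in> linked G H \<Longrightarrow> linked G H `` {x} = linked G H `` {y}"
  using linked_sym linked_trans by blast

text \<open>Left multiplication by g is a bijection between classes, by
  \<open>linked_mult\<close>.\<close>

lemma class_sum_act:
  assumes "g \<in> carrier G" "x \<in> carrier G"
  shows "class_sum G H (act T g f) x = class_sum G H f (inv g \<otimes> x)"
  unfolding class_sum_def
proof (rule sum.reindex_bij_witness[of _ "\<lambda>y. g \<otimes> y" "\<lambda>y. inv g \<otimes> y"])
  fix y assume "y \<in> linked G H `` {x}"
  then have "y \<in> carrier G" and l: "(x, y) \<in> linked G H" using linked_closed assms by auto
  then show "g \<otimes> (inv g \<otimes> y) = y" "f (inv g \<otimes> y) = act T g f y"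
    using assms by (auto simp: T_act m_assoc[symmetric])
  show "inv g \<otimes> y \<in> linked G H `` {inv g \<otimes> x}"
    using linked_mult[OF l, of "inv g"] assms by auto
next
  fix y assume "y \<in> linked G H `` {inv g \<otimes> x}"
  then have l: "(inv g \<otimes> x, y) \<in> linked G H" by simp
  then have y: "y \<in> carrier G" using linked_closed assms by auto
  then show "inv g \<otimes> (g \<otimes> y) = y" using assms by (auto simp: m_assoc[symmetric])
  have "g \<otimes> (inv g \<otimes> x) = x" using assms by (simp add: m_assoc[symmetric])
  then show "g \<otimes> y \<in> linked G H `` {x}"
    using linked_mult[OF l, of g] assms by auto
qed

lemma class_sum_add:
  assumes "x \<in> carrier G"
  shows "class_sum G H (f \<oplus>\<^bsub>T\<^esub> h) x = class_sum G H f x + class_sum G H h x"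
  unfolding class_sum_def sum.distrib[symmetric]
  using linked_closed assms by (intro sum.cong) (auto simp: T_add)

lemma class_sum_zero: "x \<in> carrier G \<Longrightarrow> class_sum G H \<zero>\<^bsub>T\<^esub> x = 0"
  unfolding class_sum_def using linked_closed by (intro sum.neutral) (auto simp: T_zero)

lemma class_sum_group_sum:
  assumes "set gs \<subseteq> carrier G" "x \<in> carrier G"
  shows "class_sum G H (group_sum T gs f) x = (\<Sum>g\<leftarrow>gs. class_sum G H f (inv g \<otimes> x))"
  using assms(1)
  by (induction gs) (use assms(2) in \<open>simp_all add: class_sum_zero class_sum_add class_sum_act\<close>)

lemma relation_kernel_subgroup:
  "subgroup (relation_kernel G H :: ('a \<Rightarrow> 'f::field) set) (add_monoid T)"
proof -
  interpret T: abelian_group "T :: ('f, _, _) group_module" by (rule T_abelian_group)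
  show ?thesis
  proof (rule T.add.subgroupI)
    show "relation_kernel G H \<subseteq> carrier (T :: ('f, _, _) group_module)"
      by (auto simp: relation_kernel_def T_carrier)
    have "\<zero>\<^bsub>T\<^esub> \<in> (relation_kernel G H :: ('a \<Rightarrow> 'f) set)"
      using class_sum_zero T.zero_closed by (auto simp: relation_kernel_def T_carrier)
    then show "(relation_kernel G H :: ('a \<Rightarrow> 'f) set) \<noteq> {}" by blast
  next
    fix f :: "'a \<Rightarrow> 'f" assume f: "f \<in> relation_kernel G H"
    then have fT: "f \<in> carrier T" by (simp add: relation_kernel_def T_carrier)
    have "class_sum G H (\<lambda>y\<in>carrier G. - f y) x = - class_sum G H f x" if "x \<in> carrier G" for x
      unfolding class_sum_def sum_negf[symmetric] using linked_closed that by (intro sum.cong) auto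
    then show "\<ominus>\<^bsub>T\<^esub> f \<in> relation_kernel G H"
      using f T_uminus[OF fT] by (auto simp: relation_kernel_def)
  next
    fix f h :: "'a \<Rightarrow> 'f" assume "f \<in> relation_kernel G H" "h \<in> relation_kernel G H"
    then show "f \<oplus>\<^bsub>T\<^esub> h \<in> relation_kernel G H"
      using T.a_closed[of f h] by (auto simp: relation_kernel_def class_sum_add T_carrier)
  qed
qed

lemma relation_kernel_stable:
  "stable_subgroup G T (relation_kernel G H :: ('a \<Rightarrow> 'f::field) set)"
proof -
  have "act T g f \<in> relation_kernel G H" if "g \<in> carrier G" "f \<in> relation_kernel G H"
    for g and f :: "'a \<Rightarrow> 'f"
    using that by (simp add: relation_kernel_def class_sum_act) (simp add: T_act)
  then show ?thesis using relation_kernel_subgroup by (simp add: stable_subgroup_def)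
qed

lemma group_sum_in_kernel_iff:
  fixes f :: "'a \<Rightarrow> 'f::field"
  assumes "set gs \<subseteq> carrier G" "f \<in> carrier T"
  shows "group_sum T gs f \<in> relation_kernel G H \<longleftrightarrow>
    (\<forall>x\<in>carrier G. (\<Sum>g\<leftarrow>gs. class_sum G H f (inv g \<otimes> x)) = 0)"
proof -
  have "stable_subgroup G T (carrier (T :: ('f, _, _) group_module))"
    using T_additive_action abelian_group.a_group[OF T_abelian_group] group.subgroup_self
    by (fastforce simp: stable_subgroup_def additive_action_def hom_def)
  then have "group_sum T gs f \<in> carrier T" using assms by (rule group_sum_closed)
  then show ?thesis using assms(1) by (simp add: relation_kernel_def class_sum_group_sum T_carrier)
qed

definition difference :: "'f::field \<Rightarrow> 'a \<Rightarrow> 'a \<Rightarrow> 'a \<Rightarrow> 'f" where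
  "difference c x y = (\<lambda>z\<in>carrier G. (if z = x then c else 0) - (if z = y then c else 0))"

lemma tensor_relations_eq:
  "tensor_relations G H (F :: ('f::field, _, _) group_module) =
    {difference c (x \<otimes> h) x | x h c. x \<in> carrier G \<and> h \<in> H}"
proof -
  interpret T: abelian_group "T :: ('f, _, _) group_module" by (rule T_abelian_group)
  have "pure_tensor G F (x \<otimes> h) c \<ominus>\<^bsub>T\<^esub> pure_tensor G F x (act F h c) = difference c (x \<otimes> h) x"
    if "x \<in> carrier G" for x h and c :: 'f
  proof -
    have "pure_tensor G F x (act F h c) \<in> carrier T"
      by (simp add: pure_tensor_def T_carrier)
    then have "pure_tensor G F (x \<otimes> h) c \<ominus>\<^bsub>T\<^esub> pure_tensor G F x (act F h c) =
      pure_tensor G F (x \<otimes> h) c \<oplus>\<^bsub>T\<^esub> (\<lambda>z\<in>carrier G. - pure_tensor G F x (act F h c) z)"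
      by (simp add: a_minus_def T_uminus)
    also have "\<dots> = difference c (x \<otimes> h) x"
      by (auto simp: T_add pure_tensor_def difference_def F_zero F_act)
    finally show ?thesis .
  qed
  then show ?thesis
    unfolding tensor_relations_def by (auto simp: trivial_module_def) metis+
qed

lemma difference_in_kernel:
  assumes "(x, y) \<in> linked G H" "x \<in> carrier G"
  shows "difference c x y \<in> relation_kernel G H"
proof -
  have "class_sum G H (difference c x y) z = 0" if "z \<in> carrier G" for z
  proof -
    have "class_sum G H (difference c x y) z =
      (\<Sum>w\<in>linked G H `` {z}. (if w = x then c else 0) - (if w = y then c else 0))"
      unfolding class_sum_def difference_def using linked_closed that by (intro sum.cong) auto
    also have "\<dots> = (if x \<in> linked G H `` {z} then c else 0) - (if y \<in> linked G H `` {z} then c else 0)"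
      using finite_class[OF that] by (simp add: sum_subtractf)
    also have "\<dots> = 0"
      using linked_trans[of z x y] linked_trans[of z y x] linked_sym[OF assms(1)] assms(1) by auto
    finally show ?thesis .
  qed
  then show ?thesis by (simp add: relation_kernel_def difference_def)
qed

text \<open>Moving every value of f to the representative of its class changes f by differences
  along links, which lie in the span by telescoping. What arrives at a representative is a class
  sum, hence zero.\<close>

lemma linear_span_relations:
  "linear_span T (tensor_relations G H (F :: ('f::field, _, _) group_module)) = relation_kernel G H"
proof
  have smult: "c \<odot>\<^bsub>T\<^esub> f \<in> relation_kernel G H" if "f \<in> relation_kernel G H" for c :: 'f and f
  proof -
    have "class_sum G H (\<lambda>y\<in>carrier G. c * f y) x = c * class_sum G H f x" if "x \<in> carrier G" for x
      unfolding class_sum_def sum_distrib_left using linked_closed that by (intro sum.cong) auto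
    then show ?thesis using that by (simp add: relation_kernel_def T_smult)
  qed
  then have "submodule (relation_kernel G H) ring_of_type_algebra (T :: ('f, _, _) group_module)"
    using relation_kernel_subgroup by (intro submodule.intro submodule_axioms.intro) auto
  moreover have "tensor_relations G H F \<subseteq> (relation_kernel G H :: ('a \<Rightarrow> 'f) set)"
    unfolding tensor_relations_eq
    using difference_in_kernel linked_sym[OF linked_step] H_subset by fastforce
  ultimately show "linear_span T (tensor_relations G H F) \<subseteq> (relation_kernel G H :: ('a \<Rightarrow> 'f) set)"
    unfolding linear_span_def by blast
next
  interpret T: abelian_group "T :: ('f, _, _) group_module" by (rule T_abelian_group)
  show "relation_kernel G H \<subseteq> linear_span T (tensor_relations G H (F :: ('f, _, _) group_module))"
    unfolding linear_span_def
  proof (intro subsetI InterI)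
    fix f :: "'a \<Rightarrow> 'f" and U :: "('a \<Rightarrow> 'f) set"
    assume f: "f \<in> relation_kernel G H"
      and "U \<in> {U. submodule U ring_of_type_algebra T \<and> tensor_relations G H F \<subseteq> U}"
    then have U: "subgroup U (add_monoid T)" and rel: "tensor_relations G H F \<subseteq> U"
      by (auto simp: submodule_def)
    have zero: "\<zero>\<^bsub>T\<^esub> \<in> U" using subgroup.one_closed[OF U] by simp
    have add: "u \<oplus>\<^bsub>T\<^esub> w \<in> U" if "u \<in> U" "w \<in> U" for u w
      using subgroup.m_closed[OF U that] by simp
    have "difference c x y \<in> U" if "(x, y) \<in> linked G H" "x \<in> carrier G" for c :: 'f and x y
      using that(1)
    proof (induction rule: linked_induct)
      case refl
      have "difference c x x = \<zero>\<^bsub>T\<^esub>" by (auto simp: difference_def T_zero)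
      then show ?case using zero by simp
    next
      case (step z h)
      have "difference (- c) (z \<otimes> h) z \<in> U" using step(1,2) rel by (auto simp: tensor_relations_eq)
      then have "difference c x z \<oplus>\<^bsub>T\<^esub> difference (- c) (z \<otimes> h) z \<in> U" using step by (intro add) auto
      also have "difference c x z \<oplus>\<^bsub>T\<^esub> difference (- c) (z \<otimes> h) z = difference c x (z \<otimes> h)"
        by (auto simp: difference_def T_add)
      finally show ?case .
    next
      case (unstep z h)
      have "difference c (z \<otimes> h) z \<in> U" using unstep(1,2) rel by (auto simp: tensor_relations_eq)
      then have "difference c x (z \<otimes> h) \<oplus>\<^bsub>T\<^esub> difference c (z \<otimes> h) z \<in> U" using unstep by (intro add) auto
      also have "difference c x (z \<otimes> h) \<oplus>\<^bsub>T\<^esub> difference c (z \<otimes> h) z = difference c x z"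
        by (auto simp: difference_def T_add)
      finally show ?case .
    qed
    note difference_U = this
    \<comment> \<open>The choice depends only on the class as a set, so linked elements share their
      representative.\<close>
    define rep where "rep x = (SOME y. y \<in> linked G H `` {x})" for x
    have rep: "(x, rep x) \<in> linked G H" for x
      unfolding rep_def using someI[of "\<lambda>y. y \<in> linked G H `` {x}" x] linked_refl by simp
    have rep_eq: "rep x = rep y" if "(x, y) \<in> linked G H" for x y
      unfolding rep_def class_eq[OF that] by simp
    have partial: "(\<lambda>z\<in>carrier G. \<Sum>x\<in>A. difference (f x) x (rep x) z) \<in> U"
      if "finite A" "A \<subseteq> carrier G" for A
      using that
    proof (induction A)
      case empty
      show ?case using zero unfolding T_zero sum.empty .
    next
      case (insert x A)
      have "difference (f x) x (rep x) \<oplus>\<^bsub>T\<^esub> (\<lambda>z\<in>carrier G. \<Sum>x\<in>A. difference (f x) x (rep x) z) \<in> U"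
      proof (rule add)
        show "difference (f x) x (rep x) \<in> U" using insert.prems rep by (intro difference_U) auto
        show "(\<lambda>z\<in>carrier G. \<Sum>x\<in>A. difference (f x) x (rep x) z) \<in> U"
          using insert.prems by (intro insert.IH) auto
      qed
      also have "difference (f x) x (rep x) \<oplus>\<^bsub>T\<^esub> (\<lambda>z\<in>carrier G. \<Sum>x\<in>A. difference (f x) x (rep x) z) =
          (\<lambda>z\<in>carrier G. \<Sum>x\<in>insert x A. difference (f x) x (rep x) z)"
        using insert.hyps by (intro ext) (simp add: T_add)
      finally show ?case .
    qed
    have "(\<Sum>x\<in>carrier G. difference (f x) x (rep x) z) = f z" if z: "z \<in> carrier G" for z
    proof -
      have "(\<Sum>x\<in>carrier G. difference (f x) x (rep x) z) =
        (\<Sum>x\<in>carrier G. if z = x then f x else 0) - (\<Sum>x\<in>carrier G. if z = rep x then f x else 0)"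
        using z by (simp add: difference_def sum_subtractf)
      also have "(\<Sum>x\<in>carrier G. if z = x then f x else 0) = f z"
        using z finite_carrier by simp
      also have "(\<Sum>x\<in>carrier G. if z = rep x then f x else 0) = 0"
      proof (cases "rep z = z")
        case True
        have "{x \<in> carrier G. z = rep x} = linked G H `` {z}"
        proof (intro equalityI subsetI)
          fix x assume "x \<in> {x \<in> carrier G. z = rep x}"
          then have "(x, z) \<in> linked G H" using rep[of x] by simp
          then show "x \<in> linked G H `` {z}" using linked_sym by simp
        next
          fix x assume "x \<in> linked G H `` {z}"
          then have l: "(z, x) \<in> linked G H" by simp
          show "x \<in> {x \<in> carrier G. z = rep x}"
            using linked_closed[OF l z] rep_eq[OF l] True by simp
        qed
        then have "(\<Sum>x\<in>carrier G. if z = rep x then f x else 0) = class_sum G H f z"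
          using sum.inter_filter[OF finite_carrier, of f "\<lambda>x. z = rep x"]
          by (simp add: class_sum_def)
        then show ?thesis using f z by (simp add: relation_kernel_def)
      next
        case False
        have "z \<noteq> rep x" for x
          using rep_eq[OF rep[of x]] False by auto
        then show ?thesis by simp
      qed
      finally show ?thesis by simp
    qed
    moreover have "f \<in> extensional (carrier G)" using f by (simp add: relation_kernel_def PiE_def)
    ultimately have "(\<lambda>z\<in>carrier G. \<Sum>x\<in>carrier G. difference (f x) x (rep x) z) = f"
      by (intro ext) (simp add: extensional_def)
    then show "f \<in> U" using partial[OF finite_carrier subset_refl] by (simp only:)
  qed
qed

text \<open>Put the prescribed value at one representative of each class and 0 elsewhere.\<close>

lemma class_sum_surjective:
  fixes \<beta> :: "'a \<Rightarrow> 'f::field"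
  assumes "\<And>x h. x \<in> carrier G \<Longrightarrow> h \<in> H \<Longrightarrow> \<beta> (x \<otimes> h) = \<beta> x"
  obtains f where "f \<in> carrier T" "\<And>x. x \<in> carrier G \<Longrightarrow> class_sum G H f x = \<beta> x"
proof -
  have const: "\<beta> y = \<beta> x" if "(x, y) \<in> linked G H" for x y
    using that by (induction rule: linked_induct) (simp_all add: assms)
  define rep where "rep x = (SOME y. y \<in> linked G H `` {x})" for x
  have rep: "(x, rep x) \<in> linked G H" for x
    unfolding rep_def using someI[of "\<lambda>y. y \<in> linked G H `` {x}" x] linked_refl by simp
  have rep_eq: "rep x = rep y" if "(x, y) \<in> linked G H" for x y
    unfolding rep_def class_eq[OF that] by simp
  show thesis
  proof (rule that)
    show "(\<lambda>y\<in>carrier G. if y = rep y then \<beta> y else 0) \<in> carrier T"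
      by (simp add: T_carrier)
    fix x assume x: "x \<in> carrier G"
    have "class_sum G H (\<lambda>y\<in>carrier G. if y = rep y then \<beta> y else 0) x =
      (\<Sum>y\<in>linked G H `` {x}. if y = rep x then \<beta> (rep x) else 0)"
      unfolding class_sum_def using linked_closed x rep_eq by (intro sum.cong) auto
    also have "\<dots> = \<beta> (rep x)" using finite_class[OF x] rep[of x] by simp
    also have "\<dots> = \<beta> x" using const rep by blast
    finally show "class_sum G H (\<lambda>y\<in>carrier G. if y = rep y then \<beta> y else 0) x = \<beta> x" .
  qed
qed

lemma class_sum_right_mult:
  assumes "x \<in> carrier G" "h \<in> H"
  shows "class_sum G H f (x \<otimes> h) = class_sum G H f x"
  unfolding class_sum_def class_eq[OF linked_step[OF assms]] by simp

end

section \<open>Polytabloids\<close>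

text \<open>With positions of entries, row and column equivalence become equations between
  coordinates instead of statements about cells.\<close>

definition position :: "nat list \<Rightarrow> (nat \<times> nat \<Rightarrow> nat) \<Rightarrow> nat \<Rightarrow> nat \<times> nat" where
  "position \<mu> t = inv_into (young_diagram \<mu>) t"

abbreviation row_of :: "nat list \<Rightarrow> (nat \<times> nat \<Rightarrow> nat) \<Rightarrow> nat \<Rightarrow> nat" where
  "row_of \<mu> t k \<equiv> fst (position \<mu> t k)"

abbreviation col_of :: "nat list \<Rightarrow> (nat \<times> nat \<Rightarrow> nat) \<Rightarrow> nat \<Rightarrow> nat" where
  "col_of \<mu> t k \<equiv> snd (position \<mu> t k)"

locale shape =
  fixes n :: nat and \<mu> :: "nat list"
  assumes partition: "is_partition n \<mu>"
begin

abbreviation "pos \<equiv> position \<mu>"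
abbreviation "trow \<equiv> row_of \<mu>"
abbreviation "tcol \<equiv> col_of \<mu>"
abbreviation "tact \<equiv> tableau_act \<mu>"

lemma sum_list_eq: "sum_list \<mu> = n"
  using partition by (simp add: is_partition_def)

lemma tableau_bij: "t \<in> tableaux \<mu> \<Longrightarrow> bij_betw t (young_diagram \<mu>) {1..n}"
  by (simp add: tableaux_def sum_list_eq)

lemma position_in_diagram: "t \<in> tableaux \<mu> \<Longrightarrow> k \<in> {1..n} \<Longrightarrow> pos t k \<in> young_diagram \<mu>"
  unfolding position_def using tableau_bij by (metis bij_betw_imp_surj_on inv_into_into)

lemma tableau_position: "t \<in> tableaux \<mu> \<Longrightarrow> k \<in> {1..n} \<Longrightarrow> t (pos t k) = k"
  unfolding position_def using tableau_bij by (metis bij_betw_imp_surj_on f_inv_into_f)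

lemma position_tableau: "t \<in> tableaux \<mu> \<Longrightarrow> x \<in> young_diagram \<mu> \<Longrightarrow> pos t (t x) = x"
  unfolding position_def using tableau_bij by (metis bij_betw_imp_inj_on inv_into_f_f)

lemma tableau_in: "t \<in> tableaux \<mu> \<Longrightarrow> x \<in> young_diagram \<mu> \<Longrightarrow> t x \<in> {1..n}"
  using tableau_bij bij_betwE by blast

lemma position_eqI: "t \<in> tableaux \<mu> \<Longrightarrow> x \<in> young_diagram \<mu> \<Longrightarrow> t x = k \<Longrightarrow> pos t k = x"
  using position_tableau by blast

lemma position_inj:
  assumes "t \<in> tableaux \<mu>" "k \<in> {1..n}" "l \<in> {1..n}" "trow t k = trow t l" "tcol t k = tcol t l"
  shows "k = l"
  using assms tableau_position by (metis prod_eqI)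

lemma row_less: "t \<in> tableaux \<mu> \<Longrightarrow> k \<in> {1..n} \<Longrightarrow> trow t k < length \<mu>"
  using position_in_diagram[of t k] by (auto simp: young_diagram_def)

lemma col_less: "t \<in> tableaux \<mu> \<Longrightarrow> k \<in> {1..n} \<Longrightarrow> tcol t k < \<mu> ! trow t k"
  using position_in_diagram[of t k] by (auto simp: young_diagram_def)

lemma tact_in_tableaux:
  assumes "t \<in> tableaux \<mu>" "p permutes {1..n}"
  shows "tact p t \<in> tableaux \<mu>"
proof -
  have "bij_betw (p \<circ> t) (young_diagram \<mu>) {1..n}"
    using tableau_bij[OF assms(1)] permutes_imp_bij[OF assms(2)] by (rule bij_betw_trans)
  then have "bij_betw (tact p t) (young_diagram \<mu>) {1..n}"
    by (rule iffD1[OF bij_betw_cong, rotated]) (simp add: tableau_act_def)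
  then show ?thesis by (simp add: tableaux_def sum_list_eq tableau_act_def)
qed

lemma tact_compose: "t \<in> tableaux \<mu> \<Longrightarrow> tact p (tact q t) = tact (p \<circ> q) t"
  by (auto simp: tableau_act_def)

lemma tact_id: "t \<in> tableaux \<mu> \<Longrightarrow> tact id t = t"
  by (auto simp: tableau_act_def tableaux_def extensional_def)

lemma position_tact:
  assumes "t \<in> tableaux \<mu>" "p permutes {1..n}" "k \<in> {1..n}"
  shows "pos (tact p t) (p k) = pos t k"
  using assms position_in_diagram[OF assms(1,3)] tableau_position[OF assms(1,3)]
  by (intro position_eqI tact_in_tableaux) (auto simp: tableau_act_def)

lemma position_tact_inv:
  assumes "t \<in> tableaux \<mu>" "p permutes {1..n}" "k \<in> {1..n}"
  shows "pos (tact p t) k = pos t (inv' p k)"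
  using position_tact[OF assms(1,2), of "inv' p k"] assms permutes_in_image[OF permutes_inv[OF assms(2)], of k]
  by (simp add: permutes_inverses)

lemma row_stabilizer_iff:
  assumes t: "t \<in> tableaux \<mu>"
  shows "p \<in> row_stabilizer \<mu> t \<longleftrightarrow> p permutes {1..n} \<and> (\<forall>k\<in>{1..n}. trow t (p k) = trow t k)"
proof (cases "p permutes {1..n}")
  case p: True
  have "(\<forall>(i, j)\<in>young_diagram \<mu>. \<exists>j'. (i, j') \<in> young_diagram \<mu> \<and> p (t (i, j)) = t (i, j')) \<longleftrightarrow>
      (\<forall>k\<in>{1..n}. trow t (p k) = trow t k)"
  proof (intro iffI ballI)
    fix k assume *: "\<forall>(i, j)\<in>young_diagram \<mu>. \<exists>j'. (i, j') \<in> young_diagram \<mu> \<and> p (t (i, j)) = t (i, j')"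
      and k: "k \<in> {1..n}"
    obtain j' where j': "(trow t k, j') \<in> young_diagram \<mu>" "p (t (pos t k)) = t (trow t k, j')"
      using bspec[OF * position_in_diagram[OF t k]] by (auto simp: split_beta)
    then have "pos t (p k) = (trow t k, j')"
      using t tableau_position[OF t k] by (intro position_eqI) auto
    then show "trow t (p k) = trow t k" by simp
  next
    fix x assume *: "\<forall>k\<in>{1..n}. trow t (p k) = trow t k" and x: "x \<in> young_diagram \<mu>"
    have pk: "p (t x) \<in> {1..n}" using permutes_in_image[OF p] tableau_in[OF t x] by simp
    have "trow t (p (t x)) = fst x"
      using * tableau_in[OF t x] position_tableau[OF t x] by auto
    then obtain c where e: "pos t (p (t x)) = (fst x, c)" by (metis prod.collapse)
    have "(fst x, c) \<in> young_diagram \<mu> \<and> p (t x) = t (fst x, c)"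
      using position_in_diagram[OF t pk] tableau_position[OF t pk] unfolding e by simp
    then show "case x of (i, j) \<Rightarrow> \<exists>j'. (i, j') \<in> young_diagram \<mu> \<and> p (t (i, j)) = t (i, j')"
      unfolding split_beta by auto
  qed
  then show ?thesis using p by (simp add: row_stabilizer_def sym_group_carrier sum_list_eq)
qed (simp add: row_stabilizer_def sym_group_carrier sum_list_eq)

lemma column_stabilizer_iff:
  assumes t: "t \<in> tableaux \<mu>"
  shows "p \<in> column_stabilizer \<mu> t \<longleftrightarrow> p permutes {1..n} \<and> (\<forall>k\<in>{1..n}. tcol t (p k) = tcol t k)"
proof (cases "p permutes {1..n}")
  case p: True
  have "(\<forall>(i, j)\<in>young_diagram \<mu>. \<exists>i'. (i', j) \<in> young_diagram \<mu> \<and> p (t (i, j)) = t (i', j)) \<longleftrightarrow>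
      (\<forall>k\<in>{1..n}. tcol t (p k) = tcol t k)"
  proof (intro iffI ballI)
    fix k assume *: "\<forall>(i, j)\<in>young_diagram \<mu>. \<exists>i'. (i', j) \<in> young_diagram \<mu> \<and> p (t (i, j)) = t (i', j)"
      and k: "k \<in> {1..n}"
    obtain i' where i': "(i', tcol t k) \<in> young_diagram \<mu>" "p (t (pos t k)) = t (i', tcol t k)"
      using bspec[OF * position_in_diagram[OF t k]] by (auto simp: split_beta)
    then have "pos t (p k) = (i', tcol t k)"
      using t tableau_position[OF t k] by (intro position_eqI) auto
    then show "tcol t (p k) = tcol t k" by simp
  next
    fix x assume *: "\<forall>k\<in>{1..n}. tcol t (p k) = tcol t k" and x: "x \<in> young_diagram \<mu>"
    have pk: "p (t x) \<in> {1..n}" using permutes_in_image[OF p] tableau_in[OF t x] by simp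
    have "tcol t (p (t x)) = snd x"
      using * tableau_in[OF t x] position_tableau[OF t x] by auto
    then obtain c where e: "pos t (p (t x)) = (c, snd x)" by (metis prod.collapse)
    have "(c, snd x) \<in> young_diagram \<mu> \<and> p (t x) = t (c, snd x)"
      using position_in_diagram[OF t pk] tableau_position[OF t pk] unfolding e by simp
    then show "case x of (i, j) \<Rightarrow> \<exists>i'. (i', j) \<in> young_diagram \<mu> \<and> p (t (i, j)) = t (i', j)"
      unfolding split_beta by auto
  qed
  then show ?thesis using p by (simp add: column_stabilizer_def sym_group_carrier sum_list_eq)
qed (simp add: column_stabilizer_def sym_group_carrier sum_list_eq)

text \<open>If u and t agree on the row of every entry, then u composed with the inverse of t
  preserves the rows of t and carries t to u.\<close>

lemma tabloid_eq_Collect: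
  assumes t: "t \<in> tableaux \<mu>"
  shows "tabloid \<mu> t = {u \<in> tableaux \<mu>. \<forall>k\<in>{1..n}. trow u k = trow t k}"
proof (intro equalityI subsetI)
  fix u assume "u \<in> tabloid \<mu> t"
  then obtain p where p: "p permutes {1..n}" "\<And>k. k \<in> {1..n} \<Longrightarrow> trow t (p k) = trow t k" "u = tact p t"
    by (auto simp: tabloid_def row_stabilizer_iff[OF t])
  have "trow u k = trow t k" if "k \<in> {1..n}" for k
  proof -
    have "inv' p k \<in> {1..n}" using permutes_in_image[OF permutes_inv[OF p(1)]] that by simp
    then show ?thesis
      using p(2)[of "inv' p k"] p(1,3) position_tact_inv[OF t p(1) that] by (simp add: permutes_inverses)
  qed
  then show "u \<in> {u \<in> tableaux \<mu>. \<forall>k\<in>{1..n}. trow u k = trow t k}"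
    using p tact_in_tableaux[OF t] by simp
next
  fix u assume "u \<in> {u \<in> tableaux \<mu>. \<forall>k\<in>{1..n}. trow u k = trow t k}"
  then have u: "u \<in> tableaux \<mu>" "\<And>k. k \<in> {1..n} \<Longrightarrow> trow u k = trow t k" by auto
  define p where "p k = (if k \<in> {1..n} then u (pos t k) else k)" for k
  have "bij_betw (u \<circ> pos t) {1..n} {1..n}"
    using bij_betw_inv_into[OF tableau_bij[OF t]] tableau_bij[OF u(1)]
    unfolding position_def by (rule bij_betw_trans)
  then have "bij_betw p {1..n} {1..n}"
    by (rule iffD1[OF bij_betw_cong, rotated]) (simp add: p_def)
  then have p: "p permutes {1..n}"
    by (rule bij_imp_permutes) (simp add: p_def del: atLeastAtMost_iff)
  have "trow t (p k) = trow t k" if k: "k \<in> {1..n}" for k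
  proof -
    have "trow t (p k) = trow u (p k)" using u(2) permutes_in_image[OF p] k by simp
    also have "\<dots> = trow t k" using k position_tableau[OF u(1) position_in_diagram[OF t k]] by (simp add: p_def)
    finally show ?thesis .
  qed
  moreover have "u = tact p t"
    using u(1) tableau_in[OF t] position_tableau[OF t]
    by (auto simp: tableau_act_def p_def tableaux_def extensional_def fun_eq_iff)
  ultimately show "u \<in> tabloid \<mu> t"
    using p by (auto simp: tabloid_def row_stabilizer_iff[OF t])
qed

lemma tabloid_eq_iff:
  assumes "t \<in> tableaux \<mu>" "u \<in> tableaux \<mu>"
  shows "tabloid \<mu> t = tabloid \<mu> u \<longleftrightarrow> (\<forall>k\<in>{1..n}. trow t k = trow u k)"
  using assms unfolding tabloid_eq_Collect[OF assms(1)] tabloid_eq_Collect[OF assms(2)] by auto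

lemma tact_tabloid:
  assumes t: "t \<in> tableaux \<mu>" and p: "p permutes {1..n}"
  shows "tact p ` tabloid \<mu> t = tabloid \<mu> (tact p t)"
proof -
  have sub: "tact p ` tabloid \<mu> t \<subseteq> tabloid \<mu> (tact p t)" if "t \<in> tableaux \<mu>" "p permutes {1..n}" for p t
    using that permutes_in_image[OF permutes_inv[OF that(2)]]
    by (auto simp: tabloid_eq_Collect tact_in_tableaux position_tact_inv)
  have "tabloid \<mu> (tact p t) \<subseteq> tact p ` tabloid \<mu> t"
  proof
    fix u assume u: "u \<in> tabloid \<mu> (tact p t)"
    then have uT: "u \<in> tableaux \<mu>" using tabloid_eq_Collect[OF tact_in_tableaux[OF t p]] by auto
    have "tact (inv' p) u \<in> tabloid \<mu> (tact (inv' p) (tact p t))"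
      using sub[OF tact_in_tableaux[OF t p] permutes_inv[OF p]] u by blast
    then have "tact (inv' p) u \<in> tabloid \<mu> t"
      using t p by (simp add: tact_compose permutes_inv_o tact_id)
    moreover have "u = tact p (tact (inv' p) u)"
      using uT p by (simp add: tact_compose permutes_inv_o tact_id)
    ultimately show "u \<in> tact p ` tabloid \<mu> t" by blast
  qed
  then show ?thesis using sub[OF t p] by blast
qed

text \<open>The coefficient of a tabloid in a polytabloid, indexed by a tableau of that tabloid so
  that permutations act directly on the index.\<close>

definition polytabloid_at :: "(nat \<times> nat \<Rightarrow> nat) \<Rightarrow> (nat \<times> nat \<Rightarrow> nat) \<Rightarrow> 'f::field" where
  "polytabloid_at t u = polytabloid \<mu> t (tabloid \<mu> u)"

lemma finite_column_stabilizer: "finite (column_stabilizer \<mu> t)"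
  by (rule finite_subset[OF _ finite_permutations[of "{1..n}"]])
     (auto simp: column_stabilizer_def sym_group_carrier sum_list_eq)

text \<open>Reindexing the defining sum by left multiplication with q multiplies every sign by that
  of q.\<close>

lemma polytabloid_at_column:
  assumes t: "t \<in> tableaux \<mu>" and u: "u \<in> tableaux \<mu>" and q: "q \<in> column_stabilizer \<mu> t"
  shows "polytabloid_at t (tact q u) = (of_int (sign q) * polytabloid_at t u :: 'f::field)"
proof -
  have qp: "q permutes {1..n}" and qc: "\<And>k. k \<in> {1..n} \<Longrightarrow> tcol t (q k) = tcol t k"
    using q by (auto simp: column_stabilizer_iff[OF t])
  have mem: "q \<circ> p \<in> column_stabilizer \<mu> t" if "p \<in> column_stabilizer \<mu> t" for p
  proof -
    have p: "p permutes {1..n}" "\<And>k. k \<in> {1..n} \<Longrightarrow> tcol t (p k) = tcol t k"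
      using that by (auto simp: column_stabilizer_iff[OF t])
    have "tcol t (q (p k)) = tcol t k" if "k \<in> {1..n}" for k
      using qc[of "p k"] p(2)[OF that] permutes_in_image[OF p(1)] that by simp
    then show ?thesis
      using permutes_compose[OF p(1) qp] by (simp add: column_stabilizer_iff[OF t])
  qed
  have mem': "inv' q \<circ> p \<in> column_stabilizer \<mu> t" if "p \<in> column_stabilizer \<mu> t" for p
  proof -
    have p: "p permutes {1..n}" "\<And>k. k \<in> {1..n} \<Longrightarrow> tcol t (p k) = tcol t k"
      using that by (auto simp: column_stabilizer_iff[OF t])
    have "tcol t (inv' q (p k)) = tcol t k" if "k \<in> {1..n}" for k
    proof -
      have "inv' q (p k) \<in> {1..n}"
        using permutes_in_image[OF permutes_inv[OF qp]] permutes_in_image[OF p(1)] that by simp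
      then show ?thesis
        using qc[of "inv' q (p k)"] p(2)[OF that] permutes_inverses(1)[OF qp] by simp
    qed
    then show ?thesis
      using permutes_compose[OF p(1) permutes_inv[OF qp]] by (simp add: column_stabilizer_iff[OF t])
  qed
  have "polytabloid_at t (tact q u) = (\<Sum>p\<in>column_stabilizer \<mu> t.
       of_int (sign (q \<circ> p)) * (if tabloid \<mu> (tact q u) = tabloid \<mu> (tact (q \<circ> p) t) then 1 else 0) :: 'f)"
    unfolding polytabloid_at_def polytabloid_def
  proof (rule sum.reindex_bij_witness[of _ "\<lambda>p. q \<circ> p" "\<lambda>p. inv' q \<circ> p"])
    fix p :: "nat \<Rightarrow> nat"
    have "q \<circ> (inv' q \<circ> p) = p" "inv' q \<circ> (q \<circ> p) = p"
      using permutes_inv_o[OF qp] by (simp_all only: o_assoc id_o)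
    then show "q \<circ> (inv' q \<circ> p) = p" "inv' q \<circ> (q \<circ> p) = p"
      "of_int (sign (q \<circ> (inv' q \<circ> p))) *
        (if tabloid \<mu> (tact q u) = tabloid \<mu> (tact (q \<circ> (inv' q \<circ> p)) t) then 1 else 0) =
       (of_int (sign p) * (if tabloid \<mu> (tact q u) = tabloid \<mu> (tact p t) then 1 else 0) :: 'f)"
      by (simp_all only:)
  qed (rule mem mem', assumption)+
  also have "\<dots> = (\<Sum>p\<in>column_stabilizer \<mu> t.
       of_int (sign q) * (of_int (sign p) * (if tabloid \<mu> u = tabloid \<mu> (tact p t) then 1 else 0)))"
  proof (rule sum.cong[OF refl])
    fix p assume "p \<in> column_stabilizer \<mu> t"
    then have p: "p permutes {1..n}" by (simp add: column_stabilizer_iff[OF t])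
    have "tabloid \<mu> (tact q u) = tabloid \<mu> (tact (q \<circ> p) t) \<longleftrightarrow>
        tact q ` tabloid \<mu> u = tact q ` tabloid \<mu> (tact p t)"
      using t u p qp by (simp add: tact_tabloid tact_in_tableaux tact_compose)
    also have "\<dots> \<longleftrightarrow> tabloid \<mu> u = tabloid \<mu> (tact p t)"
    proof
      assume eq: "tact q ` tabloid \<mu> u = tact q ` tabloid \<mu> (tact p t)"
      have inv: "tact (inv' q) ` tact q ` tabloid \<mu> w = tabloid \<mu> w" if "w \<in> tableaux \<mu>" for w
        using that qp by (simp add: tact_tabloid tact_in_tableaux permutes_inv tact_compose permutes_inv_o tact_id)
      have "tabloid \<mu> u = tact (inv' q) ` tact q ` tabloid \<mu> u"
        by (rule inv[OF u, symmetric])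
      also have "\<dots> = tabloid \<mu> (tact p t)"
        unfolding eq by (rule inv[OF tact_in_tableaux[OF t p]])
      finally show "tabloid \<mu> u = tabloid \<mu> (tact p t)" .
    qed simp
    finally have iff: "tabloid \<mu> (tact q u) = tabloid \<mu> (tact (q \<circ> p) t) \<longleftrightarrow> tabloid \<mu> u = tabloid \<mu> (tact p t)" .
    have "sign (q \<circ> p) = sign q * sign p"
      using p qp by (intro sign_compose) (auto simp: permutation_permutes)
    then show "of_int (sign (q \<circ> p)) * (if tabloid \<mu> (tact q u) = tabloid \<mu> (tact (q \<circ> p) t) then 1 else 0) =
       (of_int (sign q) * (of_int (sign p) * (if tabloid \<mu> u = tabloid \<mu> (tact p t) then 1 else 0)) :: 'f)"
      by (simp add: iff)
  qed
  also have "\<dots> = of_int (sign q) * polytabloid_at t u"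
    by (simp add: polytabloid_at_def polytabloid_def sum_distrib_left)
  finally show ?thesis .
qed

text \<open>If a column permutation p carried t into the tabloid of u, the preimages of k and l
  under p would share both their row and their column in t, so k = l.\<close>

lemma polytabloid_at_clash:
  assumes t: "t \<in> tableaux \<mu>" and u: "u \<in> tableaux \<mu>" and kl: "k \<in> {1..n}" "l \<in> {1..n}" "k \<noteq> l"
    and col: "tcol t k = tcol t l" and row: "trow u k = trow u l"
  shows "polytabloid_at t u = 0"
proof -
  have "tabloid \<mu> u \<noteq> tabloid \<mu> (tact p t)" if p: "p \<in> column_stabilizer \<mu> t" for p
  proof
    assume eq: "tabloid \<mu> u = tabloid \<mu> (tact p t)"
    have pp: "p permutes {1..n}" and pc: "\<And>k. k \<in> {1..n} \<Longrightarrow> tcol t (p k) = tcol t k"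
      using p by (auto simp: column_stabilizer_iff[OF t])
    have inv: "inv' p j \<in> {1..n}" "trow t (inv' p j) = trow u j" "tcol t (inv' p j) = tcol t j" if j: "j \<in> {1..n}" for j
    proof -
      show 1: "inv' p j \<in> {1..n}" using permutes_in_image[OF permutes_inv[OF pp]] j by simp
      show "trow t (inv' p j) = trow u j"
        using bspec[OF iffD1[OF tabloid_eq_iff[OF u tact_in_tableaux[OF t pp]] eq] j]
        unfolding position_tact_inv[OF t pp j] by (rule sym)
      show "tcol t (inv' p j) = tcol t j"
        using pc[OF 1] pp by (simp add: permutes_inverses)
    qed
    have "inv' p k = inv' p l"
      using inv(1)[OF kl(1)] inv(1)[OF kl(2)]
    proof (rule position_inj[OF t])
      show "trow t (inv' p k) = trow t (inv' p l)" using inv(2) kl row by metis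
      show "tcol t (inv' p k) = tcol t (inv' p l)" using inv(3) kl col by metis
    qed
    then have "p (inv' p k) = p (inv' p l)" by (rule arg_cong)
    then show False using kl(3) unfolding permutes_inverses(1)[OF pp] by simp
  qed
  then show ?thesis by (auto simp: polytabloid_at_def polytabloid_def intro!: sum.neutral)
qed

text \<open>A column permutation that also preserves the rows is the identity, so a single term
  survives.\<close>

lemma polytabloid_at_self:
  assumes t: "t \<in> tableaux \<mu>"
  shows "polytabloid_at t t = (1 :: 'f::field)"
proof -
  have eq: "tabloid \<mu> t = tabloid \<mu> (tact p t) \<longleftrightarrow> p = id" if p: "p \<in> column_stabilizer \<mu> t" for p
  proof
    assume eq: "tabloid \<mu> t = tabloid \<mu> (tact p t)"
    have pp: "p permutes {1..n}" and pc: "\<And>k. k \<in> {1..n} \<Longrightarrow> tcol t (p k) = tcol t k"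
      using p by (auto simp: column_stabilizer_iff[OF t])
    have "p k = k" if k: "k \<in> {1..n}" for k
    proof -
      have pk: "p k \<in> {1..n}" using permutes_in_image[OF pp] k by simp
      have "trow t (p k) = trow t k"
        using bspec[OF iffD1[OF tabloid_eq_iff[OF t tact_in_tableaux[OF t pp]] eq] pk]
        unfolding position_tact[OF t pp k] .
      then show ?thesis by (rule position_inj[OF t pk k _ pc[OF k]])
    qed
    then show "p = id" using permutes_not_in[OF pp] by (auto simp: fun_eq_iff)
  qed (simp add: tact_id t)
  have "id \<in> column_stabilizer \<mu> t" by (simp add: column_stabilizer_iff[OF t] permutes_id)
  have "polytabloid_at t t = (\<Sum>p\<in>column_stabilizer \<mu> t. if p = id then 1 else 0 :: 'f)"
    unfolding polytabloid_at_def polytabloid_def by (intro sum.cong) (auto simp: eq sign_id)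
  also have "\<dots> = 1" using \<open>id \<in> _\<close> finite_column_stabilizer by simp
  finally show ?thesis .
qed

section \<open>The Specht module inside the functions on tabloids\<close>

abbreviation "\<Omega> \<equiv> tabloid \<mu> ` tableaux \<mu>"

lemma tabloid_module_simps:
  "carrier (tabloid_module \<mu>) = {f. \<forall>x. x \<notin> \<Omega> \<longrightarrow> f x = (0::'f::field)}"
  "\<zero>\<^bsub>tabloid_module \<mu>\<^esub> = (\<lambda>x. 0 :: 'f)"
  "f \<oplus>\<^bsub>tabloid_module \<mu>\<^esub> h = (\<lambda>x. f x + h x :: 'f)"
  "c \<odot>\<^bsub>tabloid_module \<mu>\<^esub> f = (\<lambda>x. c * f x :: 'f)"
  by (simp_all add: tabloid_module_def permutation_module_def)

lemma tabloid_module_act: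
  assumes "g permutes {1..n}" "t \<in> tableaux \<mu>"
  shows "act (tabloid_module \<mu>) g w (tabloid \<mu> t) = w (tabloid \<mu> (tact (inv' g) t))"
proof -
  have "g \<in> carrier (sym_group n)" using assms by (simp add: sym_group_carrier)
  then show ?thesis
    using assms by (simp add: tabloid_module_def permutation_module_def sum_list_eq
      sym_group_inv_equality tact_tabloid permutes_inv)
qed

lemma specht_module_simps:
  "\<zero>\<^bsub>specht_module \<mu>\<^esub> = (\<lambda>x. 0 :: 'f::field)"
  "f \<oplus>\<^bsub>specht_module \<mu>\<^esub> h = (\<lambda>x. f x + h x :: 'f)"
  "act (specht_module \<mu> :: ('f, _, _) group_module) = act (tabloid_module \<mu>)"
  by (simp_all add: specht_module_def tabloid_module_simps)

lemma specht_group_sum: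
  assumes "\<And>g. g \<in> set gs \<Longrightarrow> g permutes {1..n}" "t \<in> tableaux \<mu>"
  shows "group_sum (specht_module \<mu>) gs w (tabloid \<mu> t) = (\<Sum>g\<leftarrow>gs. w (tabloid \<mu> (tact (inv' g) t)))"
  using assms(1)
  by (induction gs) (use assms(2) in \<open>simp_all add: specht_module_simps tabloid_module_act\<close>)

lemma tabloid_submoduleI:
  fixes U :: "((nat \<times> nat \<Rightarrow> nat) set \<Rightarrow> 'f::field) set"
  assumes "U \<subseteq> carrier (tabloid_module \<mu>)" "(\<lambda>x. 0) \<in> U"
    and "\<And>f h. f \<in> U \<Longrightarrow> h \<in> U \<Longrightarrow> (\<lambda>x. f x + h x) \<in> U"
    and "\<And>c f. f \<in> U \<Longrightarrow> (\<lambda>x. c * f x) \<in> U"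
  shows "submodule U ring_of_type_algebra (tabloid_module \<mu>)"
proof -
  have uminus: "(\<lambda>x. - f x) \<in> U" if "f \<in> U" for f
    using assms(4)[OF that, of "- 1"] by simp
  interpret abelian_group "tabloid_module \<mu> :: ('f, _, _) group_module"
  proof (rule abelian_groupI)
    fix f :: "(nat \<times> nat \<Rightarrow> nat) set \<Rightarrow> 'f" assume "f \<in> carrier (tabloid_module \<mu>)"
    then show "\<exists>h\<in>carrier (tabloid_module \<mu>). h \<oplus>\<^bsub>tabloid_module \<mu>\<^esub> f = \<zero>\<^bsub>tabloid_module \<mu>\<^esub>"
      by (intro bexI[of _ "\<lambda>x. - f x"]) (auto simp: tabloid_module_simps)
  qed (auto simp: tabloid_module_simps algebra_simps)
  have "subgroup U (add_monoid (tabloid_module \<mu>))"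
  proof (rule add.subgroupI)
    fix f assume f: "f \<in> U"
    have "\<ominus>\<^bsub>tabloid_module \<mu>\<^esub> f = (\<lambda>x. - f x)"
      using f assms(1) uminus[OF f] by (intro minus_equality) (auto simp: tabloid_module_simps)
    then show "\<ominus>\<^bsub>tabloid_module \<mu>\<^esub> f \<in> U" using uminus[OF f] by simp
  qed (use assms in \<open>auto simp: tabloid_module_simps\<close>)
  then show ?thesis
    by (intro submodule.intro submodule_axioms.intro) (use assms(4) in \<open>auto simp: tabloid_module_simps\<close>)
qed

lemma specht_module_least:
  fixes U :: "((nat \<times> nat \<Rightarrow> nat) set \<Rightarrow> 'f::field) set"
  assumes "submodule U ring_of_type_algebra (tabloid_module \<mu>)" "polytabloid \<mu> ` tableaux \<mu> \<subseteq> U"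
  shows "carrier (specht_module \<mu>) \<subseteq> U"
  using assms by (auto simp: specht_module_def linear_span_def)

lemma polytabloid_in_specht: "t \<in> tableaux \<mu> \<Longrightarrow> polytabloid \<mu> t \<in> carrier (specht_module \<mu>)"
  by (auto simp: specht_module_def linear_span_def)

lemma polytabloid_in_tabloid_module:
  assumes "t \<in> tableaux \<mu>"
  shows "polytabloid \<mu> t \<in> carrier (tabloid_module \<mu>)"
proof -
  have "tabloid \<mu> (tact p t) \<in> \<Omega>" if "p \<in> column_stabilizer \<mu> t" for p
    using that assms tact_in_tableaux by (simp add: column_stabilizer_iff)
  then show ?thesis
    by (auto simp: tabloid_module_simps polytabloid_def intro!: sum.neutral)
qed

lemma specht_subset_tabloid: "carrier (specht_module \<mu>) \<subseteq> carrier (tabloid_module \<mu> :: ('f::field, _, _) group_module)"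
proof (rule specht_module_least)
  show "submodule (carrier (tabloid_module \<mu>)) ring_of_type_algebra (tabloid_module \<mu> :: ('f, _, _) group_module)"
    by (rule tabloid_submoduleI) (auto simp: tabloid_module_simps)
  show "polytabloid \<mu> ` tableaux \<mu> \<subseteq> carrier (tabloid_module \<mu> :: ('f, _, _) group_module)"
    using polytabloid_in_tabloid_module by blast
qed

text \<open>The relation is linear in w, so it suffices to test it on the polytabloids, which
  span.\<close>

lemma specht_annihilated:
  fixes w :: "(nat \<times> nat \<Rightarrow> nat) set \<Rightarrow> 'f::field"
  assumes hs: "\<And>t u. t \<in> tableaux \<mu> \<Longrightarrow> u \<in> tableaux \<mu> \<Longrightarrow> (\<Sum>h\<leftarrow>hs. polytabloid_at t (tact h u) :: 'f) = 0"
    and w: "w \<in> carrier (specht_module \<mu>)" and u: "u \<in> tableaux \<mu>"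
  shows "(\<Sum>h\<leftarrow>hs. w (tabloid \<mu> (tact h u))) = 0"
proof -
  let ?U = "{w \<in> carrier (tabloid_module \<mu>). (\<Sum>h\<leftarrow>hs. w (tabloid \<mu> (tact h u)) :: 'f) = 0}"
  have "submodule ?U ring_of_type_algebra (tabloid_module \<mu>)"
    by (rule tabloid_submoduleI) (auto simp: tabloid_module_simps sum_list_addf sum_list_const_mult)
  then have "carrier (specht_module \<mu>) \<subseteq> ?U"
    using hs[OF _ u] polytabloid_in_tabloid_module
    by (intro specht_module_least) (auto simp: polytabloid_at_def)
  then show ?thesis using w by blast
qed

end

section \<open>Transpositions and arithmetic in characteristic 3\<close>

abbreviation swap :: "nat \<Rightarrow> nat \<Rightarrow> nat \<Rightarrow> nat" where "swap \<equiv> Transposition.transpose"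

lemma char_3_simps:
  assumes "CHAR('f::field) = 3"
  shows "(3 :: 'f) = 0" and "(2 :: 'f) \<noteq> 0" and "x + x = (0 :: 'f) \<longleftrightarrow> x = 0" and "- x = x + (x :: 'f)"
proof -
  show 3: "(3 :: 'f) = 0" using of_nat_CHAR[where 'a = 'f] assms by simp
  show 2: "(2 :: 'f) \<noteq> 0"
  proof
    assume "(2 :: 'f) = 0"
    have "(3 :: 'f) = 2 + 1" by simp
    also have "\<dots> = 1" unfolding \<open>2 = 0\<close> by simp
    finally show False using 3 by simp
  qed
  show "x + x = 0 \<longleftrightarrow> x = 0" using 2 by (simp flip: mult_2)
  have "x + (x + x) = (2 + 1) * x" by (simp only: distrib_right mult_2 mult_1_left add.assoc)
  also have "(2 + 1 :: 'f) = 0" using 3 by (simp only: one_plus_numeral numeral_plus_one semiring_norm)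
  finally show "- x = x + x" by (intro minus_unique) simp
qed

context shape
begin

text \<open>Exchanging two entries of one row leaves the tabloid unchanged, so the hypothesis reads
  2 w = 0 at this tabloid.\<close>

lemma same_row_zero:
  fixes w :: "(nat \<times> nat \<Rightarrow> nat) set \<Rightarrow> 'f::field"
  assumes "CHAR('f) = 3" and u: "u \<in> tableaux \<mu>" and ij: "i \<in> {1..n}" "j \<in> {1..n}"
    and row: "trow u i = trow u j"
    and anti: "w (tabloid \<mu> u) + w (tabloid \<mu> (tact (swap i j) u)) = 0"
  shows "w (tabloid \<mu> u) = 0"
proof -
  have p: "swap i j permutes {1..n}" using ij by (rule permutes_swap_id)
  have "tabloid \<mu> (tact (swap i j) u) = tabloid \<mu> u"
    using u p row
    by (subst tabloid_eq_iff) (auto simp: tact_in_tableaux position_tact_inv Transposition.transpose_def)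
  then show ?thesis using anti char_3_simps(3)[OF assms(1)] by simp
qed

end

section \<open>Vectors satisfying the relations of the coboundary\<close>

text \<open>The assumption \<open>rel\<close> is the vanishing of the boundary: with 1 to 4 held
  fixed, the fifth alternating point runs through 5 to 9.\<close>

locale relation_vector = shape 9 \<mu> for \<mu> +
  fixes w :: "(nat \<times> nat \<Rightarrow> nat) set \<Rightarrow> 'f::field"
  assumes char: "CHAR('f) = 3"
    and anti: "\<And>u i j. u \<in> tableaux \<mu> \<Longrightarrow> i \<in> {1..5} \<Longrightarrow> j \<in> {1..5} \<Longrightarrow> i \<noteq> j \<Longrightarrow>
      w (tabloid \<mu> u) + w (tabloid \<mu> (tact (swap i j) u)) = 0"
    and symm: "\<And>u i j. u \<in> tableaux \<mu> \<Longrightarrow> i \<in> {6..9} \<Longrightarrow> j \<in> {6..9} \<Longrightarrow>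
      w (tabloid \<mu> (tact (swap i j) u)) = w (tabloid \<mu> u)"
    and rel: "\<And>u. u \<in> tableaux \<mu> \<Longrightarrow>
      w (tabloid \<mu> u) + (\<Sum>j\<in>{6..9}. w (tabloid \<mu> (tact (swap 5 j) u))) = 0"
begin

lemma clash_zero:
  assumes "u \<in> tableaux \<mu>" "i \<in> {1..5}" "j \<in> {1..5}" "i \<noteq> j" "trow u i = trow u j"
  shows "w (tabloid \<mu> u) = 0"
  using assms by (intro same_row_zero[OF char _ _ _ _ anti]) auto

lemma few_rows:
  assumes "length \<mu> < 5" "u \<in> tableaux \<mu>"
  shows "w (tabloid \<mu> u) = 0"
proof -
  have "trow u ` {1..5} \<subseteq> {..<length \<mu>}"
    using row_less[OF assms(2)] by auto
  then have "card (trow u ` {1..5}) \<le> card {..<length \<mu>}" by (intro card_mono) auto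
  then have "\<not> inj_on (trow u) {1..5}"
    using assms(1) card_image[of "trow u" "{1..5}"] by auto
  then show ?thesis using clash_zero[OF assms(2)] by (auto simp: inj_on_def)
qed

text \<open>The last of five rows with 9 cells in all has length 1. When 5 is alone there and 1 to 4
  occupy the other four rows, moving 5 to the place of some j > 5 puts it into the row of one of 1
  to 4. So all terms of \<open>rel\<close> but the first vanish.\<close>

lemma five_rows:
  assumes len: "length \<mu> = 5" and u: "u \<in> tableaux \<mu>"
  shows "w (tabloid \<mu> u) = 0"
proof -
  obtain a b c d e where \<mu>: "\<mu> = [a, b, c, d, e]"
    using len by (auto simp: length_Suc_conv numeral_eq_Suc)
  have last: "\<mu> ! 4 = 1"
    using partition unfolding \<mu> is_partition_def by (simp add: numeral_eq_Suc)
  have main: "w (tabloid \<mu> u) = 0" if u: "u \<in> tableaux \<mu>" and row5: "trow u 5 = 4" for u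
  proof (cases "inj_on (trow u) {1..5}")
    case False
    then show ?thesis using clash_zero[OF u] by (auto simp: inj_on_def)
  next
    case True
    have "trow u ` {1..5} \<subseteq> {..<5}" using row_less[OF u] len by auto
    then have onto: "trow u ` {1..5} = {..<5}"
      using True by (intro card_subset_eq) (auto simp: card_image)
    have "w (tabloid \<mu> (tact (swap 5 j) u)) = 0" if j: "j \<in> {6..9}" for j
    proof -
      have p: "swap 5 j permutes {1..9}" using j by (intro permutes_swap_id) auto
      have "trow u j \<noteq> 4"
      proof
        assume r: "trow u j = 4"
        have "tcol u j = 0" "tcol u 5 = 0"
          using col_less[OF u, of j] col_less[OF u, of 5] r row5 last j by auto
        then have "j = 5" 
            using r row5 j position_inj[OF u, of j 5] by auto
        then show False using j by simp
      qed
      have "trow u j < 5" using row_less[OF u] j len by auto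
      then have "trow u j \<in> trow u ` {1..5}" unfolding onto by simp
      then obtain i where i: "i \<in> {1..5}" "trow u i = trow u j" by auto
      have i5: "i \<noteq> 5" using \<open>trow u j \<noteq> 4\<close> i(2) row5 by auto
      show ?thesis
      proof (rule clash_zero[OF tact_in_tableaux[OF u p], of i 5])
        show "trow (tact (swap 5 j) u) i = trow (tact (swap 5 j) u) 5"
          using i i5 j position_tact_inv[OF u p, of i] position_tact_inv[OF u p, of 5]
          by (auto simp: Transposition.transpose_def)
      qed (use i i5 in auto)
    qed
    then show ?thesis using rel[OF u] by simp
  qed
  show ?thesis
  proof (cases "inj_on (trow u) {1..5}")
    case False
    then show ?thesis using clash_zero[OF u] by (auto simp: inj_on_def)
  next
    case True
    have "trow u ` {1..5} \<subseteq> {..<5}" using row_less[OF u] len by auto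
    then have "trow u ` {1..5} = {..<5}"
      using True by (intro card_subset_eq) (auto simp: card_image)
    then have "4 \<in> trow u ` {1..5}" by simp
    then obtain i where i: "i \<in> {1..5}" "trow u i = 4" by auto
    show ?thesis
    proof (cases "i = 5")
      case True
      then show ?thesis using main[OF u] i by simp
    next
      case False
      \<comment> \<open>By alternation the entry in the last row may be taken to be 5.\<close>
      have p: "swap i 5 permutes {1..9}" using i by (intro permutes_swap_id) auto
      have "trow (tact (swap i 5) u) 5 = 4"
        using i position_tact_inv[OF u p, of 5] by simp
      then have "w (tabloid \<mu> (tact (swap i 5) u)) = 0"
        using main tact_in_tableaux[OF u p] by blast
      then show ?thesis using anti[OF u i(1), of 5] False by simp
    qed
  qed
qed

end

section \<open>The annihilating element\<close>

text \<open>The five-cycle 1, 2, 3, 4, 5: a rotation of the pentagon with its vertices in this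
  cyclic order.\<close>

definition rotation :: "nat \<Rightarrow> nat" where
  "rotation = swap 1 2 \<circ> swap 2 3 \<circ> swap 3 4 \<circ> swap 4 5"

text \<open>The reflection of the same pentagon in the axis through 4.\<close>

definition reflection :: "nat \<Rightarrow> nat" where
  "reflection = swap 1 2 \<circ> swap 3 5"

definition klein_four :: "(nat \<Rightarrow> nat) list" where
  "klein_four = [id, swap 6 7 \<circ> swap 8 9, swap 6 8 \<circ> swap 7 9, swap 6 9 \<circ> swap 7 8]"

text \<open>Reflections have sign \<open>-1 = 1 + 1\<close>, so each of them is listed twice.\<close>

definition annihilator :: "(nat \<Rightarrow> nat) list" where
  "annihilator = concat (map (\<lambda>d. map (\<lambda>v. v \<circ> d) klein_four)
     (map (\<lambda>i. rotation ^^ i) [0..<5] @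
      concat (map (\<lambda>i. [rotation ^^ i \<circ> reflection, rotation ^^ i \<circ> reflection]) [0..<5])))"

lemma swap_permutes: "i \<in> {1..n} \<Longrightarrow> j \<in> {1..n} \<Longrightarrow> swap i j permutes {1..n}"
  by (rule permutes_swap_id)

lemma rotation_permutes: "rotation ^^ i permutes {1..5}"
proof -
  have "rotation permutes {1..5}"
    unfolding rotation_def by (intro permutes_compose swap_permutes) auto
  then show ?thesis by (rule permutes_funpow)
qed

lemma reflection_permutes: "reflection permutes {1..5}"
  unfolding reflection_def by (intro permutes_compose swap_permutes) auto

lemma klein_four_permutes: "v \<in> set klein_four \<Longrightarrow> v permutes {6..9}"
  unfolding klein_four_def by (auto intro!: permutes_compose permutes_swap_id permutes_id)

lemma annihilator_permutes:
  assumes "h \<in> set annihilator"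
  shows "h permutes {1..9}"
proof -
  have "v permutes {1..9}" if "v \<in> set klein_four" for v
    using klein_four_permutes[OF that] by (rule permutes_subset) auto
  moreover have "rotation ^^ i permutes {1..9}" for i
    using rotation_permutes by (rule permutes_subset) auto
  moreover have "reflection permutes {1..9}"
    using reflection_permutes by (rule permutes_subset) auto
  ultimately show ?thesis
    using assms unfolding annihilator_def by (auto intro!: permutes_compose split: if_splits)
qed

lemma sum_list_annihilator:
  fixes f :: "(nat \<Rightarrow> nat) \<Rightarrow> 'f::field"
  shows "(\<Sum>h\<leftarrow>annihilator. f h) = (\<Sum>v\<leftarrow>klein_four. \<Sum>i<5. f (v \<circ> rotation ^^ i)) +
     2 * (\<Sum>v\<leftarrow>klein_four. \<Sum>i<5. f (v \<circ> (rotation ^^ i \<circ> reflection)))"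
proof -
  have upt: "[0..<5] = [0, 1, 2, 3, 4 :: nat]" by (simp add: upt_rec)
  have sum5: "sum g {..<5} = (\<Sum>i\<leftarrow>[0..<5]. g i)" for g :: "nat \<Rightarrow> 'f"
    by (simp add: interv_sum_list_conv_sum_set_nat atLeast0LessThan)
  define r where "r i = rotation ^^ i" for i
  show ?thesis
    unfolding annihilator_def klein_four_def sum5 upt r_def[symmetric] by (simp add: algebra_simps)
qed

section \<open>Diagrams with at most two columns\<close>

context shape
begin

lemma col_less_first:
  assumes "t \<in> tableaux \<mu>" "k \<in> {1..n}"
  shows "tcol t k < \<mu> ! 0"
proof -
  have "\<mu> ! trow t k \<le> \<mu> ! 0"
    using partition row_less[OF assms] sorted_wrt_nth_less[of "(\<ge>)" \<mu> 0 "trow t k"]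
    by (cases "trow t k = 0") (auto simp: is_partition_def)
  then show ?thesis using col_less[OF assms] by simp
qed

lemma swap_in_column_stabilizer:
  assumes t: "t \<in> tableaux \<mu>" and ij: "i \<in> {1..n}" "j \<in> {1..n}" "tcol t i = tcol t j"
  shows "swap i j \<in> column_stabilizer \<mu> t"
  using swap_permutes[OF ij(1,2)] ij by (auto simp: column_stabilizer_iff[OF t] Transposition.transpose_def)

lemma polytabloid_at_swap:
  assumes t: "t \<in> tableaux \<mu>" and u: "u \<in> tableaux \<mu>"
    and ij: "i \<in> {1..n}" "j \<in> {1..n}" "i \<noteq> j" "tcol t i = tcol t j"
  shows "polytabloid_at t (tact (swap i j) u) = (- polytabloid_at t u :: 'f::field)"
  using polytabloid_at_column[OF t u swap_in_column_stabilizer[OF t ij(1,2,4)], where 'f = 'f] ij(3)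
  by (simp add: sign_swap_id)

lemma young_diagram_Sigma: "young_diagram \<mu> = Sigma {..<length \<mu>} (\<lambda>i. {..<\<mu> ! i})"
  by (auto simp: young_diagram_def)

lemma card_young_diagram: "finite (young_diagram \<mu>)" "card (young_diagram \<mu>) = n"
  unfolding young_diagram_Sigma
  by (simp_all add: sum_list_eq[symmetric] sum_list_sum_nth atLeast0LessThan)

end

text \<open>Two of the entries 5, 6, 7 share a column in any tableau with at most two columns. Left
  composition with their transposition pairs the six summands of the symmetrizer of 5, 6, 7 with
  opposite signs.\<close>

lemma (in shape) symmetrizer_annihilates:
  assumes n: "n = 9" and first: "\<mu> ! 0 \<le> 2"
    and w: "w \<in> carrier (specht_module \<mu>)" and u: "u \<in> tableaux \<mu>"
  shows "w (tabloid \<mu> u) + w (tabloid \<mu> (tact (swap 5 6) u)) + w (tabloid \<mu> (tact (swap 5 7) u)) +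
    w (tabloid \<mu> (tact (swap 6 7) u)) + w (tabloid \<mu> (tact (swap 5 6 \<circ> swap 5 7) u)) +
    w (tabloid \<mu> (tact (swap 5 7 \<circ> swap 5 6) u)) = (0 :: 'f::field)"
proof -
  define a b c where "a = swap 5 6" and "b = swap 5 7" and "c = swap 6 7"
  have compose: "a \<circ> c = b \<circ> a" "c \<circ> a = a \<circ> b" "b \<circ> c = a \<circ> b" "c \<circ> b = b \<circ> a"
    by (auto simp: a_def b_def c_def fun_eq_iff Transposition.transpose_def)
  have perm: "a permutes {1..n}" "b permutes {1..n}" "c permutes {1..n}"
    unfolding a_def b_def c_def n by (intro swap_permutes; simp)+
  let ?hs = "[id, a, b, c, a \<circ> b, b \<circ> a]"
  have "(\<Sum>h\<leftarrow>?hs. w (tabloid \<mu> (tact h u))) = 0"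
  proof (rule specht_annihilated[OF _ w u])
    fix t v assume t: "t \<in> tableaux \<mu>" and v: "v \<in> tableaux \<mu>"
    define E where "E p = (polytabloid_at t (tact p v) :: 'f)" for p
    have neg: "E (swap i j \<circ> p) = - E p"
      if "p permutes {1..n}" "i \<in> {1..n}" "j \<in> {1..n}" "i \<noteq> j" "tcol t i = tcol t j" for i j p
      using polytabloid_at_swap[OF t tact_in_tableaux[OF v that(1)] that(2-5), where 'f = 'f]
      by (simp add: E_def tact_compose[OF v])
    have col: "tcol t k < 2" if "k \<in> {1..9}" for k
      using col_less_first[OF t, of k] first that n by simp
    have "tcol t 5 < 2" "tcol t 6 < 2" "tcol t 7 < 2" by (simp_all add: col)
    then consider "tcol t 5 = tcol t 6" | "tcol t 5 = tcol t 7" | "tcol t 6 = tcol t 7" by linarith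
    then have "E id + E a + E b + E c + E (a \<circ> b) + E (b \<circ> a) = 0"
    proof cases
      case 1
      then have "E (a \<circ> p) = - E p" if "p permutes {1..n}" for p
        unfolding a_def using neg[OF that, of 5 6] n by simp
      from this[OF permutes_id] this[OF perm(2)] this[OF perm(3)]
      show ?thesis by (simp add: compose)
    next
      case 2
      then have "E (b \<circ> p) = - E p" if "p permutes {1..n}" for p
        unfolding b_def using neg[OF that, of 5 7] n by simp
      from this[OF permutes_id] this[OF perm(1)] this[OF perm(3)]
      show ?thesis by (simp add: compose)
    next
      case 3
      then have "E (c \<circ> p) = - E p" if "p permutes {1..n}" for p
        unfolding c_def using neg[OF that, of 6 7] n by simp
      from this[OF permutes_id] this[OF perm(1)] this[OF perm(2)]
      show ?thesis by (simp add: compose)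
    qed
    then show "(\<Sum>h\<leftarrow>?hs. polytabloid_at t (tact h v) :: 'f) = 0"
      by (simp add: E_def add.assoc)
  qed
  then show ?thesis
    by (simp add: a_def b_def c_def tact_id[OF u] add.assoc)
qed

text \<open>The symmetrizer of 5, 6, 7 together with symmetry in 6 to 9 makes w invariant under (5
  6), while w changes sign under (4 5). The two sides of the braid relation between these
  transpositions then give -w and w.\<close>

lemma (in relation_vector) two_columns:
  assumes w: "w \<in> carrier (specht_module \<mu>)" and first: "\<mu> ! 0 \<le> 2" and u: "u \<in> tableaux \<mu>"
  shows "w (tabloid \<mu> u) = 0"
proof -
  define W where "W u = w (tabloid \<mu> u)" for u
  have T: "tact (swap i j) u \<in> tableaux \<mu>" if "u \<in> tableaux \<mu>" "i \<in> {1..9}" "j \<in> {1..9}" for i j u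
    using that by (intro tact_in_tableaux swap_permutes)
  have keep: "W (tact (swap i j) u) = W u" if "u \<in> tableaux \<mu>" "i \<in> {6..9}" "j \<in> {6..9}" for i j u
    unfolding W_def using that by (rule symm)
  have move: "tact (swap i j) (tact (swap k l) u) = tact (swap k' l') (tact (swap i' j') u)"
    if "swap i j \<circ> swap k l = swap k' l' \<circ> swap i' j'" "u \<in> tableaux \<mu>" for i j k l i' j' k' l' u
    using that by (simp add: tact_compose)
  \<comment> \<open>By symmetry in 6 and 7 the six terms of the symmetrizer coincide in pairs, and 2
    is invertible.\<close>
  have sum3: "W u + W (tact (swap 5 6) u) + W (tact (swap 5 7) u) = 0" if u: "u \<in> tableaux \<mu>" for u
  proof -
    have "swap 5 6 \<circ> swap 5 7 = swap 6 7 \<circ> swap 5 6" "swap 5 7 \<circ> swap 5 6 = swap 6 7 \<circ> swap 5 7"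
      by (auto simp: fun_eq_iff Transposition.transpose_def)
    then have "W (tact (swap 5 6 \<circ> swap 5 7) u) = W (tact (swap 5 6) u)"
      "W (tact (swap 5 7 \<circ> swap 5 6) u) = W (tact (swap 5 7) u)"
      using u keep[OF T[OF u]] by (simp_all flip: tact_compose)
    then have "(W u + W (tact (swap 5 6) u) + W (tact (swap 5 7) u)) +
        (W u + W (tact (swap 5 6) u) + W (tact (swap 5 7) u)) = 0"
      using symmetrizer_annihilates[OF refl first w u] keep[OF u, of 6 7] unfolding W_def by (simp add: ac_simps)
    then show ?thesis using char_3_simps(3)[OF char] by blast
  qed
  \<comment> \<open>Compare \<open>sum3\<close> at u with \<open>sum3\<close> at the image of u
    under (7 8): only the last term differs.\<close>
  have eq78: "W (tact (swap 5 7) u) = W (tact (swap 5 8) u)" if u: "u \<in> tableaux \<mu>" for u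
  proof -
    have "tact (swap 5 6) (tact (swap 7 8) u) = tact (swap 7 8) (tact (swap 5 6) u)"
      "tact (swap 5 7) (tact (swap 7 8) u) = tact (swap 7 8) (tact (swap 5 8) u)"
      by (rule move[OF _ u], simp add: fun_eq_iff Transposition.transpose_def)+
    then have "W u + W (tact (swap 5 6) u) + W (tact (swap 5 8) u) = 0"
      using sum3[OF T[OF u, of 7 8]] u by (simp add: keep T)
    then show ?thesis using sum3[OF u] by (metis add_left_imp_eq)
  qed
  have eq67: "W (tact (swap 5 6) u) = W (tact (swap 5 7) u)" if u: "u \<in> tableaux \<mu>" for u
  proof -
    have "tact (swap 5 7) (tact (swap 6 7) u) = tact (swap 6 7) (tact (swap 5 6) u)"
      "tact (swap 5 8) (tact (swap 6 7) u) = tact (swap 6 7) (tact (swap 5 8) u)"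
      by (rule move[OF _ u], simp add: fun_eq_iff Transposition.transpose_def)+
    then have "W (tact (swap 5 6) u) = W (tact (swap 5 8) u)"
      using eq78[OF T[OF u, of 6 7]] u by (simp add: keep T)
    then show ?thesis using eq78[OF u] by simp
  qed
  \<comment> \<open>In characteristic 3 the equation W + 2 W' = 0 says W = W'.\<close>
  have fix56: "W (tact (swap 5 6) u) = W u" if u: "u \<in> tableaux \<mu>" for u
  proof -
    have "W u + (W (tact (swap 5 6) u) + W (tact (swap 5 6) u)) = 0"
      using sum3[OF u] eq67[OF u] by (simp add: add.assoc)
    then show ?thesis
      using char_3_simps(4)[OF char, of "W (tact (swap 5 6) u)"] by (metis add.inverse_inverse add_eq_0_iff2)
  qed
  have neg45: "W (tact (swap 4 5) u) = - W u" if u: "u \<in> tableaux \<mu>" for u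
    using anti[OF u, of 4 5] unfolding W_def by (simp add: add_eq_0_iff)
  have "W (tact (swap 5 6) (tact (swap 4 5) (tact (swap 5 6) u))) = - W u"
    using u by (simp add: fix56 neg45 T)
  moreover have "W (tact (swap 4 5) (tact (swap 5 6) (tact (swap 4 5) u))) = W u"
    using u by (simp add: fix56 neg45 T)
  moreover have "swap 5 6 \<circ> (swap 4 5 \<circ> swap 5 6) = swap 4 5 \<circ> (swap 5 6 \<circ> swap 4 5)"
    by (auto simp: fun_eq_iff Transposition.transpose_def)
  then have "tact (swap 5 6) (tact (swap 4 5) (tact (swap 5 6) u)) =
      tact (swap 4 5) (tact (swap 5 6) (tact (swap 4 5) u))"
    using u by (simp add: tact_compose)
  ultimately have "W u + W u = 0" by (metis add.left_inverse)
  then show ?thesis using char_3_simps(3)[OF char] unfolding W_def by blast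
qed

section \<open>Nonvanishing of the annihilating element on the remaining shapes\<close>

lemma (in shape) tableau_with_long_column:
  assumes n: "n = 9" and len: "6 \<le> length \<mu>" and first: "3 \<le> \<mu> ! 0"
  obtains t where "t \<in> tableaux \<mu>" "\<And>k. k \<in> {1, 2, 6, 7, 8, 9} \<Longrightarrow> tcol t k = 0"
    "\<And>k. k \<in> {3, 5, 6} \<Longrightarrow> trow t k = 0"
proof -
  let ?D = "young_diagram \<mu>"
  define C :: "(nat \<times> nat) set"
    where "C = {(0, 0), (1, 0), (2, 0), (3, 0), (4, 0), (5, 0), (0, 1), (0, 2)}"
  have "0 < \<mu> ! i" if "i < length \<mu>" for i
    using partition that by (metis is_partition_def nth_mem neq0_conv)
  then have CD: "C \<subseteq> ?D" using len first by (auto simp: young_diagram_def C_def)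
  have "finite C" "card C = 8" by (simp_all add: C_def)
  then have "card (?D - C) = 1"
    using card_young_diagram n CD by (simp add: card_Diff_subset)
  then obtain c where Dc: "?D - C = {c}" by (auto simp: card_1_singleton_iff)
  then have "c \<notin> C" by blast
  have D: "?D = insert c C" using Diff_partition[OF CD] unfolding Dc by simp
  \<comment> \<open>The hook of cells C is present in every such shape. The entry 6 sits in the
    corner, sharing the first row with 3 and 5 and the first column with 1, 2, 7, 8, 9; this makes
    most coefficients in \<open>annihilator_nonzero\<close> vanish. The ninth cell c has no
    prescribed place and receives 4.\<close>
  define t :: "nat \<times> nat \<Rightarrow> nat" where "t = (\<lambda>x\<in>?D. if x = c then 4 else if snd x = 0 then [6, 1, 2, 7, 8, 9] ! fst x
    else if snd x = 1 then 3 else 5)"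
  have tC: "t (0, 0) = 6" "t (1, 0) = 1" "t (2, 0) = 2" "t (3, 0) = 7" "t (4, 0) = 8" "t (5, 0) = 9"
    "t (0, 1) = 3" "t (0, 2) = 5" "t c = 4"
    using \<open>c \<notin> C\<close> by (auto simp: t_def D C_def)
  have "{1..9} = {4, 6, 1, 2, 7, 8, 9, 3, 5 :: nat}"
    by (intro equalityI subsetI; simp; presburger)
  then have img: "t ` ?D = {1..9}"
    by (simp only: D C_def image_insert image_empty tC)
  have "inj_on t ?D"
    using card_young_diagram n img by (intro eq_card_imp_inj_on) auto
  then have "t \<in> tableaux \<mu>"
    using sum_list_eq n img by (auto simp: tableaux_def bij_betw_def t_def)
  then have "pos t 6 = (0, 0)" "pos t 1 = (1, 0)" "pos t 2 = (2, 0)" "pos t 7 = (3, 0)" "pos t 8 = (4, 0)"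
    "pos t 9 = (5, 0)" "pos t 3 = (0, 1)" "pos t 5 = (0, 2)"
    using tC by (auto intro!: position_eqI simp: D C_def)
  then show thesis using \<open>t \<in> tableaux \<mu>\<close> by (intro that[of t]) auto
qed

text \<open>The sum is evaluated for the polytabloid of t with u = t. Of the ten dihedral elements
  only the identity and (1 2)(3 5) contribute, since each of the others carries 3 or 5 to 1 or 2.
  The Klein four-group multiplies their contributions 1 and 2 * (-1) by 4, for a total of
  -4.\<close>

lemma (in shape) annihilator_nonzero:
  assumes char: "CHAR('f::field) = 3" and n: "n = 9" and len: "6 \<le> length \<mu>" and first: "3 \<le> \<mu> ! 0"
  obtains w and u where "w \<in> carrier (specht_module \<mu>)" "u \<in> tableaux \<mu>"
    "(\<Sum>h\<leftarrow>annihilator. w (tabloid \<mu> (tact h u)) :: 'f) \<noteq> 0"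
proof -
  obtain t where t: "t \<in> tableaux \<mu>" and col: "\<And>k. k \<in> {1, 2, 6, 7, 8, 9} \<Longrightarrow> tcol t k = 0"
    and row: "\<And>k. k \<in> {3, 5, 6} \<Longrightarrow> trow t k = 0"
    using tableau_with_long_column[OF n len first] by blast
  define E where "E p = (polytabloid_at t (tact p t) :: 'f)" for p
  have colV: "tcol t i = 0" if "i \<in> {6..9}" for i
  proof -
    have "i = 6 \<or> i = 7 \<or> i = 8 \<or> i = 9" using that by (simp; presburger)
    then show ?thesis using col[of i] by auto
  qed
  have swap_neg: "E (swap i j \<circ> p) = - E p"
    if "p permutes {1..9}" "i \<in> {6..9}" "j \<in> {6..9}" "i \<noteq> j" for i j p
    using polytabloid_at_swap[OF t tact_in_tableaux[OF t], of p i j, where 'f = 'f] that n colV[of i] colV[of j]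
    by (simp add: E_def tact_compose[OF t])
  \<comment> \<open>An element other than the identity is a product of two transpositions inside the
    first column of t, and the two sign changes cancel.\<close>
  have klein: "E (v \<circ> p) = E p" if "v \<in> set klein_four" "p permutes {1..9}" for v p
  proof -
    have "E (swap i j \<circ> swap k l \<circ> p) = E p"
      if "i \<in> {6..9}" "j \<in> {6..9}" "i \<noteq> j" "k \<in> {6..9}" "l \<in> {6..9}" "k \<noteq> l" for i j k l
    proof -
      have "swap k l \<circ> p permutes {1..9}"
        using that \<open>p permutes {1..9}\<close> by (intro permutes_compose swap_permutes) auto
      then have "E (swap i j \<circ> (swap k l \<circ> p)) = - E (swap k l \<circ> p)"
        using that by (intro swap_neg)
      then show ?thesis using swap_neg[OF \<open>p permutes {1..9}\<close> that(4-6)] by (simp add: o_assoc)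
    qed
    then show ?thesis using that(1) by (auto simp: klein_four_def)
  qed
  \<comment> \<open>In the tabloid of p t the entries p m and p 6 = 6 lie in the first row, and in t
    both lie in the first column.\<close>
  have zero: "E p = 0" if p: "p permutes {1..5}" and m: "m \<in> {3, 5}" "p m \<in> {1, 2}" for p m
    unfolding E_def
  proof (rule polytabloid_at_clash[OF t])
    have p9: "p permutes {1..n}" using p n by (auto intro: permutes_subset)
    show "tact p t \<in> tableaux \<mu>" using t p9 by (rule tact_in_tableaux)
    have "p 6 = 6" using permutes_not_in[OF p] by simp
    then have "trow (tact p t) 6 = 0"
      using position_tact[OF t p9, of 6] row[of 6] n by simp
    moreover have "trow (tact p t) (p m) = 0"
      using position_tact[OF t p9, of m] row[of m] m n by auto
    ultimately show "trow (tact p t) (p m) = trow (tact p t) 6" by simp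
    show "tcol t (p m) = tcol t 6" using col[of "p m"] col[of 6] m by auto
  qed (use m n in auto)
  have rot: "rotation 1 = 2" "rotation 2 = 3" "rotation 3 = 4" "rotation 4 = 5" "rotation 5 = 1"
    and refl: "reflection 3 = 5" "reflection 5 = 3"
    by (simp_all add: rotation_def reflection_def Transposition.transpose_def)
  have pow: "(rotation ^^ 1) 5 = 1" "(rotation ^^ 2) 5 = 2" "(rotation ^^ 3) 3 = 1" "(rotation ^^ 4) 3 = 2"
    using rot by (simp_all add: eval_nat_numeral)
  have r0: "E (rotation ^^ i) = 0" if "i \<in> {1, 2, 3, 4}" for i
    using that pow zero[OF rotation_permutes, of 5 i] zero[OF rotation_permutes, of 3 i] by auto
  have perm: "rotation ^^ i \<circ> reflection permutes {1..5}" for i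
    by (intro permutes_compose reflection_permutes rotation_permutes)
  have s0: "E (rotation ^^ i \<circ> reflection) = 0" if "i \<in> {1, 2, 3, 4}" for i
    using that pow refl zero[OF perm, of 5 i] zero[OF perm, of 3 i] by auto
  have Eid: "E id = 1" using polytabloid_at_self[OF t] by (simp add: E_def tact_id[OF t])
  \<comment> \<open>(3 5) preserves the rows of t, and (1 2) lies in its column stabilizer with sign
    -1.\<close>
  have Es: "E reflection = - 1"
  proof -
    have p: "swap 3 5 permutes {1..n}" using n by (intro swap_permutes) auto
    have "tabloid \<mu> (tact (swap 3 5) t) = tabloid \<mu> t"
      using t p row[of 3] row[of 5]
      by (subst tabloid_eq_iff) (auto simp: tact_in_tableaux position_tact_inv Transposition.transpose_def)
    then have "polytabloid_at t (tact (swap 3 5) t) = (1 :: 'f)"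
      using polytabloid_at_self[OF t] by (simp add: polytabloid_at_def)
    then show ?thesis
      using polytabloid_at_swap[OF t tact_in_tableaux[OF t p], of 1 2, where 'f = 'f] n col[of 1] col[of 2]
      by (simp add: E_def reflection_def tact_compose[OF t])
  qed
  have sum5: "(\<Sum>i<5. f i) = f 0 + f 1 + f 2 + f 3 + f 4" for f :: "nat \<Rightarrow> 'f"
  proof -
    have "{..<5} = {0, 1, 2, 3, 4 :: nat}" by auto
    then show ?thesis by (simp add: add.assoc)
  qed
  have p9: "rotation ^^ i permutes {1..9}" "rotation ^^ i \<circ> reflection permutes {1..9}" for i
    using permutes_subset[OF rotation_permutes] permutes_subset[OF perm] by auto
  have "(\<Sum>h\<leftarrow>annihilator. E h) = (\<Sum>v\<leftarrow>klein_four. \<Sum>i<5. E (rotation ^^ i)) +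
     2 * (\<Sum>v\<leftarrow>klein_four. \<Sum>i<5. E (rotation ^^ i \<circ> reflection))"
    unfolding sum_list_annihilator
    by (intro arg_cong2[of _ _ _ _ "(+)"] arg_cong[of _ _ "(*) 2"] arg_cong[of _ _ sum_list] map_cong sum.cong refl)
       (simp_all add: klein[OF _ p9(1)] klein[OF _ p9(2)])
  also have "\<dots> = - 4"
    using r0[of 1] s0[of 1] by (simp add: sum5 r0 s0 Eid Es klein_four_def)
  also have "- 4 \<noteq> (0 :: 'f)"
  proof -
    have "(4 :: 'f) = 2 * 2" by simp
    moreover have "(2 :: 'f) * 2 \<noteq> 0" using char_3_simps(2)[OF char] by (intro no_zero_divisors)
    ultimately show ?thesis by (metis neg_equal_0_iff_equal)
  qed
  finally show thesis
    using that[OF polytabloid_in_specht[OF t] t] by (simp add: E_def polytabloid_at_def)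
qed

section \<open>The field with eight elements\<close>

definition trace8 :: "'k::field \<Rightarrow> 'k" where "trace8 y = y + y^2 + y^4"

text \<open>The additive character (-1)^Tr of F_8, kept integer-valued so that divisibility by 3 can
  be expressed.\<close>

definition trace_sign :: "'k::field \<Rightarrow> int" where
  "trace_sign y = (if trace8 y = 0 then 1 else - 1)"

text \<open>Zech logarithms with respect to a root of \<open>X\<^sup>3 + X + 1\<close>.\<close>

definition zech :: "nat \<Rightarrow> nat" where
  "zech i = [0, 3, 6, 1, 5, 4, 2] ! i"

text \<open>Among the powers of a root of X^3 + X + 1, those with exponent 1, 2, 4 are its
  conjugates and have trace 0; those with exponent 0, 3, 5, 6 have trace 1.\<close>

definition log_sign :: "nat \<Rightarrow> int" where
  "log_sign i = (if i mod 7 \<in> {1, 2, 4} then 1 else - 1)"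

text \<open>The thirty cases of the five-point identity in logarithmic form. Adding 7 before a
  subtraction keeps it exact on natural numbers and preserves the residue modulo 7.\<close>

lemma log_sign_cocycle:
  "\<forall>i\<in>set [1..<7]. \<forall>j\<in>set [1..<7]. i \<noteq> j \<longrightarrow>
    log_sign (zech j + 7 - zech i + i + 7 - j) - log_sign (zech j + 7 - zech i) +
      log_sign (j + 7 - i) - log_sign j + log_sign i \<in> {3, - 3}"
  by code_simp

locale field8 =
  fixes field_type :: "'k::field itself"
  assumes card8: "CARD('k) = 8"
begin

lemma finite_field: "finite (UNIV :: 'k set)"
  using card8 by (intro card_ge_0_finite) simp

text \<open>Multiplication by x permutes the seven nonzero elements, so their product does not
  change.\<close>

lemma power7: "x \<noteq> 0 \<Longrightarrow> x ^ 7 = (1 :: 'k)"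
proof -
  assume x: "x \<noteq> 0"
  let ?U = "UNIV - {0 :: 'k}"
  have card: "card ?U = 7" using card8 finite_field by (simp add: card_Diff_singleton)
  have "(\<Prod>y\<in>?U. y) = (\<Prod>y\<in>?U. x * y)"
    by (rule prod.reindex_bij_witness[of _ "\<lambda>y. x * y" "\<lambda>y. y / x"]) (use x in auto)
  also have "\<dots> = x ^ 7 * (\<Prod>y\<in>?U. y)"
    using card by (simp add: prod.distrib)
  finally show "x ^ 7 = 1" using finite_field by simp
qed

text \<open>The seventh power of -1 is both -1 and 1.\<close>

lemma one_add_one: "1 + 1 = (0 :: 'k)"
proof -
  have "(- 1 :: 'k) ^ 7 = 1" by (rule power7) simp
  then have "- 1 = (1 :: 'k)" by simp
  then show ?thesis by (metis add.left_inverse)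
qed

lemma add_self: "x + x = (0 :: 'k)"
  using one_add_one by (metis distrib_left mult.right_neutral mult_zero_right)

lemma uminus_eq: "- x = (x :: 'k)"
  using add_self by (simp add: minus_unique)

lemma minus_eq_add: "x - y = x + (y :: 'k)"
  using uminus_eq[of y] by (metis diff_conv_add_uminus)

lemma add_eq_0_iff_eq: "x + y = 0 \<longleftrightarrow> x = (y :: 'k)"
  using minus_eq_add by (metis right_minus_eq)

lemma square_add: "(x + y)^2 = x^2 + (y^2 :: 'k)"
proof -
  have "(x + y)^2 = x^2 + y^2 + (x * y + x * y)" by (simp add: power2_eq_square algebra_simps)
  then show ?thesis by (simp add: add_self)
qed

lemma power8: "x ^ 8 = (x :: 'k)"
proof (cases "x = 0")
  case False
  have "x ^ 8 = x ^ 7 * x" by (simp add: eval_nat_numeral)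
  then show ?thesis using power7[OF False] by simp
qed simp

lemma trace8_add: "trace8 (x + y) = trace8 x + trace8 (y :: 'k)"
proof -
  have "(x + y)^4 = ((x + y)^2)^2" by (simp flip: power_mult)
  also have "\<dots> = x^4 + y^4" unfolding square_add[of x y] square_add[of "x^2"] by (simp flip: power_mult)
  finally have "(x + y)^4 = x^4 + y^4" .
  then show ?thesis by (simp add: trace8_def square_add)
qed

lemma trace8_square: "trace8 (y^2) = trace8 (y :: 'k)"
  using power8[of y] by (simp add: trace8_def flip: power_mult)

lemma trace8_one: "trace8 (1 :: 'k) = 1"
  using one_add_one by (simp add: trace8_def)

text \<open>The trace is fixed by squaring, hence a root of X^2 - X.\<close>

lemma trace8_cases: "trace8 (y :: 'k) = 0 \<or> trace8 y = 1"
proof -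
  have "(trace8 y)^2 = trace8 (y^2)"
    by (simp add: trace8_def square_add flip: power_mult)
  then have "(trace8 y)^2 = trace8 y" by (simp only: trace8_square)
  then have "trace8 y * (trace8 y - 1) = 0"
    by (simp add: power2_eq_square algebra_simps)
  then show ?thesis by simp
qed

text \<open>The exponents 1, 2, 4 in the trace of y and 6, 5, 3 in that of 1/y are all the nonzero
  residues modulo 7, and the seven powers of y add up to 0.\<close>

lemma trace8_inverse:
  assumes "y \<noteq> 0" "y \<noteq> (1 :: 'k)"
  shows "trace8 (1 / y) = trace8 y + 1"
proof -
  have "(y - 1) * (1 + y + y^2 + y^3 + y^4 + y^5 + y^6) = y^7 - 1"
    by (simp add: eval_nat_numeral algebra_simps)
  then have "1 + y + y^2 + y^3 + y^4 + y^5 + y^6 = 0"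
    using power7[OF assms(1)] assms(2) by simp
  then have "(y + y^2 + y^4 + 1) + (y^6 + y^5 + y^3) = 0" by (simp add: ac_simps)
  then have sum: "y^6 + y^5 + y^3 = trace8 y + 1"
    by (simp add: add_eq_0_iff_eq trace8_def)
  have "y * y^6 = 1" using power7[OF assms(1)] by (simp add: eval_nat_numeral)
  then have inv: "1 / y = y^6" using assms(1) by (simp add: field_simps)
  have "(y^6)^2 = y^7 * y^5" "(y^6)^4 = y^7 * y^7 * y^7 * y^3"
    by (simp_all flip: power_mult power_add)
  then have "trace8 (y^6) = y^6 + y^5 + y^3"
    using power7[OF assms(1)] by (simp add: trace8_def)
  then show ?thesis using inv sum by simp
qed

lemma trace_sign_inverse: "y \<noteq> 0 \<Longrightarrow> y \<noteq> (1 :: 'k) \<Longrightarrow> trace_sign (1 / y) = - trace_sign y"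
  using trace8_cases[of y] one_add_one by (auto simp: trace_sign_def trace8_inverse)

lemma trace_sign_add_one: "trace_sign (1 + y) = - trace_sign (y :: 'k)"
  using trace8_cases[of y] one_add_one by (auto simp: trace_sign_def trace8_add trace8_one)

lemma trace_sign_square: "trace_sign (y^2) = trace_sign (y :: 'k)"
  by (simp add: trace_sign_def trace8_square)

text \<open>Of x and 1/x one has trace 0, by \<open>trace8_inverse\<close>. Cancelling a factor
  \<alpha> from the trace of such an element \<alpha> gives \<alpha>^3 + \<alpha> + 1 = 0, which
  determines all powers of \<alpha> and their traces.\<close>

lemma primitive_element:
  obtains \<alpha> :: 'k where "\<alpha> \<noteq> 0" "\<forall>i\<in>{1..6}. 1 + \<alpha> ^ i = \<alpha> ^ zech i"
    "\<forall>i. trace_sign (\<alpha> ^ i) = log_sign i"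
    "\<forall>y. y \<noteq> 0 \<longrightarrow> y \<noteq> 1 \<longrightarrow> (\<exists>i\<in>{1..6}. y = \<alpha> ^ i)"
proof -
  have "UNIV \<noteq> {0, 1 :: 'k}"
  proof
    assume "UNIV = {0, 1 :: 'k}"
    then have "CARD('k) = card {0, 1 :: 'k}" by (rule arg_cong)
    then show False using card8 by simp
  qed
  then obtain x :: 'k where x: "x \<noteq> 0" "x \<noteq> 1" by auto
  have "\<exists>\<alpha>. \<alpha> \<noteq> 0 \<and> \<alpha> \<noteq> 1 \<and> trace8 \<alpha> = (0 :: 'k)"
  proof (cases "trace8 x = 0")
    case False
    then have "trace8 (1 / x) = 0"
      using trace8_cases[of x] trace8_inverse[OF x] one_add_one by auto
    then show ?thesis using x by (intro exI[of _ "1 / x"]) auto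
  qed (use x in blast)
  then obtain \<alpha> :: 'k where \<alpha>: "\<alpha> \<noteq> 0" "\<alpha> \<noteq> 1" "trace8 \<alpha> = 0" by blast
  have "\<alpha> * (1 + \<alpha> + \<alpha>^3) = trace8 \<alpha>"
    by (simp add: trace8_def eval_nat_numeral algebra_simps)
  then have "(1 + \<alpha>) + \<alpha>^3 = 0" using \<alpha> by simp
  then have cube: "\<alpha>^3 = 1 + \<alpha>" by (simp add: add_eq_0_iff_eq)
  have p4: "\<alpha>^4 = \<alpha> + \<alpha>^2"
  proof -
    have "\<alpha>^4 = \<alpha> * \<alpha>^3" by (simp add: eval_nat_numeral)
    then show ?thesis unfolding cube by (simp add: algebra_simps power2_eq_square)
  qed
  have p5: "\<alpha>^5 = 1 + \<alpha> + \<alpha>^2"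
  proof -
    have "\<alpha>^5 = \<alpha>^2 * \<alpha>^3" by (simp add: eval_nat_numeral)
    also have "\<dots> = \<alpha>^2 * (1 + \<alpha>)" by (simp only: cube)
    also have "\<dots> = \<alpha>^2 + \<alpha>^3" by (simp add: algebra_simps eval_nat_numeral)
    finally show ?thesis unfolding cube by (simp add: ac_simps)
  qed
  have p6: "\<alpha>^6 = 1 + \<alpha>^2"
  proof -
    have "\<alpha>^6 = (\<alpha>^3)^2" by (simp flip: power_mult)
    then show ?thesis unfolding cube by (simp add: square_add)
  qed
  have cancel: "u + (u + v) = v" for u v :: 'k
    using add_self[of u] by (simp flip: add.assoc)
  have interval: "i = 1 \<or> i = 2 \<or> i = 3 \<or> i = 4 \<or> i = 5 \<or> i = 6" if "i \<in> {1..6}" for i :: nat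
    using that by (simp; presburger)
  have zech: "1 + \<alpha> ^ i = \<alpha> ^ zech i" if "i \<in> {1..6}" for i
    using interval[OF that] by (elim disjE) (simp_all add: zech_def cube p4 p5 p6 cancel ac_simps)
  have ne1: "\<alpha> ^ i \<noteq> 1" if "i \<in> {1..6}" for i
  proof
    assume "\<alpha> ^ i = 1"
    then have "\<alpha> ^ zech i = 0" using zech[OF that] one_add_one by simp
    then show False using \<alpha> by simp
  qed
  have inj: "inj_on (\<lambda>i. \<alpha> ^ i) {1..6}"
  proof (rule linorder_inj_onI')
    fix i j :: nat assume ij: "i \<in> {1..6}" "j \<in> {1..6}" "i < j"
    show "\<alpha> ^ i \<noteq> \<alpha> ^ j"
    proof
      assume "\<alpha> ^ i = \<alpha> ^ j"
      also have "\<alpha> ^ j = \<alpha> ^ i * \<alpha> ^ (j - i)" using ij by (simp flip: power_add)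
      finally have "\<alpha> ^ (j - i) = 1" using \<alpha> by simp
      moreover have "j - i \<in> {1..6}" using ij by (simp; linarith)
      ultimately show False using ne1 by blast
    qed
  qed
  have "(\<lambda>i. \<alpha> ^ i) ` {1..6} = UNIV - {0, 1}"
  proof (rule card_subset_eq)
    show "card ((\<lambda>i. \<alpha> ^ i) ` {1..6}) = card (UNIV - {0, 1 :: 'k})"
      using inj card8 finite_field by (simp add: card_image card_Diff_subset)
  qed (use finite_field ne1 \<alpha> in \<open>auto intro: rev_finite_subset\<close>)
  then have onto: "\<exists>i\<in>{1..6}. y = \<alpha> ^ i" if "y \<noteq> 0" "y \<noteq> 1" for y
    using that by (metis DiffI UNIV_I empty_iff imageE insert_iff)
  have s124: "trace_sign \<alpha> = 1" "trace_sign (\<alpha>^2) = 1" "trace_sign (\<alpha>^4) = 1"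
    using \<alpha>(3) trace_sign_square[of "\<alpha>^2"] trace_sign_square[of \<alpha>] by (simp_all add: trace_sign_def flip: power_mult)
  have "trace_sign (\<alpha>^3) = - 1" "trace_sign (\<alpha>^6) = - 1" "trace_sign (\<alpha>^5) = - 1"
    using trace_sign_add_one[of \<alpha>] trace_sign_add_one[of "\<alpha>^2"] trace_sign_add_one[of "\<alpha>^4"]
      zech[of 4] s124 by (simp_all add: cube p6 zech_def)
  moreover have "trace_sign (1 :: 'k) = - 1" by (simp add: trace_sign_def trace8_one)
  ultimately have small: "trace_sign (\<alpha> ^ i) = log_sign i" if "i < 7" for i
  proof -
    have "i = 0 \<or> i = 1 \<or> i = 2 \<or> i = 3 \<or> i = 4 \<or> i = 5 \<or> i = 6" using that by presburger
    then show ?thesis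
      using s124 \<open>trace_sign (\<alpha>^3) = - 1\<close> \<open>trace_sign (\<alpha>^6) = - 1\<close> \<open>trace_sign (\<alpha>^5) = - 1\<close> \<open>trace_sign 1 = - 1\<close>
      by (elim disjE) (simp_all add: log_sign_def)
  qed
  have "trace_sign (\<alpha> ^ i) = log_sign i" for i
  proof -
    have "\<alpha> ^ i = (\<alpha>^7) ^ (i div 7) * \<alpha> ^ (i mod 7)" by (simp flip: power_mult power_add)
    then have "\<alpha> ^ i = \<alpha> ^ (i mod 7)" using power7[OF \<alpha>(1)] by simp
    then show ?thesis using small[of "i mod 7"] by (simp add: log_sign_def)
  qed
  then show thesis using that \<alpha>(1) zech onto by blast
qed

text \<open>Here y and z are coordinates of five points up to projectivity, and w, z/y and wy/z are
  the other three cross ratios; see \<open>coboundary_values\<close>. Taking logarithms leaves a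
  finite check.\<close>

lemma trace_sign_cocycle:
  assumes yz: "y \<noteq> 0" "y \<noteq> 1" "z \<noteq> 0" "z \<noteq> 1" "y \<noteq> (z :: 'k)" and w: "w * (1 + y) = 1 + z"
  shows "trace_sign (w * y / z) - trace_sign w + trace_sign (z / y) - trace_sign z + trace_sign y \<in> {3, - 3}"
proof -
  obtain \<alpha> :: 'k where \<alpha>: "\<alpha> \<noteq> 0" "\<forall>i\<in>{1..6}. 1 + \<alpha> ^ i = \<alpha> ^ zech i"
    "\<forall>i. trace_sign (\<alpha> ^ i) = log_sign i"
    "\<forall>y. y \<noteq> 0 \<longrightarrow> y \<noteq> 1 \<longrightarrow> (\<exists>i\<in>{1..6}. y = \<alpha> ^ i)"
    by (rule primitive_element)
  obtain i j where i: "i \<in> {1..6}" "y = \<alpha> ^ i" and j: "j \<in> {1..6}" "z = \<alpha> ^ j"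
    using \<alpha>(4) yz by metis
  have "i \<noteq> j" using i j yz by auto
  have p7: "\<alpha> ^ 7 = 1" using power7 \<alpha>(1) by blast
  have quotient: "\<alpha> ^ m / \<alpha> ^ k = \<alpha> ^ (m + 7 - k)" if "k \<le> 7" for m k
  proof -
    have "\<alpha> ^ (m + 7 - k) * \<alpha> ^ k = \<alpha> ^ m * \<alpha> ^ 7" using that by (simp flip: power_add)
    then show ?thesis using \<alpha>(1) p7 by (simp add: field_simps)
  qed
  have zech_le: "zech i \<le> 7" if "i \<in> {1..6}" for i
  proof -
    have "i = 1 \<or> i = 2 \<or> i = 3 \<or> i = 4 \<or> i = 5 \<or> i = 6" using that by (simp; presburger)
    then show ?thesis by (elim disjE) (simp_all add: zech_def)
  qed
  have "w * \<alpha> ^ zech i = \<alpha> ^ zech j"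
    using w bspec[OF \<alpha>(2) i(1)] bspec[OF \<alpha>(2) j(1)] unfolding i(2) j(2) by simp
  then have "w = \<alpha> ^ zech j / \<alpha> ^ zech i"
    using \<alpha>(1) by (simp add: field_simps)
  then have w': "w = \<alpha> ^ (zech j + 7 - zech i)" using quotient zech_le i by simp
  have wyz: "w * y / z = \<alpha> ^ (zech j + 7 - zech i + i + 7 - j)"
    unfolding w' i j using quotient[of j "zech j + 7 - zech i + i"] j by (simp add: power_add)
  have zy: "z / y = \<alpha> ^ (j + 7 - i)" using i j quotient by simp
  have "i \<in> set [1..<7]" "j \<in> set [1..<7]" using i j by auto
  then show ?thesis
    unfolding wyz zy unfolding w' i j \<alpha>(3)[rule_format] using bspec[OF bspec[OF log_sign_cocycle]] \<open>i \<noteq> j\<close> by blast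
qed

text \<open>Inversion permutes the six elements and reverses every sign.\<close>

lemma trace_sign_sum: "(\<Sum>y\<in>UNIV - {0, 1 :: 'k}. trace_sign y) = 0"
proof -
  let ?S = "\<Sum>y\<in>UNIV - {0, 1 :: 'k}. trace_sign y"
  have "?S = (\<Sum>y\<in>UNIV - {0, 1 :: 'k}. trace_sign (1 / y))"
    by (rule sum.reindex_bij_witness[of _ "\<lambda>y. 1 / y" "\<lambda>y. 1 / y"]) auto
  also have "\<dots> = - ?S"
    by (simp add: trace_sign_inverse sum_negf)
  finally show ?thesis by simp
qed

text \<open>Multiplication by an element other than 0 and 1 permutes the field and hence fixes the
  sum.\<close>

lemma field_sum: "(\<Sum>x\<in>UNIV. x) = (0 :: 'k)"
proof -
  obtain \<alpha> :: 'k where \<alpha>: "\<alpha> \<noteq> 0" "\<forall>i\<in>{1..6}. 1 + \<alpha> ^ i = \<alpha> ^ zech i"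
    by (rule primitive_element)
  have "1 + \<alpha> = \<alpha> ^ zech 1" using bspec[OF \<alpha>(2), of 1] by simp
  then have "\<alpha> \<noteq> 1" using one_add_one by auto
  have "(\<Sum>x\<in>UNIV. x) = (\<Sum>x\<in>UNIV. \<alpha> * (x :: 'k))"
    by (rule sum.reindex_bij_witness[of _ "\<lambda>x. \<alpha> * x" "\<lambda>x. x / \<alpha>"]) (use \<alpha>(1) in auto)
  also have "\<dots> = \<alpha> * (\<Sum>x\<in>UNIV. x)" by (simp only: sum_distrib_left)
  finally have "(1 - \<alpha>) * (\<Sum>x\<in>UNIV. x) = (0 :: 'k)"
    by (simp add: left_diff_distrib)
  then show ?thesis using \<open>\<alpha> \<noteq> 1\<close> by simp
qed

end

section \<open>The sign of the cross ratio\<close>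

text \<open>The determinant of the matrix with columns v and w.\<close>

definition bracket :: "('k::field)^2 \<Rightarrow> 'k^2 \<Rightarrow> 'k" where
  "bracket v w = v $ 1 * w $ 2 - v $ 2 * w $ 1"

definition cross_ratio :: "('k::field)^2 \<Rightarrow> 'k^2 \<Rightarrow> 'k^2 \<Rightarrow> 'k^2 \<Rightarrow> 'k" where
  "cross_ratio a b c d = bracket a c * bracket b d / (bracket a d * bracket b c)"

definition line_vector :: "(('k::field)^2) set \<Rightarrow> 'k^2" where
  "line_vector L = (SOME v. v \<noteq> 0 \<and> L = vec.span {v})"

definition cross_sign ::
  "(('k::field)^2) set \<Rightarrow> ('k^2) set \<Rightarrow> ('k^2) set \<Rightarrow> ('k^2) set \<Rightarrow> int" where
  "cross_sign A B C D =
     trace_sign (cross_ratio (line_vector A) (line_vector B) (line_vector C) (line_vector D))"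

lemma span_singleton_vec: "vec.span {v} = range (\<lambda>c. c *s (v :: ('k::field)^2))"
  by (rule vec.span_singleton)

lemma bracket_self [simp]: "bracket v v = (0 :: 'k::field)"
  by (simp add: bracket_def mult.commute)

lemma bracket_antisym: "bracket w v = - bracket v (w :: ('k::field)^2)"
  by (simp add: bracket_def algebra_simps)

lemma bracket_smult [simp]:
  "bracket (c *s v) w = c * bracket v (w :: ('k::field)^2)" "bracket v (c *s w) = c * bracket v w"
  by (simp_all add: bracket_def algebra_simps)

lemma bracket_add:
  "bracket (u + v) w = bracket u w + bracket v (w :: ('k::field)^2)"
  "bracket w (u + v) = bracket w u + bracket w v"
  by (simp_all add: bracket_def algebra_simps)

lemma bracket_matrix: "bracket (A *v v) (A *v w) = det A * bracket v (w :: ('k::field)^2)"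
  by (simp add: bracket_def matrix_vector_mult_def sum_2 det_2 algebra_simps)

text \<open>This three-term identity is the reason that exchanging the two middle points of a cross
  ratio r gives 1 - r, which is 1 + r over F_8.\<close>

lemma plucker:
  "bracket a b * bracket c d - bracket a c * bracket b d + bracket a d * bracket b c = (0 :: 'k::field)"
  by (simp add: bracket_def algebra_simps)

lemma vec2_nonzero: "(v :: ('k::field)^2) \<noteq> 0 \<longleftrightarrow> v $ 1 \<noteq> 0 \<or> v $ 2 \<noteq> 0"
  by (simp add: vec_eq_iff forall_2)

lemma bracket_eq_0_iff:
  fixes v w :: "('k::field)^2"
  assumes "v \<noteq> 0"
  shows "bracket v w = 0 \<longleftrightarrow> (\<exists>c. w = c *s v)"
proof
  assume br: "bracket v w = 0"
  show "\<exists>c. w = c *s v"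
  proof (cases "v $ 1 = 0")
    case False
    then have "w = (w $ 1 / v $ 1) *s v"
      using br by (simp add: vec_eq_iff forall_2 bracket_def field_simps)
    then show ?thesis by blast
  next
    case True
    then have "v $ 2 \<noteq> 0" using assms by (simp add: vec2_nonzero)
    then have "w = (w $ 2 / v $ 2) *s v"
      using br True by (simp add: vec_eq_iff forall_2 bracket_def field_simps)
    then show ?thesis by blast
  qed
qed auto

lemma span_eq_iff_bracket:
  fixes v w :: "('k::field)^2"
  assumes "v \<noteq> 0" "w \<noteq> 0"
  shows "vec.span {v} = vec.span {w} \<longleftrightarrow> bracket v w = 0"
proof
  assume "vec.span {v} = vec.span {w}"
  then have "w \<in> vec.span {v}" by (simp add: vec.span_base)
  then show "bracket v w = 0" by (auto simp: span_singleton_vec)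
next
  assume "bracket v w = 0"
  then obtain c where c: "w = c *s v" using assms(1) by (auto simp: bracket_eq_0_iff)
  then have "c \<noteq> 0" using assms(2) by auto
  then have "v = (1 / c) *s w" using c by (simp add: vec_eq_iff)
  then have "v \<in> vec.span {w}" unfolding span_singleton_vec by (rule range_eqI)
  moreover have "w \<in> vec.span {v}" using c unfolding span_singleton_vec by (rule range_eqI)
  ultimately show "vec.span {v} = vec.span {w}" by (intro vec.span_eq[THEN iffD2]) auto
qed

lemma line_vector:
  assumes "L \<in> projective_line"
  shows "line_vector L \<noteq> 0" and "vec.span {line_vector L} = L"
proof -
  obtain v where "v \<noteq> 0 \<and> L = vec.span {v}" using assms by (auto simp: projective_line_def)
  then have "line_vector L \<noteq> 0 \<and> L = vec.span {line_vector L}"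
    unfolding line_vector_def by (rule someI)
  then show "line_vector L \<noteq> 0" "vec.span {line_vector L} = L" by simp_all
qed

lemma span_in_projective_line: "v \<noteq> 0 \<Longrightarrow> vec.span {v} \<in> projective_line"
  by (auto simp: projective_line_def)

text \<open>Each vector occurs once in the numerator and once in the denominator. So the arbitrary
  choice in \<open>line_vector\<close> does not influence the cross ratio.\<close>

lemma cross_ratio_smult:
  assumes "p \<noteq> 0" "q \<noteq> 0" "r \<noteq> 0" "s \<noteq> 0"
  shows "cross_ratio (p *s a) (q *s b) (r *s c) (s *s d) = cross_ratio a b c (d :: ('k::field)^2)"
  using assms by (simp add: cross_ratio_def)

lemma line_vector_span:
  assumes "v \<noteq> (0 :: ('k::field)^2)"
  obtains c where "c \<noteq> 0" "line_vector (vec.span {v}) = c *s v"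
proof -
  have L: "line_vector (vec.span {v}) \<noteq> 0" "vec.span {line_vector (vec.span {v})} = vec.span {v}"
    using line_vector[OF span_in_projective_line[OF assms]] by simp_all
  then have "line_vector (vec.span {v}) \<in> vec.span {v}"
    using vec.span_base[of "line_vector (vec.span {v})" "{line_vector (vec.span {v})}"] by simp
  then obtain c where c: "line_vector (vec.span {v}) = c *s v" by (auto simp: span_singleton_vec)
  then have "c \<noteq> 0" using L(1) by auto
  then show thesis using that c by blast
qed

lemma cross_sign_span:
  assumes "a \<noteq> 0" "b \<noteq> 0" "c \<noteq> 0" "d \<noteq> (0 :: ('k::field)^2)"
  shows "cross_sign (vec.span {a}) (vec.span {b}) (vec.span {c}) (vec.span {d}) = trace_sign (cross_ratio a b c d)"
proof -
  obtain p where p: "p \<noteq> 0" "line_vector (vec.span {a}) = p *s a" using assms(1) by (rule line_vector_span)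
  obtain q where q: "q \<noteq> 0" "line_vector (vec.span {b}) = q *s b" using assms(2) by (rule line_vector_span)
  obtain r where r: "r \<noteq> 0" "line_vector (vec.span {c}) = r *s c" using assms(3) by (rule line_vector_span)
  obtain s where s: "s \<noteq> 0" "line_vector (vec.span {d}) = s *s d" using assms(4) by (rule line_vector_span)
  show ?thesis unfolding cross_sign_def p(2) q(2) r(2) s(2)
    by (rule arg_cong[OF cross_ratio_smult[OF p(1) q(1) r(1) s(1)]])
qed

lemma matrix_image_span: "(\<lambda>v. A *v v) ` vec.span {v} = vec.span {A *v v}"
  for A :: "'k::field^2^2"
  by (simp add: span_singleton_vec image_image vector_scalar_commute)

lemma invertible_det: "invertible A \<longleftrightarrow> det (A :: ('k::field)^2^2) \<noteq> 0"
  by (rule invertible_det_nz)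

lemma bracket_nonzero: "bracket v w \<noteq> 0 \<Longrightarrow> v \<noteq> 0 \<and> w \<noteq> (0 :: ('k::field)^2)"
  by (auto simp: bracket_def)

lemma matrix_nonzero:
  assumes "invertible A" "v \<noteq> (0 :: ('k::field)^2)"
  shows "A *v v \<noteq> 0"
proof -
  obtain B where "B ** A = mat 1" using assms(1) by (auto simp: invertible_def)
  then have "B *v (A *v v) = v" by (simp add: matrix_vector_mul_assoc)
  then show ?thesis using assms(2) by auto
qed

lemma cross_ratio_matrix:
  assumes "invertible A"
  shows "cross_ratio (A *v a) (A *v b) (A *v c) (A *v d) = cross_ratio a b c (d :: ('k::field)^2)"
  using assms by (simp add: cross_ratio_def bracket_matrix invertible_det)

section \<open>Invariance of the sign under semilinear maps and its alternation\<close>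

definition frobenius_vector :: "('k::field)^2 \<Rightarrow> 'k^2" where
  "frobenius_vector v = (\<chi> i. (v $ i)\<^sup>2)"

context field8
begin

lemma frobenius_span: "frobenius_line (vec.span {v}) = vec.span {frobenius_vector (v :: 'k^2)}"
proof -
  have "frobenius_vector (c *s v) = c^2 *s frobenius_vector v" for c
    by (simp add: frobenius_vector_def vec_eq_iff power_mult_distrib)
  then have "frobenius_line (vec.span {v}) = (\<lambda>d. d *s frobenius_vector v) ` range (\<lambda>c. c^2)"
    by (simp add: frobenius_line_def span_singleton_vec image_image flip: frobenius_vector_def)
  also have "range (\<lambda>c :: 'k. c^2) = UNIV"
  proof (rule surjI)
    \<comment> \<open>The fourth power inverts squaring because x^8 = x.\<close>
    show "(d^4)^2 = d" for d :: 'k using power8[of d] by (simp flip: power_mult)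
  qed
  finally show ?thesis by (simp add: span_singleton_vec)
qed

lemma frobenius_nonzero: "v \<noteq> 0 \<Longrightarrow> frobenius_vector v \<noteq> (0 :: 'k^2)"
  by (simp add: vec2_nonzero frobenius_vector_def)

lemma cross_ratio_frobenius:
  "cross_ratio (frobenius_vector a) (frobenius_vector b) (frobenius_vector c) (frobenius_vector d) =
    (cross_ratio a b c (d :: 'k^2))^2"
proof -
  have "bracket (frobenius_vector v) (frobenius_vector w) = (bracket v w)^2" for v w :: "'k^2"
    by (simp add: bracket_def frobenius_vector_def minus_eq_add square_add power_mult_distrib)
  then show ?thesis by (simp add: cross_ratio_def power_mult_distrib power_divide)
qed

lemma frobenius_projective: "L \<in> projective_line \<Longrightarrow> frobenius_line L \<in> (projective_line :: ('k^2) set set)"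
  by (auto simp: projective_line_def frobenius_span intro!: frobenius_nonzero)

text \<open>Frobenius squares the cross ratio, and the trace is invariant under squaring.\<close>

lemma cross_sign_frobenius:
  assumes "A \<in> projective_line" "B \<in> projective_line" "C \<in> projective_line" "D \<in> (projective_line :: ('k^2) set set)"
  shows "cross_sign (frobenius_line A) (frobenius_line B) (frobenius_line C) (frobenius_line D) = cross_sign A B C D"
proof -
  obtain a b c d where "a \<noteq> 0" "A = vec.span {a}" "b \<noteq> 0" "B = vec.span {b}"
    "c \<noteq> 0" "C = vec.span {c}" "d \<noteq> 0" "D = vec.span {d}"
    using assms unfolding projective_line_def by blast
  then show ?thesis
    by (simp add: frobenius_span cross_sign_span frobenius_nonzero cross_ratio_frobenius trace_sign_square)
qed

lemma cross_sign_PGL2: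
  assumes g: "g \<in> PGL2"
    and "A \<in> projective_line" "B \<in> projective_line" "C \<in> projective_line" "D \<in> (projective_line :: ('k^2) set set)"
  shows "cross_sign (g A) (g B) (g C) (g D) = cross_sign A B C D"
proof -
  obtain M :: "'k^2^2" where "invertible M" "g = (\<lambda>L\<in>projective_line. (\<lambda>v. M *v v) ` L)"
    using g by (auto simp: PGL2_def)
  note M = this
  obtain a b c d where "a \<noteq> 0" "A = vec.span {a}" "b \<noteq> 0" "B = vec.span {b}"
    "c \<noteq> 0" "C = vec.span {c}" "d \<noteq> 0" "D = vec.span {d}"
    using assms(2-) unfolding projective_line_def by blast
  then show ?thesis
    using M by (simp add: span_in_projective_line matrix_image_span cross_sign_span matrix_nonzero
        cross_ratio_matrix)
qed

lemma cross_sign_PGammaL2: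
  assumes g: "g \<in> PGammaL2"
    and L: "A \<in> projective_line" "B \<in> projective_line" "C \<in> projective_line" "D \<in> (projective_line :: ('k^2) set set)"
  shows "cross_sign (g A) (g B) (g C) (g D) = cross_sign A B C D"
proof -
  obtain h i where h: "h \<in> PGL2" "g = compose projective_line h (frobenius_line ^^ i)"
    using g by (auto simp: PGammaL2_def)
  have proj: "(frobenius_line ^^ i) L \<in> projective_line" if "L \<in> projective_line" for i and L :: "('k^2) set"
    using that by (induction i) (simp_all add: frobenius_projective)
  have "cross_sign ((frobenius_line ^^ i) A) ((frobenius_line ^^ i) B) ((frobenius_line ^^ i) C)
      ((frobenius_line ^^ i) D) = cross_sign A B C D"
    by (induction i) (simp_all add: cross_sign_frobenius proj L)
  then show ?thesis
    using h(2) L cross_sign_PGL2[OF h(1)] by (simp add: compose_def proj)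
qed

lemma cross_ratio_swaps:
  fixes a b c d :: "'k^2"
  assumes "bracket a b \<noteq> 0" "bracket a c \<noteq> 0" "bracket a d \<noteq> 0" "bracket b c \<noteq> 0" "bracket b d \<noteq> 0" "bracket c d \<noteq> 0"
  shows "cross_ratio a b c d \<noteq> 0" "cross_ratio a b c d \<noteq> 1"
    "cross_ratio b a c d = 1 / cross_ratio a b c d"
    "cross_ratio a b d c = 1 / cross_ratio a b c d"
    "cross_ratio a c b d = 1 + cross_ratio a b c d"
    "1 + cross_ratio a b c d = bracket a b * bracket c d / (bracket a d * bracket b c)"
proof -
  have "1 + cross_ratio a b c d = (bracket a d * bracket b c - bracket a c * bracket b d) / (bracket a d * bracket b c)"
    using assms by (simp add: cross_ratio_def minus_eq_add field_simps)
  also have "bracket a d * bracket b c - bracket a c * bracket b d = - (bracket a b * bracket c d)"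
    using plucker[of a b c d] by (simp add: algebra_simps)
  finally show one: "1 + cross_ratio a b c d = bracket a b * bracket c d / (bracket a d * bracket b c)"
    by (simp only: uminus_eq)
  show "cross_ratio a b c d \<noteq> 0" using assms by (simp add: cross_ratio_def)
  show "cross_ratio a b c d \<noteq> 1" using one assms one_add_one by auto
  show "cross_ratio b a c d = 1 / cross_ratio a b c d" "cross_ratio a b d c = 1 / cross_ratio a b c d"
    using assms by (simp_all add: cross_ratio_def field_simps)
  show "cross_ratio a c b d = 1 + cross_ratio a b c d"
    unfolding one by (simp add: cross_ratio_def bracket_antisym[of b c] uminus_eq)
qed

lemma line_bracket:
  assumes "A \<in> projective_line" "B \<in> (projective_line :: ('k^2) set set)" "A \<noteq> B"
  shows "bracket (line_vector A) (line_vector B) \<noteq> 0"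
proof
  assume "bracket (line_vector A) (line_vector B) = 0"
  then have "vec.span {line_vector A} = vec.span {line_vector B}"
    using line_vector(1)[OF assms(1)] line_vector(1)[OF assms(2)] span_eq_iff_bracket by blast
  then show False
    unfolding line_vector(2)[OF assms(1)] line_vector(2)[OF assms(2)] using assms(3) by contradiction
qed

text \<open>Adjacent transpositions act on the cross ratio r by 1/r and 1 + r, and both add 1 to the
  trace when r is neither 0 nor 1.\<close>

lemma cross_sign_swaps:
  assumes "A \<in> projective_line" "B \<in> projective_line" "C \<in> projective_line" "D \<in> (projective_line :: ('k^2) set set)"
    and "distinct [A, B, C, D]"
  shows "cross_sign B A C D = - cross_sign A B C D"
    "cross_sign A C B D = - cross_sign A B C D"
    "cross_sign A B D C = - cross_sign A B C D"
proof -
  have br: "bracket (line_vector A) (line_vector B) \<noteq> 0" "bracket (line_vector A) (line_vector C) \<noteq> 0"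
    "bracket (line_vector A) (line_vector D) \<noteq> 0" "bracket (line_vector B) (line_vector C) \<noteq> 0"
    "bracket (line_vector B) (line_vector D) \<noteq> 0" "bracket (line_vector C) (line_vector D) \<noteq> 0"
    by (rule line_bracket; use assms in simp)+
  note swaps = cross_ratio_swaps[OF br]
  show "cross_sign B A C D = - cross_sign A B C D"
    "cross_sign A B D C = - cross_sign A B C D"
    unfolding cross_sign_def swaps(3,4) using swaps(1,2) by (simp_all add: trace_sign_inverse)
  show "cross_sign A C B D = - cross_sign A B C D"
    unfolding cross_sign_def swaps(5) by (rule trace_sign_add_one)
qed

section \<open>The coboundary on five points and the balance of signs\<close>

definition coboundary :: "(nat \<Rightarrow> ('k^2) set) \<Rightarrow> int" where
  "coboundary l = cross_sign (l 2) (l 3) (l 4) (l 5) - cross_sign (l 1) (l 3) (l 4) (l 5) +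
     cross_sign (l 1) (l 2) (l 4) (l 5) - cross_sign (l 1) (l 2) (l 3) (l 5) +
     cross_sign (l 1) (l 2) (l 3) (l 4)"

definition numbering :: "(nat \<Rightarrow> ('k^2) set) \<Rightarrow> bool" where
  "numbering l \<longleftrightarrow> bij_betw l {1..9} projective_line"

lemma numbering_in: "numbering l \<Longrightarrow> i \<in> {1..9} \<Longrightarrow> l i \<in> projective_line"
  unfolding numbering_def by (rule bij_betwE[THEN bspec])

lemma numbering_eq_iff: "numbering l \<Longrightarrow> i \<in> {1..9} \<Longrightarrow> j \<in> {1..9} \<Longrightarrow> l i = l j \<longleftrightarrow> i = j"
  unfolding numbering_def by (rule inj_on_eq_iff[OF bij_betw_imp_inj_on])

lemma numbering_permute: "numbering l \<Longrightarrow> p permutes {1..9} \<Longrightarrow> numbering (l \<circ> p)"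
  unfolding numbering_def by (rule bij_betw_trans[OF permutes_imp_bij])

text \<open>All five cross ratios are rational functions of the two called y and z, which reduces
  the claim to \<open>trace_sign_cocycle\<close>.\<close>

lemma coboundary_values:
  assumes l: "numbering l"
  shows "coboundary l \<in> {3, - 3}"
proof -
  define v where "v i = line_vector (l i)" for i
  have br: "bracket (v i) (v j) \<noteq> 0" if "i \<in> {1..9}" "j \<in> {1..9}" "i \<noteq> j" for i j
    using that numbering_in[OF l] numbering_eq_iff[OF l] by (simp add: v_def line_bracket del: atLeastAtMost_iff)
  have b: "bracket (v 1) (v 2) \<noteq> 0" "bracket (v 1) (v 3) \<noteq> 0" "bracket (v 1) (v 4) \<noteq> 0" "bracket (v 1) (v 5) \<noteq> 0"
    "bracket (v 2) (v 3) \<noteq> 0" "bracket (v 2) (v 4) \<noteq> 0" "bracket (v 2) (v 5) \<noteq> 0"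
    "bracket (v 3) (v 4) \<noteq> 0" "bracket (v 3) (v 5) \<noteq> 0" "bracket (v 4) (v 5) \<noteq> 0"
    by (rule br; simp)+
  define y z w where "y = cross_ratio (v 1) (v 2) (v 3) (v 4)" and "z = cross_ratio (v 1) (v 2) (v 3) (v 5)"
    and "w = cross_ratio (v 1) (v 3) (v 4) (v 5)"
  have zy: "cross_ratio (v 1) (v 2) (v 4) (v 5) = z / y"
    using b by (simp add: y_def z_def cross_ratio_def field_simps)
  have yz: "y \<noteq> 0" "y \<noteq> 1" "z \<noteq> 0" "z \<noteq> 1"
    unfolding y_def z_def using b by (intro cross_ratio_swaps; simp)+
  have "z / y \<noteq> 1"
    unfolding zy[symmetric] using b by (intro cross_ratio_swaps(2)) simp_all
  then have "y \<noteq> z" using yz by auto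
  have y1: "1 + y = bracket (v 1) (v 2) * bracket (v 3) (v 4) / (bracket (v 1) (v 4) * bracket (v 2) (v 3))"
    unfolding y_def using b by (intro cross_ratio_swaps(6)) simp_all
  have z1: "1 + z = bracket (v 1) (v 2) * bracket (v 3) (v 5) / (bracket (v 1) (v 5) * bracket (v 2) (v 3))"
    unfolding z_def using b by (intro cross_ratio_swaps(6)) simp_all
  have w: "w * (1 + y) = 1 + z"
    unfolding y1 z1 w_def cross_ratio_def using b by simp
  have wyz: "cross_ratio (v 2) (v 3) (v 4) (v 5) = w * y / z"
    using b by (simp add: y_def z_def w_def cross_ratio_def field_simps)
  show ?thesis
    using trace_sign_cocycle[OF yz \<open>y \<noteq> z\<close> w]
    unfolding coboundary_def cross_sign_def v_def[symmetric] zy wyz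
    unfolding y_def[symmetric] z_def[symmetric] w_def[symmetric] .
qed

text \<open>With three points fixed, the cross ratio is a bijection from the other six points onto
  the field without 0 and 1, where the signs are balanced.\<close>

lemma cross_sign_sum:
  assumes l: "numbering l" and ijk: "i \<in> {1..9}" "j \<in> {1..9}" "k \<in> {1..9}" "distinct [i, j, k]"
  shows "(\<Sum>m\<in>{1..9} - {i, j, k}. cross_sign (l i) (l j) (l k) (l m)) = 0"
proof -
  define v where "v i = line_vector (l i)" for i
  have br: "bracket (v i) (v j) \<noteq> 0" if "i \<in> {1..9}" "j \<in> {1..9}" "i \<noteq> j" for i j
    using that numbering_in[OF l] numbering_eq_iff[OF l] by (simp add: v_def line_bracket del: atLeastAtMost_iff)
  define y where "y m = cross_ratio (v i) (v j) (v k) (v m)" for m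
  let ?S = "{1..9} - {i, j, k}"
  have inj: "inj_on y ?S"
  proof (rule inj_onI, rule ccontr)
    fix m m' assume m: "m \<in> ?S" "m' \<in> ?S" "y m = y m'" "m \<noteq> m'"
    have b: "bracket (v i) (v j) \<noteq> 0" "bracket (v i) (v k) \<noteq> 0" "bracket (v i) (v m) \<noteq> 0" "bracket (v i) (v m') \<noteq> 0"
      "bracket (v j) (v k) \<noteq> 0" "bracket (v j) (v m) \<noteq> 0" "bracket (v j) (v m') \<noteq> 0" "bracket (v m) (v m') \<noteq> 0"
      by (rule br; use m ijk in auto)+
    \<comment> \<open>The quotient of two of these cross ratios is itself a cross ratio of four
      distinct points, hence not 1.\<close>
    have "cross_ratio (v i) (v j) (v m) (v m') = y m' / y m"
      using b by (simp add: y_def cross_ratio_def field_simps)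
    also have "\<dots> = 1" using m(3) b by (simp add: y_def cross_ratio_def)
    finally show False using cross_ratio_swaps(2)[of "v i" "v j" "v m" "v m'"] b by simp
  qed
  have range: "y ` ?S \<subseteq> UNIV - {0, 1}"
  proof (rule image_subsetI)
    fix m assume m: "m \<in> ?S"
    have "bracket (v i) (v j) \<noteq> 0" "bracket (v i) (v k) \<noteq> 0" "bracket (v i) (v m) \<noteq> 0"
      "bracket (v j) (v k) \<noteq> 0" "bracket (v j) (v m) \<noteq> 0" "bracket (v k) (v m) \<noteq> 0"
      by (rule br; use m ijk in auto)+
    then show "y m \<in> UNIV - {0, 1}"
      using cross_ratio_swaps(1,2) by (simp add: y_def)
  qed
  have "card {i, j, k} = 3" using ijk by simp
  moreover have "{i, j, k} \<subseteq> {1..9}" using ijk by blast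
  ultimately have "card ?S = 6" by (subst card_Diff_subset) simp_all
  then have "y ` ?S = UNIV - {0, 1}"
    using range inj card8 finite_field by (intro card_subset_eq) (auto simp: card_image card_Diff_subset)
  then have "(\<Sum>m\<in>?S. trace_sign (y m)) = 0"
    using trace_sign_sum sum.reindex[OF inj, of trace_sign] by simp
  then show ?thesis by (simp add: cross_sign_def y_def v_def)
qed

end

section \<open>Transvections and sets of four points\<close>

lemma span_smult: "c \<noteq> 0 \<Longrightarrow> vec.span {c *s v} = vec.span {v :: ('k::field)^2}"
proof (cases "v = 0")
  case False
  assume "c \<noteq> 0"
  then have "c *s v \<noteq> 0" using False by (simp add: vec2_nonzero)
  then show ?thesis using False by (subst span_eq_iff_bracket) simp_all
qed simp

section \<open>Alternation and boundary of the coboundary; the affine chart\<close>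

context field8
begin

lemma coboundary_swap_adjacent:
  assumes l: "numbering l" and i: "i \<in> {1, 2, 3, 4}"
  shows "coboundary (l \<circ> swap i (Suc i)) = - coboundary l"
proof -
  have swaps: "cross_sign (l b) (l a) (l c) (l d) = - cross_sign (l a) (l b) (l c) (l d)"
    "cross_sign (l a) (l c) (l b) (l d) = - cross_sign (l a) (l b) (l c) (l d)"
    "cross_sign (l a) (l b) (l d) (l c) = - cross_sign (l a) (l b) (l c) (l d)"
    if "{a, b, c, d} \<subseteq> {1..9}" "distinct [a, b, c, d]" for a b c d
    by (rule cross_sign_swaps; use that numbering_in[OF l] numbering_eq_iff[OF l] in simp)+
  from i consider "i = 1" | "i = 2" | "i = 3" | "i = 4" by auto
  then show ?thesis
  proof cases
    case 1
    then show ?thesis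
      using swaps(1)[of 1 2 4 5] swaps(1)[of 1 2 3 5] swaps(1)[of 1 2 3 4]
      by (simp add: coboundary_def Transposition.transpose_def numeral_2_eq_2[symmetric])
  next
    case 2
    then show ?thesis
      using swaps(1)[of 2 3 4 5] swaps(2)[of 1 2 3 5] swaps(2)[of 1 2 3 4]
      by (simp add: coboundary_def Transposition.transpose_def)
  next
    case 3
    then show ?thesis
      using swaps(2)[of 2 3 4 5] swaps(2)[of 1 3 4 5] swaps(3)[of 1 2 3 4]
      by (simp add: coboundary_def Transposition.transpose_def)
  next
    case 4
    then show ?thesis
      using swaps(3)[of 2 3 4 5] swaps(3)[of 1 3 4 5] swaps(3)[of 1 2 4 5]
      by (simp add: coboundary_def Transposition.transpose_def)
  qed
qed

text \<open>Conjugating the adjacent transposition (j j+1) by (i j) gives (i j+1), so the distance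
  grows by one at each step; three sign changes amount to one.\<close>

lemma coboundary_swap:
  assumes l: "numbering l" and ij: "i \<in> {1..5}" "j \<in> {1..5}" "i \<noteq> j"
  shows "coboundary (l \<circ> swap i j) = - coboundary l"
proof -
  have less: "coboundary (l \<circ> swap i (Suc (i + d))) = - coboundary l"
    if "1 \<le> i" "Suc (i + d) \<le> 5" "numbering l" for i d l
    using that
  proof (induction d arbitrary: l)
    case 0
    then have "i \<in> {1, 2, 3, 4}" by auto
    then show ?case using coboundary_swap_adjacent[OF 0(3), of i] by (simp add: comp_def)
  next
    case (Suc d)
    let ?j = "Suc (i + d)"
    have p: "swap i ?j permutes {1..9}" "swap ?j (Suc ?j) permutes {1..9}"
      using Suc by (auto intro!: permutes_swap_id)
    have eq: "swap i (Suc ?j) = swap i ?j \<circ> swap ?j (Suc ?j) \<circ> swap i ?j"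
      by (auto simp: fun_eq_iff Transposition.transpose_def)
    have n1: "numbering (l \<circ> swap i ?j)" using Suc.prems(3) p(1) by (rule numbering_permute)
    have n2: "numbering (l \<circ> swap i ?j \<circ> swap ?j (Suc ?j))" using n1 p(2) by (rule numbering_permute)
    have "?j \<in> {1, 2, 3, 4}" using Suc.prems by auto
    then have "coboundary (l \<circ> swap i ?j \<circ> swap ?j (Suc ?j)) = coboundary l"
      using coboundary_swap_adjacent[OF n1] Suc.IH[OF Suc.prems(1) _ Suc.prems(3)] Suc.prems(2) by (simp add: comp_def)
    moreover have "coboundary (l \<circ> swap i ?j \<circ> swap ?j (Suc ?j) \<circ> swap i ?j) =
        - coboundary (l \<circ> swap i ?j \<circ> swap ?j (Suc ?j))"
      using Suc.IH[OF Suc.prems(1) _ n2] Suc.prems(2) by (simp add: comp_def)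
    ultimately show ?case unfolding add_Suc_right eq o_assoc by (simp add: comp_def)
  qed
  show ?thesis
  proof (cases "i < j")
    case True
    then show ?thesis using less[of i "j - i - 1" l] l ij by (simp add: comp_def)
  next
    case False
    then show ?thesis using less[of j "i - j - 1" l] l ij by (simp add: transpose_commute comp_def)
  qed
qed

text \<open>Each of the four terms containing the moving point is summed by
  \<open>cross_sign_sum\<close> up to one index outside 5 to 9, and alternation turns that remainder
  into the constant term. The constant term occurs five times, so the factor is 5 + 4 = 9.\<close>

lemma coboundary_sum:
  assumes l: "numbering l"
  shows "(\<Sum>j\<in>{5..9}. coboundary (l \<circ> swap 5 j)) = 9 * cross_sign (l 1) (l 2) (l 3) (l 4)"
proof -
  let ?t = "\<lambda>a b c d. cross_sign (l a) (l b) (l c) (l d)"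
  have swaps: "?t b a c d = - ?t a b c d" "?t a c b d = - ?t a b c d" "?t a b d c = - ?t a b c d"
    if "{a, b, c, d} \<subseteq> {1..9}" "distinct [a, b, c, d]" for a b c d
    by (rule cross_sign_swaps; use that numbering_in[OF l] numbering_eq_iff[OF l] in simp)+
  have split: "{1..9} - {2, 3, 4} = insert 1 {5..9 :: nat}" "{1..9} - {1, 3, 4} = insert 2 {5..9 :: nat}"
    "{1..9} - {1, 2, 4} = insert 3 {5..9 :: nat}" "{1..9} - {1, 2, 3} = insert 4 {5..9 :: nat}"
    by auto
  have s1: "(\<Sum>j\<in>{5..9}. ?t 2 3 4 j) = - ?t 2 3 4 1"
    using cross_sign_sum[OF l, of 2 3 4] unfolding split by simp
  have s2: "(\<Sum>j\<in>{5..9}. ?t 1 3 4 j) = - ?t 1 3 4 2"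
    using cross_sign_sum[OF l, of 1 3 4] unfolding split by simp
  have s3: "(\<Sum>j\<in>{5..9}. ?t 1 2 4 j) = - ?t 1 2 4 3"
    using cross_sign_sum[OF l, of 1 2 4] unfolding split by simp
  have s4: "(\<Sum>j\<in>{5..9}. ?t 1 2 3 j) = - ?t 1 2 3 4"
    using cross_sign_sum[OF l, of 1 2 3] unfolding split by simp
  have "coboundary (l \<circ> swap 5 j) = ?t 2 3 4 j - ?t 1 3 4 j + ?t 1 2 4 j - ?t 1 2 3 j + ?t 1 2 3 4"
    if "j \<in> {5..9}" for j
    using that by (simp add: coboundary_def)
  then have "(\<Sum>j\<in>{5..9}. coboundary (l \<circ> swap 5 j)) =
      (\<Sum>j\<in>{5..9}. ?t 2 3 4 j - ?t 1 3 4 j + ?t 1 2 4 j - ?t 1 2 3 j + ?t 1 2 3 4)"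
    by (rule sum.cong[OF refl])
  also have "\<dots> = (\<Sum>j\<in>{5..9}. ?t 2 3 4 j) - (\<Sum>j\<in>{5..9}. ?t 1 3 4 j) + (\<Sum>j\<in>{5..9}. ?t 1 2 4 j)
      - (\<Sum>j\<in>{5..9}. ?t 1 2 3 j) + 5 * ?t 1 2 3 4"
    by (simp add: sum.distrib sum_subtractf)
  also have "\<dots> = - ?t 2 3 4 1 + ?t 1 3 4 2 - ?t 1 2 4 3 + ?t 1 2 3 4 + 5 * ?t 1 2 3 4"
    unfolding s1 s2 s3 s4 by simp
  also have "?t 2 3 4 1 = - ?t 1 2 3 4"
    using swaps(3)[of 2 3 1 4] swaps(2)[of 2 1 3 4] swaps(1)[of 1 2 3 4] by simp
  also have "?t 1 3 4 2 = ?t 1 2 3 4"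
    using swaps(3)[of 1 3 2 4] swaps(2)[of 1 2 3 4] by simp
  also have "?t 1 2 4 3 = - ?t 1 2 3 4" using swaps(3)[of 1 2 3 4] by simp
  finally show ?thesis by (simp add: comp_def)
qed

text \<open>The map v -> v + s [v, e] e, with [v, e] the bracket, fixes e and is a translation of
  the parameter t in b + t e; s is scaled so that it translates by c.\<close>

lemma transvection:
  fixes b e :: "'k^2"
  assumes "bracket b e \<noteq> 0"
  obtains g where "g \<in> PGL2" "g (vec.span {e}) = vec.span {e}"
    "\<And>t. g (vec.span {b + t *s e}) = vec.span {b + (t + c) *s e}"
proof -
  define s where "s = c / bracket b e"
  define A :: "'k^2^2" where
    "A = (\<chi> i j. (if i = j then 1 else 0) + s * e $ i * (if j = 1 then e $ 2 else - e $ 1))"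
  have A: "A *v v = v + (s * bracket v e) *s e" for v
    by (simp add: A_def matrix_vector_mult_def vec_eq_iff forall_2 sum_2 bracket_def algebra_simps)
  have "det A = 1" by (simp add: A_def det_2 algebra_simps)
  then have inv: "invertible A" by (simp add: invertible_det)
  have nonzero: "e \<noteq> 0" "b + t *s e \<noteq> 0" for t
    using assms bracket_nonzero[of "b + t *s e" e] bracket_nonzero[of b e] by (auto simp: bracket_add)
  let ?g = "\<lambda>L\<in>projective_line. (\<lambda>v. A *v v) ` L"
  show thesis
  proof (rule that[of ?g])
    show "?g \<in> PGL2" using inv by (auto simp: PGL2_def)
    have "A *v e = e" by (simp add: A)
    then show "?g (vec.span {e}) = vec.span {e}"
      using nonzero(1) by (simp add: span_in_projective_line matrix_image_span)
    show "?g (vec.span {b + t *s e}) = vec.span {b + (t + c) *s e}" for t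
    proof -
      have "A *v (b + t *s e) = b + (t + c) *s e"
        using assms by (simp add: A s_def bracket_add vec_eq_iff algebra_simps)
      then show ?thesis using nonzero(2) by (simp add: span_in_projective_line matrix_image_span)
    qed
  qed
qed

lemma affine_chart:
  fixes b e :: "'k^2"
  assumes be: "bracket b e \<noteq> 0" and L: "L \<in> projective_line" "L \<noteq> vec.span {e}"
  shows "\<exists>t. L = vec.span {b + t *s e}"
proof -
  define v where "v = line_vector L"
  have v: "v \<noteq> 0" "vec.span {v} = L" using line_vector[OF L(1)] by (simp_all add: v_def)
  have "e \<noteq> 0" using be bracket_nonzero by blast
  then have "bracket v e \<noteq> 0" using v L(2) span_eq_iff_bracket[of v e] by auto
  define t where "t = - (bracket v b / bracket v e)"
  have "bracket v (b + t *s e) = 0"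
    unfolding bracket_add bracket_smult using \<open>bracket v e \<noteq> 0\<close> by (simp add: t_def)
  moreover have "b + t *s e \<noteq> 0"
    using be bracket_nonzero[of "b + t *s e" e] by (simp add: bracket_add)
  ultimately have "vec.span {v} = vec.span {b + t *s e}" using v(1) span_eq_iff_bracket by blast
  then show ?thesis using v(2) by blast
qed

lemma affine_chart_inj:
  fixes b e :: "'k^2"
  assumes be: "bracket b e \<noteq> 0"
  shows "vec.span {b + s *s e} = vec.span {b + t *s e} \<longleftrightarrow> s = t" "vec.span {b + s *s e} \<noteq> vec.span {e}"
proof -
  have nz: "b + t *s e \<noteq> 0" for t
    using be bracket_nonzero[of "b + t *s e" e] by (simp add: bracket_add)
  have "bracket (b + s *s e) (b + t *s e) = (t - s) * bracket b e"
    using bracket_antisym[of e b] by (simp add: bracket_add algebra_simps)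
  then show "vec.span {b + s *s e} = vec.span {b + t *s e} \<longleftrightarrow> s = t"
    using be by (subst span_eq_iff_bracket[OF nz nz]) auto
  have "e \<noteq> 0" using be bracket_nonzero by blast
  then show "vec.span {b + s *s e} \<noteq> vec.span {e}"
    using be by (subst span_eq_iff_bracket[OF nz]) (auto simp: bracket_add)
qed

text \<open>Cramer's rule in two dimensions.\<close>

lemma vector_expansion:
  fixes a b v :: "'k^2"
  assumes "bracket a b \<noteq> 0"
  shows "v = (bracket v b / bracket a b) *s a + (bracket a v / bracket a b) *s b"
proof -
  have "bracket v b * a $ i + bracket a v * b $ i = bracket a b * v $ i" for i
  proof -
    have "i = 1 \<or> i = 2" using exhaust_2 by auto
    then show ?thesis by (auto simp: bracket_def algebra_simps)
  qed
  then show ?thesis using assms by (simp add: vec_eq_iff field_simps)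
qed

text \<open>Four points of the projective line over the field with eight elements are a coset of a
  plane in the affine line that is left when the common fixed point of the three
  involutions stabilizing the four points is removed.\<close>

lemma affine_plane:
  assumes l: "numbering l"
  obtains b e :: "'k^2" and s where "bracket b e \<noteq> 0" "\<And>k. k \<in> {6..9} \<Longrightarrow> l k = vec.span {b + s k *s e}"
    "s 6 + s 7 + s 8 + s 9 = 0"
proof -
  define v where "v i = line_vector (l i)" for i
  have v: "v k \<noteq> 0" "vec.span {v k} = l k" if "k \<in> {1..9}" for k
    using line_vector[OF numbering_in[OF l that]] by (simp_all add: v_def)
  have br: "bracket (v i) (v j) \<noteq> 0" if "i \<in> {1..9}" "j \<in> {1..9}" "i \<noteq> j" for i j
    using that numbering_in[OF l] numbering_eq_iff[OF l] by (simp add: v_def line_bracket del: atLeastAtMost_iff)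
  \<comment> \<open>The coefficients of point 8 in the basis given by points 6 and 7; absorbing them
    into a and b turns point 8 into a + b.\<close>
  define p q where "p = bracket (v 8) (v 7) / bracket (v 6) (v 7)" and "q = bracket (v 6) (v 8) / bracket (v 6) (v 7)"
  define a b where "a = p *s v 6" and "b = q *s v 7"
  have pq: "p \<noteq> 0" "q \<noteq> 0" using br by (simp_all add: p_def q_def)
  have l6: "l 6 = vec.span {a}" and l7: "l 7 = vec.span {b}"
    using pq v by (simp_all add: a_def b_def span_smult)
  have "v 8 = a + b"
    unfolding a_def b_def p_def q_def by (rule vector_expansion) (use br in simp)
  then have l8: "l 8 = vec.span {a + b}" using v(2)[of 8] by simp
  have ab: "bracket a b \<noteq> 0" using pq br by (simp add: a_def b_def)
  define r u where "r = bracket (v 9) b / bracket a b" and "u = bracket a (v 9) / bracket a b"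
  have ru: "r \<noteq> 0" "u \<noteq> 0" using ab pq br by (simp_all add: r_def u_def a_def b_def)
  have v9: "v 9 = r *s a + u *s b"
    unfolding r_def u_def using ab by (rule vector_expansion)
  \<comment> \<open>A square root of u/r. In the coordinate y/x of x a + y b the four points are 0,
    infinity, 1 and \<kappa>^2. The involution z -> \<kappa>^2/z exchanges them in pairs and has
    \<kappa> as its only fixed point, which becomes the direction e.\<close>
  define \<kappa> where "\<kappa> = (u / r)^4"
  have \<kappa>2: "\<kappa>^2 = u / r" using power8[of "u / r"] by (simp add: \<kappa>_def flip: power_mult)
  have "v 9 = r *s (a + \<kappa>^2 *s b)"
    unfolding v9 \<kappa>2 using ru by (simp add: vec_eq_iff algebra_simps)
  then have l9: "l 9 = vec.span {a + \<kappa>^2 *s b}" using v(2)[of 9] ru(1) by (simp add: span_smult)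
  have \<kappa>0: "\<kappa> \<noteq> 0" using ru by (simp add: \<kappa>_def)
  have "\<kappa> \<noteq> 1" using l8 l9 numbering_eq_iff[OF l, of 8 9] by auto
  then have \<kappa>1: "1 + \<kappa> \<noteq> 0" by (simp add: add_eq_0_iff_eq)
  define e where "e = a + \<kappa> *s b"
  have be: "bracket b e \<noteq> 0" using ab bracket_antisym[of b a] by (simp add: e_def bracket_add)
  \<comment> \<open>The parameters t at which b + t e is proportional to the four points.\<close>
  define s where "s k = (if k = 6 then 1 / \<kappa> else if k = 7 then 0 else if k = 8 then 1 / (1 + \<kappa>)
    else 1 / (\<kappa> * (1 + \<kappa>)))" for k :: nat
  have comb: "b + t *s e = t *s a + (1 + t * \<kappa>) *s b" for t
    by (simp add: e_def vec_eq_iff algebra_simps)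
  have e6: "b + s 6 *s e = (1 / \<kappa>) *s a"
    unfolding comb using \<kappa>0 one_add_one by (simp add: s_def)
  have e8: "b + s 8 *s e = (1 / (1 + \<kappa>)) *s (a + b)"
  proof -
    have "1 + \<kappa> / (1 + \<kappa>) = (1 + (\<kappa> + \<kappa>)) / (1 + \<kappa>)" using \<kappa>1 by (simp add: field_simps)
    then have "1 + s 8 * \<kappa> = 1 / (1 + \<kappa>)" by (simp add: s_def add_self)
    then show ?thesis unfolding comb by (simp add: s_def vec_eq_iff algebra_simps)
  qed
  have e9: "b + s 9 *s e = (1 / (\<kappa> * (1 + \<kappa>))) *s (a + \<kappa>^2 *s b)"
  proof -
    have "1 + 1 / (1 + \<kappa>) = (\<kappa> + (1 + 1)) / (1 + \<kappa>)" using \<kappa>1 by (simp add: field_simps)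
    then have "1 + s 9 * \<kappa> = \<kappa> / (1 + \<kappa>)" using \<kappa>0 one_add_one by (simp add: s_def)
    also have "\<dots> = (1 / (\<kappa> * (1 + \<kappa>))) * \<kappa>^2" using \<kappa>0 \<kappa>1 by (simp add: power2_eq_square)
    finally show ?thesis unfolding comb by (simp add: s_def vec_eq_iff algebra_simps)
  qed
  have "l k = vec.span {b + s k *s e}" if "k \<in> {6..9}" for k
  proof -
    have "k = 6 \<or> k = 7 \<or> k = 8 \<or> k = 9" using that by (simp; presburger)
    then show ?thesis
    proof (elim disjE)
      assume "k = 6" then show ?thesis unfolding \<open>k = 6\<close> e6 l6 using \<kappa>0 by (simp add: span_smult)
    next
      assume "k = 7" then show ?thesis using l7 by (simp add: s_def)
    next
      assume "k = 8" then show ?thesis unfolding \<open>k = 8\<close> e8 l8 using \<kappa>1 by (simp add: span_smult)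
    next
      assume "k = 9" then show ?thesis unfolding \<open>k = 9\<close> e9 l9 using \<kappa>0 \<kappa>1 by (simp add: span_smult)
    qed
  qed
  moreover have "s 6 + s 7 + s 8 + s 9 = 0"
  proof -
    have "s 6 + s 7 + s 8 + s 9 = ((1 + 1) + (\<kappa> + \<kappa>)) / (\<kappa> * (1 + \<kappa>))"
      using \<kappa>0 \<kappa>1 by (simp add: s_def divide_simps)
    then show ?thesis by (simp add: add_self one_add_one)
  qed
  ultimately show thesis using that be by blast
qed

end

section \<open>Reflections of the pentagon and the Klein four-group\<close>

lemma rotation_values:
  "rotation 1 = 2" "rotation 2 = 3" "rotation 3 = 4" "rotation 4 = 5" "rotation 5 = 1"
  by (simp_all add: rotation_def Transposition.transpose_def)

lemma reflection_values:
  "reflection 1 = 2" "reflection 2 = 1" "reflection 3 = 5" "reflection 4 = 4" "reflection 5 = 3"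
  by (simp_all add: reflection_def Transposition.transpose_def)

lemma rotation_power5: "rotation ^^ 5 = id"
proof
  fix k
  show "(rotation ^^ 5) k = id k"
  proof (cases "k \<in> {1..5}")
    case True
    then have "k = 1 \<or> k = 2 \<or> k = 3 \<or> k = 4 \<or> k = 5" by (simp; presburger)
    then show ?thesis
      using rotation_values by (elim disjE) (simp_all add: numeral_eq_Suc)
  next
    case False
    then show ?thesis using permutes_not_in[OF rotation_permutes] by simp
  qed
qed

text \<open>Every vertex of the pentagon lies on one of its five axes.\<close>

lemma rotation_reflection:
  assumes "m \<in> {1..5}"
  obtains i p q r s where "i < 5" "rotation ^^ i \<circ> reflection = swap p q \<circ> swap r s"
    "{m, p, q, r, s} = {1..5}" "distinct [m, p, q, r, s]"
proof -
  have eq: "rotation ^^ i \<circ> reflection = swap p q \<circ> swap r s"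
    if "{p, q, r, s} \<subseteq> {1..5}"
      "\<And>k. k \<in> {1, 2, 3, 4, 5} \<Longrightarrow> (rotation ^^ i) (reflection k) = swap p q (swap r s k)" for i p q r s
  proof
    fix k
    show "(rotation ^^ i \<circ> reflection) k = (swap p q \<circ> swap r s) k"
    proof (cases "k \<in> {1..5}")
      case True
      then have "k \<in> {1, 2, 3, 4, 5}" by (simp; presburger)
      then show ?thesis using that(2) by simp
    next
      case False
      then have "k \<noteq> p" "k \<noteq> q" "k \<noteq> r" "k \<noteq> s" using that(1) by auto
      then show ?thesis
        using False permutes_not_in[OF rotation_permutes] permutes_not_in[OF reflection_permutes] by simp
    qed
  qed
  have set: "{1..5} = {1, 2, 3, 4, 5 :: nat}" by (intro equalityI subsetI; simp; presburger)
  note val = rotation_values reflection_values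
  from assms consider "m = 1" | "m = 2" | "m = 3" | "m = 4" | "m = 5" unfolding set by auto
  then show thesis
  proof cases
    case 1
    have "rotation ^^ 4 \<circ> reflection = swap 2 5 \<circ> swap 3 4"
      using val by (intro eq) (auto simp: numeral_eq_Suc Transposition.transpose_def)
    then show ?thesis by (intro that[of 4 2 5 3 4]) (use 1 set in auto)
  next
    case 2
    have "rotation ^^ 1 \<circ> reflection = swap 1 3 \<circ> swap 4 5"
      using val by (intro eq) (auto simp: numeral_eq_Suc Transposition.transpose_def)
    then show ?thesis by (intro that[of 1 1 3 4 5]) (use 2 set in auto)
  next
    case 3
    have "rotation ^^ 3 \<circ> reflection = swap 1 5 \<circ> swap 2 4"
      using val by (intro eq) (auto simp: numeral_eq_Suc Transposition.transpose_def)
    then show ?thesis by (intro that[of 3 1 5 2 4]) (use 3 set in auto)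
  next
    case 4
    have "rotation ^^ 0 \<circ> reflection = swap 1 2 \<circ> swap 3 5" by (simp add: reflection_def)
    then show ?thesis by (intro that[of 0 1 2 3 5]) (use 4 set in auto)
  next
    case 5
    have "rotation ^^ 2 \<circ> reflection = swap 1 4 \<circ> swap 2 3"
      using val by (intro eq) (auto simp: numeral_eq_Suc Transposition.transpose_def)
    then show ?thesis by (intro that[of 2 1 4 2 3]) (use 5 set in auto)
  qed
qed

lemma klein_four_involution: "v \<in> set klein_four \<Longrightarrow> v \<circ> v = id"
  by (auto simp: klein_four_def fun_eq_iff Transposition.transpose_def)

text \<open>Replacing u by u v permutes the group.\<close>

lemma klein_four_sum:
  fixes W :: "(nat \<Rightarrow> nat) \<Rightarrow> 'f::field"
  assumes "v \<in> set klein_four"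
  shows "(\<Sum>u\<leftarrow>klein_four. W (u \<circ> (v \<circ> y))) = (\<Sum>u\<leftarrow>klein_four. W (u \<circ> y))"
proof -
  define a b c where "a = swap 6 7 \<circ> swap 8 9" and "b = swap 6 8 \<circ> swap 7 9" and "c = swap 6 9 \<circ> swap 7 8"
  have K: "klein_four = [id, a, b, c]" by (simp add: klein_four_def a_def b_def c_def)
  have "a \<circ> a = id" "b \<circ> b = id" "c \<circ> c = id"
    using klein_four_involution unfolding K by simp_all
  moreover have "a \<circ> b = c" "b \<circ> a = c" "a \<circ> c = b" "c \<circ> a = b" "b \<circ> c = a" "c \<circ> b = a"
    by (auto simp: a_def b_def c_def fun_eq_iff Transposition.transpose_def)
  ultimately show ?thesis
    using assms unfolding K by (auto simp: o_assoc ac_simps)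
qed

section \<open>The involution adapted to a numbering\<close>

context field8
begin

text \<open>Let m be the number of the point at infinity in the chart of
  \<open>affine_plane\<close>. All eight parameters add up to 0, and so do those of 6 to 9, hence
  also the other four. If the reflection through m pairs p with q and r with s, this gives t p + t q
  = t r + t s, and translation by the common value c realizes both pairs.\<close>

lemma involution_exists:
  assumes l: "numbering l"
  obtains i v g where "i < 5" "v \<in> set klein_four" "g \<in> PGL2"
    "\<And>k. k \<in> {1..9} \<Longrightarrow> g (l k) = l ((v \<circ> (rotation ^^ i \<circ> reflection)) k)"
proof -
  note conclude = that
  obtain b e :: "'k^2" and s0 where be: "bracket b e \<noteq> 0"
    and s0: "\<And>k. k \<in> {6..9} \<Longrightarrow> l k = vec.span {b + s0 k *s e}" and sum0: "s0 6 + s0 7 + s0 8 + s0 9 = 0"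
    using affine_plane[OF l] by metis
  have "e \<noteq> 0" using be bracket_nonzero by blast
  then have "vec.span {e} \<in> l ` {1..9}"
    using l span_in_projective_line[of e] by (simp add: numbering_def bij_betw_def)
  then obtain m where m: "m \<in> {1..9}" "l m = vec.span {e}" by auto
  have "m \<notin> {6..9}" using s0[of m] m(2) affine_chart_inj(2)[OF be] by auto
  then have "m \<in> {1..5}" using m(1) by auto
  then obtain i p q r s where i: "i < 5" "rotation ^^ i \<circ> reflection = swap p q \<circ> swap r s"
    and mpqrs: "{m, p, q, r, s} = {1..5}" and dist: "distinct [m, p, q, r, s]"
    by (rule rotation_reflection)
  have "\<exists>t. l k = vec.span {b + t *s e}" if "k \<in> {1..9} - {m}" for k
  proof (rule affine_chart[OF be])
    show "l k \<in> projective_line" using that numbering_in[OF l] by blast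
    show "l k \<noteq> vec.span {e}" unfolding m(2)[symmetric] using that m(1) numbering_eq_iff[OF l, of k m] by simp
  qed
  then obtain t where t: "\<And>k. k \<in> {1..9} - {m} \<Longrightarrow> l k = vec.span {b + t k *s e}" by metis
  have t_iff: "t k = t k' \<longleftrightarrow> k = k'" if "k \<in> {1..9} - {m}" "k' \<in> {1..9} - {m}" for k k'
    using t[OF that(1)] t[OF that(2)] affine_chart_inj(1)[OF be, of "t k" "t k'"] numbering_eq_iff[OF l, of k k'] that
    by auto
  have inj: "inj_on t ({1..9} - {m})" by (rule inj_onI) (use t_iff in blast)
  have "card ({1..9} - {m}) = 8" using m(1) by simp
  then have onto: "t ` ({1..9} - {m}) = UNIV"
    using inj card8 finite_field by (intro card_subset_eq) (auto simp: card_image)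
  have mem: "x \<in> {1..5}" if "x \<in> {m, p, q, r, s}" for x using that unfolding mpqrs .
  have small: "p \<le> 5" "q \<le> 5" "r \<le> 5" "s \<le> 5" "m \<le> 5"
    using mem[of p] mem[of q] mem[of r] mem[of s] mem[of m] by simp_all
  have ne: "p \<noteq> q" "p \<noteq> r" "p \<noteq> s" "q \<noteq> r" "q \<noteq> s" "r \<noteq> s" "m \<noteq> p" "m \<noteq> q" "m \<noteq> r" "m \<noteq> s"
    using dist by simp_all
  have far: "x \<noteq> 6" "x \<noteq> 7" "x \<noteq> 8" "x \<noteq> 9" if "x \<le> 5" for x :: nat using that by simp_all
  note far = far[OF small(1)] far[OF small(2)] far[OF small(3)] far[OF small(4)] far[OF small(5)]
  have "{1..9} = {1..5} \<union> {6, 7, 8, 9 :: nat}" by (intro equalityI subsetI; simp; presburger)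
  then have nine2: "{1..9} = insert m {p, q, r, s, 6, 7, 8, 9}"
    unfolding mpqrs[symmetric] by (simp only: Un_insert_left Un_empty_left)
  have "m \<notin> {p, q, r, s, 6, 7, 8, 9}" using ne far by simp
  then have nine: "{1..9} - {m} = {p, q, r, s, 6, 7, 8, 9}"
    unfolding nine2 by (rule Diff_insert_absorb)
  have in9: "p \<in> {1..9} - {m}" "q \<in> {1..9} - {m}" "r \<in> {1..9} - {m}" "s \<in> {1..9} - {m}"
    "6 \<in> {1..9} - {m}" "7 \<in> {1..9} - {m}" "8 \<in> {1..9} - {m}" "9 \<in> {1..9} - {m}"
    unfolding nine by simp_all
  have cancel: "u + (u + v) = v" for u v :: 'k by (simp add: add_self flip: add.assoc)
  have ts0: "t k = s0 k" if "k \<in> {6..9}" "k \<in> {1..9} - {m}" for k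
    using s0[OF that(1)] t[OF that(2)] affine_chart_inj(1)[OF be, of "t k" "s0 k"] by simp
  have sumP: "t 6 + t 7 + t 8 + t 9 = 0"
    using sum0 ts0[OF _ in9(5)] ts0[OF _ in9(6)] ts0[OF _ in9(7)] ts0[OF _ in9(8)] by simp
  have "(\<Sum>k\<in>{1..9} - {m}. t k) = (\<Sum>x\<in>t ` ({1..9} - {m}). x)"
    using sum.reindex[OF inj, of "\<lambda>x. x"] by (simp add: comp_def)
  also have "\<dots> = 0" unfolding onto by (rule field_sum)
  finally have "(t p + t q) + (t r + t s) + (t 6 + t 7 + t 8 + t 9) = 0"
    unfolding nine using far ne by (simp add: add.assoc)
  then have pqrs: "t p + t q = t r + t s" unfolding sumP by (simp add: add_eq_0_iff_eq)
  define c where "c = t p + t q"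
  obtain g where g: "g \<in> PGL2" "g (vec.span {e}) = vec.span {e}"
    "\<And>x. g (vec.span {b + x *s e}) = vec.span {b + (x + c) *s e}"
    using transvection[OF be, of c] by blast
  have move: "g (l k) = l k'" if "k \<in> {1..9} - {m}" "k' \<in> {1..9} - {m}" "t k + c = t k'" for k k'
    unfolding t[OF that(1)] t[OF that(2)] g(3) that(3) ..
  have swap_pair: "t x + c = t y" "t y + c = t x" if "c = t x + t y" for x y
    unfolding that using cancel[of "t x" "t y"] cancel[of "t y" "t x"] by (simp_all add: add.commute)
  have pq: "t p + c = t q" "t q + c = t p" using swap_pair[of p q] by (simp_all add: c_def)
  have rs: "t r + c = t s" "t s + c = t r" using swap_pair[of r s] pqrs by (simp_all add: c_def)
  have "t p \<noteq> t q" using t_iff[OF in9(1,2)] ne by simp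
  then have c0: "c \<noteq> 0" by (simp add: c_def add_eq_0_iff_eq)
  have common: "g (l m) = l m" "g (l p) = l q" "g (l q) = l p" "g (l r) = l s" "g (l s) = l r"
    using m(2) g(2) move[OF in9(1,2)] move[OF in9(2,1)] move[OF in9(3,4)] move[OF in9(4,3)] pq rs by simp_all
  \<comment> \<open>The translation moves 6 to some k, which cannot be p, q, r or s because these
    are already exchanged among themselves.\<close>
  have "t 6 + c \<in> t ` ({1..9} - {m})" unfolding onto by simp
  then obtain k where k: "k \<in> {p, q, r, s, 6, 7, 8, 9}" "t k = t 6 + c" unfolding nine by (metis imageE)
  have bwd: "t k + c = t 6" unfolding k(2) using cancel[of c "t 6"] by (simp add: ac_simps)
  have "k \<noteq> 6" using k(2) c0 by auto
  moreover have "k \<noteq> p" using bwd pq t_iff[OF in9(2,5)] far by auto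
  moreover have "k \<noteq> q" using bwd pq t_iff[OF in9(1,5)] far by auto
  moreover have "k \<noteq> r" using bwd rs t_iff[OF in9(4,5)] far by auto
  moreover have "k \<noteq> s" using bwd rs t_iff[OF in9(3,5)] far by auto
  ultimately have k789: "k = 7 \<or> k = 8 \<or> k = 9" using k(1) by simp
  have sumP': "t 6 + t k = c" unfolding k(2) by (rule cancel)
  \<comment> \<open>One argument for the three possible partners x of 6: the zero sum over 6 to 9
    makes the remaining two, y and z, partners of each other.\<close>
  have finish: thesis
    if v: "v = swap 6 x \<circ> swap y z" "v \<in> set klein_four" and xyz: "{x, y, z} = {7, 8, 9}" "distinct [x, y, z]"
      and cx: "t 6 + t x = c" and sum: "(t 6 + t x) + (t y + t z) = 0" for v x y z
  proof (rule conclude[OF i(1) v(2) g(1)])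
    fix k :: nat assume k: "k \<in> {1..9}"
    have yz: "t y + t z = c" using sum unfolding cx by (simp add: add_eq_0_iff_eq)
    have x9: "x \<in> {7, 8, 9}" "y \<in> {7, 8, 9}" "z \<in> {7, 8, 9}" unfolding xyz(1)[symmetric] by simp_all
    then have in9': "x \<in> {1..9} - {m}" "y \<in> {1..9} - {m}" "z \<in> {1..9} - {m}" unfolding nine by blast+
    have P: "g (l 6) = l x" "g (l x) = l 6" "g (l y) = l z" "g (l z) = l y"
      using move[OF in9(5) in9'(1)] move[OF in9'(1) in9(5)] move[OF in9'(2,3)] move[OF in9'(3,2)]
        swap_pair[OF cx[symmetric]] swap_pair[OF yz[symmetric]] by simp_all
    have far': "u \<noteq> x" "u \<noteq> y" "u \<noteq> z" if "u \<le> 6" for u using x9 that by auto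
    have "{p, q, r, s, 6, 7, 8, 9} = {p, q, r, s, 6} \<union> {x, y, z}" unfolding xyz(1) by blast
    then have "k \<in> {m, p, q, r, s, 6, x, y, z}" using k unfolding nine2 by blast
    then have "k \<in> {m, p, q, r, s} \<or> k \<in> {6, x, y, z}" by blast
    then show "g (l k) = l ((v \<circ> (rotation ^^ i \<circ> reflection)) k)"
    proof
      assume k: "k \<in> {m, p, q, r, s}"
      have v_fix: "v j = j" if "j \<le> 5" for j
        using that far'[of j] by (simp add: v(1) Transposition.transpose_def)
      show ?thesis
        unfolding i(2) using k common ne small by (elim insertE) (simp_all add: v_fix Transposition.transpose_def)
    next
      assume k: "k \<in> {6, x, y, z}"
      have w_fix: "swap p q (swap r s j) = j" if "6 \<le> j" for j
        using that small by (simp add: Transposition.transpose_def)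
      have "6 \<le> k" using k x9 by auto
      moreover have "g (l k) = l (v k)"
        using k P far'[of 6] xyz(2) by (elim insertE) (simp_all add: v(1) Transposition.transpose_def)
      ultimately show ?thesis unfolding i(2) by (simp add: w_fix)
    qed
  qed
  have perm3: "{8, 7, 9} = {7, 8, 9 :: nat}" "{9, 7, 8} = {7, 8, 9 :: nat}" by auto
  have sums: "(t 6 + t 7) + (t 8 + t 9) = 0" "(t 6 + t 8) + (t 7 + t 9) = 0" "(t 6 + t 9) + (t 7 + t 8) = 0"
    using sumP by (simp_all add: ac_simps)
  from k789 show thesis
  proof (elim disjE)
    assume "k = 7"
    then show thesis
      by (intro finish[of "swap 6 7 \<circ> swap 8 9" 7 8 9])
         (use sumP' sums(1) perm3 in \<open>simp_all add: klein_four_def\<close>)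
  next
    assume "k = 8"
    then show thesis
      by (intro finish[of "swap 6 8 \<circ> swap 7 9" 8 7 9])
         (use sumP' sums(2) perm3 in \<open>simp_all add: klein_four_def\<close>)
  next
    assume "k = 9"
    then show thesis
      by (intro finish[of "swap 6 9 \<circ> swap 7 8" 9 7 8])
         (use sumP' sums(3) perm3 in \<open>simp_all add: klein_four_def\<close>)
  qed
qed

lemma PGammaL2_closed:
  assumes "g \<in> PGammaL2" "L \<in> (projective_line :: ('k^2) set set)"
  shows "g L \<in> projective_line"
proof -
  obtain h i where h: "h \<in> PGL2" "g = compose projective_line h (frobenius_line ^^ i)"
    using assms(1) by (auto simp: PGammaL2_def)
  have frob: "(frobenius_line ^^ i) L \<in> projective_line" for i
    using assms(2) by (induction i) (simp_all add: frobenius_projective)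
  obtain M :: "'k^2^2" where M: "invertible M" "h = (\<lambda>L\<in>projective_line. (\<lambda>v. M *v v) ` L)"
    using h(1) by (auto simp: PGL2_def)
  obtain v where v: "v \<noteq> 0" "(frobenius_line ^^ i) L = vec.span {v}"
    using frob[of i] by (auto simp: projective_line_def)
  show ?thesis
    unfolding h(2) M(2) using assms(2) frob[of i] v M(1)
    by (simp add: compose_def matrix_image_span span_in_projective_line matrix_nonzero)
qed

lemma PGL2_subset_PGammaL2: "PGL2 \<subseteq> (PGammaL2 :: (('k^2) set \<Rightarrow> ('k^2) set) set)"
proof
  fix g :: "('k^2) set \<Rightarrow> ('k^2) set" assume g: "g \<in> PGL2"
  then have "g \<in> extensional projective_line" by (auto simp: PGL2_def)
  then have "g = compose projective_line g (frobenius_line ^^ 0)"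
    by (auto simp: compose_def extensional_def fun_eq_iff)
  then show "g \<in> PGammaL2" unfolding PGammaL2_def using g by (intro CollectI exI[of _ g] exI[of _ 0]) simp
qed

end

section \<open>The Specht factors of the induced module\<close>

locale numbered_line = field8 field_type for field_type :: "'k::field itself" +
  fixes b :: "('k^2) set \<Rightarrow> nat"
  assumes b_bij: "bij_betw b projective_line {1..9}"
begin

text \<open>Left multiplication of x permutes the numbers of the points
  (\<open>labelling_compose\<close>), and right multiplication by \<open>PGammaL2_perms b\<close>
  moves the points by semilinear maps (\<open>labelling_right_mult\<close>). So an invariant of the
  labelled points is a function of x that is constant on the classes.\<close>

definition labelling :: "(nat \<Rightarrow> nat) \<Rightarrow> nat \<Rightarrow> ('k^2) set" where
  "labelling x = inv_into projective_line b \<circ> inv' x"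

lemma labelling_numbering: "x permutes {1..9} \<Longrightarrow> numbering (labelling x)"
  unfolding labelling_def numbering_def
  by (rule bij_betw_trans[OF permutes_imp_bij[OF permutes_inv] bij_betw_inv_into[OF b_bij]])

lemma labelling_compose:
  assumes "x permutes {1..9}" "p permutes {1..9}"
  shows "labelling (p \<circ> x) = labelling x \<circ> inv' p"
  using assms by (simp add: labelling_def o_inv_distrib permutes_bij comp_assoc)

lemma b_labelling:
  assumes "x permutes {1..9}" "k \<in> {1..9}"
  shows "b (labelling x k) = inv' x k"
proof -
  have "inv' x k \<in> {1..9}" using permutes_in_image[OF permutes_inv[OF assms(1)]] assms(2) by simp
  then show ?thesis
    using b_bij by (simp add: labelling_def bij_betw_inv_into_right del: atLeastAtMost_iff)
qed

lemma labelling_right_mult: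
  assumes x: "x permutes {1..9}" and h: "h \<in> PGammaL2_perms b"
  obtains g where "g \<in> PGammaL2" "\<And>k. k \<in> {1..9} \<Longrightarrow> labelling x k = g (labelling (x \<circ> h) k)"
proof -
  obtain g where g: "g \<in> PGammaL2" "\<And>L. L \<in> projective_line \<Longrightarrow> h (b L) = b (g L)"
    and hp: "h permutes {1..9}"
    using h by (auto simp: PGammaL2_perms_def sym_group_carrier)
  have xh: "x \<circ> h permutes {1..9}" using hp x by (rule permutes_compose)
  have "labelling x k = g (labelling (x \<circ> h) k)" if k: "k \<in> {1..9}" for k
  proof -
    let ?L = "labelling (x \<circ> h) k"
    have L: "?L \<in> projective_line" using labelling_numbering[OF xh] k by (rule numbering_in)
    have "b (g ?L) = h (inv' (x \<circ> h) k)"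
      using g(2)[OF L] b_labelling[OF xh k] by simp
    also have "\<dots> = inv' x k"
      using x hp by (simp add: o_inv_distrib permutes_bij permutes_inverses)
    finally have "inv_into projective_line b (inv' x k) = inv_into projective_line b (b (g ?L))" by simp
    also have "\<dots> = g ?L"
      using b_bij PGammaL2_closed[OF g(1) L] by (simp add: bij_betw_inv_into_left)
    finally show ?thesis by (simp add: labelling_def)
  qed
  then show thesis using that g(1) by blast
qed

lemma coboundary_right_mult:
  assumes x: "x permutes {1..9}" and h: "h \<in> PGammaL2_perms b"
  shows "coboundary (labelling (x \<circ> h)) = coboundary (labelling x)"
proof -
  obtain g where g: "g \<in> PGammaL2" "\<And>k. k \<in> {1..9} \<Longrightarrow> labelling x k = g (labelling (x \<circ> h) k)"
    using labelling_right_mult[OF assms] by blast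
  have "h permutes {1..9}" using h by (simp add: PGammaL2_perms_def sym_group_carrier)
  then have "x \<circ> h permutes {1..9}" using x by (rule permutes_compose)
  then have L: "labelling (x \<circ> h) k \<in> projective_line" if "k \<in> {1..9}" for k
    using numbering_in[OF labelling_numbering that] by blast
  show ?thesis
    unfolding coboundary_def using cross_sign_PGammaL2[OF g(1)] by (simp add: g(2) L)
qed

text \<open>This is \<open>involution_exists\<close> for \<open>labelling x\<close>; conjugation by
  x turns its permutation of the numbers into one of the labels given by b.\<close>

lemma conjugate_in_group:
  assumes x: "x permutes {1..9}"
  obtains i v where "i < 5" "v \<in> set klein_four"
    "inv' x \<circ> (v \<circ> (rotation ^^ i \<circ> reflection)) \<circ> x \<in> PGammaL2_perms b"
proof -
  obtain i v g where i: "i < 5" and v: "v \<in> set klein_four" and g: "g \<in> PGL2"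
    "\<And>k. k \<in> {1..9} \<Longrightarrow> g (labelling x k) = labelling x ((v \<circ> (rotation ^^ i \<circ> reflection)) k)"
    by (rule involution_exists[OF labelling_numbering[OF x]]) blast
  let ?q = "v \<circ> (rotation ^^ i \<circ> reflection)"
  have q: "?q permutes {1..9}"
    by (intro permutes_compose permutes_subset[OF reflection_permutes] permutes_subset[OF rotation_permutes]
        permutes_subset[OF klein_four_permutes[OF v]]) auto
  have h: "inv' x \<circ> ?q \<circ> x permutes {1..9}"
    by (rule permutes_compose[OF x permutes_compose[OF q permutes_inv[OF x]]])
  have "(inv' x \<circ> ?q \<circ> x) (b L) = b (g L)" if L: "L \<in> projective_line" for L
  proof -
    have bL: "b L \<in> {1..9}" using b_bij L by (rule bij_betwE[THEN bspec])
    have k: "x (b L) \<in> {1..9}" using permutes_in_image[OF x] bL by blast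
    have lab: "labelling x (x (b L)) = L"
      using x b_bij L by (simp add: labelling_def permutes_inverses bij_betw_inv_into_left)
    have qk: "?q (x (b L)) \<in> {1..9}" using permutes_in_image[OF q] k by blast
    have "b (g L) = b (labelling x (?q (x (b L))))" using g(2)[OF k] unfolding lab by simp
    also have "\<dots> = inv' x (?q (x (b L)))" by (rule b_labelling[OF x qk])
    finally show ?thesis by simp
  qed
  moreover have "g \<in> PGammaL2" using g(1) PGL2_subset_PGammaL2 by blast
  ultimately have "inv' x \<circ> ?q \<circ> x \<in> PGammaL2_perms b"
    using h unfolding PGammaL2_perms_def by (auto simp: sym_group_carrier)
  then show thesis using that i v by blast
qed

text \<open>By the conjugation property above, the sum over the Klein four-group takes the same
  values at a rotation and at a reflection, and these enter with weights 1 and 2.\<close>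

lemma annihilator_sum_zero:
  fixes W :: "(nat \<Rightarrow> nat) \<Rightarrow> 'f::field"
  assumes char: "CHAR('f) = 3" and x: "x permutes {1..9}"
    and W: "\<And>x h. x permutes {1..9} \<Longrightarrow> h \<in> PGammaL2_perms b \<Longrightarrow> W (x \<circ> h) = W x"
  shows "(\<Sum>a\<leftarrow>annihilator. W (a \<circ> x)) = 0"
proof -
  define S where "S y = (\<Sum>v\<leftarrow>klein_four. W (v \<circ> y))" for y
  obtain i v where i: "i < 5" and v: "v \<in> set klein_four"
    and h: "inv' x \<circ> (v \<circ> (rotation ^^ i \<circ> reflection)) \<circ> x \<in> PGammaL2_perms b"
    by (rule conjugate_in_group[OF x])
  let ?h = "inv' x \<circ> (v \<circ> (rotation ^^ i \<circ> reflection)) \<circ> x"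
  let ?r = "rotation ^^ i \<circ> reflection"
  have kp: "u permutes {1..9}" if "u \<in> set klein_four" for u
    using klein_four_permutes[OF that] by (rule permutes_subset) auto
  have rp: "rotation ^^ j permutes {1..9}" for j
    using rotation_permutes by (rule permutes_subset) auto
  have xh: "x \<circ> ?h = v \<circ> (?r \<circ> x)"
    using permutes_inv_o(1)[OF x] by (simp add: o_assoc)
  have commute: "rotation ^^ j \<circ> v = v \<circ> rotation ^^ j" for j
  proof
    fix k
    have "v k \<in> {6..9}" if "k \<in> {6..9}" using permutes_in_image[OF klein_four_permutes[OF v]] that by blast
    moreover have "(rotation ^^ j) k \<in> {1..5}" if "k \<in> {1..5}"
      using permutes_in_image[OF rotation_permutes] that by blast
    moreover have "(rotation ^^ j) k = k" if "k \<notin> {1..5}" for k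
      using permutes_not_in[OF rotation_permutes that] .
    moreover have "v k = k" if "k \<notin> {6..9}" for k
      using permutes_not_in[OF klein_four_permutes[OF v] that] .
    ultimately show "(rotation ^^ j \<circ> v) k = (v \<circ> rotation ^^ j) k"
      by (cases "k \<in> {1..5}"; cases "k \<in> {6..9}") auto
  qed
  \<comment> \<open>The composition of x with \<open>?h\<close> is v, then a reflection, then x read
    from the left. The factor v passes through the rotation and is absorbed by the sum over the
    Klein four-group.\<close>
  have S_eq: "S (rotation ^^ (j + i) \<circ> reflection \<circ> x) = S (rotation ^^ j \<circ> x)" for j
  proof -
    have "S (rotation ^^ (j + i) \<circ> reflection \<circ> x) = S (v \<circ> (rotation ^^ (j + i) \<circ> reflection \<circ> x))"
      unfolding S_def by (rule klein_four_sum[OF v, symmetric])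
    also have "v \<circ> (rotation ^^ (j + i) \<circ> reflection \<circ> x) = rotation ^^ j \<circ> x \<circ> ?h"
    proof -
      have "v \<circ> (rotation ^^ (j + i) \<circ> reflection \<circ> x) = (v \<circ> rotation ^^ j) \<circ> (?r \<circ> x)"
        by (simp add: funpow_add o_assoc)
      also have "\<dots> = rotation ^^ j \<circ> (v \<circ> (?r \<circ> x))" 
        unfolding commute[of j, symmetric] by (simp only: o_assoc)
      finally show ?thesis unfolding xh[symmetric] by (simp add: o_assoc)
    qed
    also have "S (rotation ^^ j \<circ> x \<circ> ?h) = S (rotation ^^ j \<circ> x)"
    proof -
      have "W (u \<circ> (rotation ^^ j \<circ> x \<circ> ?h)) = W (u \<circ> (rotation ^^ j \<circ> x))" if "u \<in> set klein_four" for u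
        using W[OF permutes_compose[OF permutes_compose[OF x rp] kp[OF that]] h, of j] by (simp add: o_assoc)
      then show ?thesis unfolding S_def by (intro arg_cong[of _ _ sum_list] map_cong refl)
    qed
    finally show ?thesis .
  qed
  have periodic: "rotation ^^ (j mod 5) = rotation ^^ j" for j
    using rotation_power5 by (intro ext funpow_mod_eq) simp
  \<comment> \<open>Shifting the exponent by i is a bijection modulo 5; its inverse shifts by 5 - i
    to stay within the natural numbers.\<close>
  have "(\<Sum>j<5. S (rotation ^^ j \<circ> reflection \<circ> x)) = (\<Sum>j<5. S (rotation ^^ (j + i) \<circ> reflection \<circ> x))"
  proof (rule sum.reindex_bij_witness[of _ "\<lambda>j. (j + i) mod 5" "\<lambda>j. (j + (5 - i)) mod 5"])
    fix j :: nat assume j: "j \<in> {..<5}"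
    have "((j + i) mod 5 + (5 - i)) mod 5 = (j + i + (5 - i)) mod 5" by (rule mod_add_left_eq)
    then show "((j + i) mod 5 + (5 - i)) mod 5 = j" using i j by simp
    have "((j + (5 - i)) mod 5 + i) mod 5 = (j + (5 - i) + i) mod 5" by (rule mod_add_left_eq)
    then show *: "((j + (5 - i)) mod 5 + i) mod 5 = j" using i j by simp
    have "rotation ^^ ((j + (5 - i)) mod 5 + i) = rotation ^^ (((j + (5 - i)) mod 5 + i) mod 5)"
      by (rule periodic[symmetric])
    then have "rotation ^^ ((j + (5 - i)) mod 5 + i) = rotation ^^ j" unfolding * .
    then show "S (rotation ^^ ((j + (5 - i)) mod 5 + i) \<circ> reflection \<circ> x) = S (rotation ^^ j \<circ> reflection \<circ> x)"
      by simp
  qed auto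
  also have "\<dots> = (\<Sum>j<5. S (rotation ^^ j \<circ> x))" by (simp only: S_eq)
  finally have eq: "(\<Sum>j<5. S (rotation ^^ j \<circ> reflection \<circ> x)) = (\<Sum>j<5. S (rotation ^^ j \<circ> x))" .
  have exchange: "(\<Sum>v\<leftarrow>klein_four. \<Sum>j<5. f v j) = (\<Sum>j<5. \<Sum>v\<leftarrow>klein_four. f v j)" for f :: "_ \<Rightarrow> nat \<Rightarrow> 'f"
    by (simp add: klein_four_def sum.distrib)
  have "(\<Sum>a\<leftarrow>annihilator. W (a \<circ> x)) = (\<Sum>j<5. S (rotation ^^ j \<circ> x)) + 2 * (\<Sum>j<5. S (rotation ^^ j \<circ> reflection \<circ> x))"
    unfolding sum_list_annihilator exchange S_def by (simp only: o_assoc)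
  also have "\<dots> = 3 * (\<Sum>j<5. S (rotation ^^ j \<circ> x))" unfolding eq by simp
  also have "\<dots> = 0" using char_3_simps(1)[OF char] by (simp only: mult_zero_left)
  finally show ?thesis .
qed

lemma specht_filtration_impossible:
  assumes char: "CHAR('f::field) = 3"
  shows "\<not> has_specht_filtration 9 (induced_module (sym_group 9) (PGammaL2_perms b)
    (trivial_module :: ('f, 'f, nat \<Rightarrow> nat) group_module))"
proof
  let ?G = "sym_group 9" and ?H = "PGammaL2_perms b"
  assume filt: "has_specht_filtration 9 (induced_module ?G ?H (trivial_module :: ('f, 'f, nat \<Rightarrow> nat) group_module))"
  interpret induction_data ?G ?H
  proof (intro induction_data.intro induction_data_axioms.intro)
    show "finite (carrier ?G)" by (simp add: sym_group_def finite_permutations)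
  qed (auto simp: sym_group_is_group PGammaL2_perms_def)
  \<comment> \<open>The division takes place in the integers, before reduction modulo 3; the
    quotient is 1 or -1, so the reduction is nonzero everywhere on the group.\<close>
  define \<beta> :: "(nat \<Rightarrow> nat) \<Rightarrow> 'f" where "\<beta> x = of_int (coboundary (labelling x) div 3)" for x
  have \<beta>_right: "\<beta> (x \<otimes>\<^bsub>?G\<^esub> h) = \<beta> x" if "x \<in> carrier ?G" "h \<in> ?H" for x h
    using that coboundary_right_mult[of x h] by (simp add: \<beta>_def sym_group_carrier sym_group_mult)
  \<comment> \<open>Class sums are coordinates on the induced module, so \<beta> describes a vector
    there and f is a lift of it to the group algebra.\<close>
  obtain f where f: "f \<in> carrier (T :: ('f, _, _) group_module)"
    and f_sum: "\<And>x. x \<in> carrier ?G \<Longrightarrow> class_sum ?G ?H f x = \<beta> x"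
    using class_sum_surjective[of \<beta>, OF \<beta>_right] by blast
  have three: "3 * (coboundary l div 3) = coboundary l" if "numbering l" for l
    using coboundary_values[OF that] by auto
  have "f \<notin> relation_kernel ?G ?H"
  proof
    assume "f \<in> relation_kernel ?G ?H"
    moreover have id: "id \<in> carrier ?G" by (simp add: sym_group_carrier permutes_id)
    ultimately have "\<beta> id = 0" using f_sum[OF id] by (simp add: relation_kernel_def)
    moreover have "coboundary (labelling id) div 3 \<in> {1, - 1}"
      using coboundary_values[OF labelling_numbering[OF permutes_id]] by auto
    ultimately show False by (auto simp: \<beta>_def)
  qed
  have filt': "has_specht_filtration 9 (quotient_module (T :: ('f, _, _) group_module) (relation_kernel ?G ?H))"
    using filt unfolding induced_module_def linear_span_relations .
  obtain \<mu> V and \<pi> :: "_ \<Rightarrow> (nat \<times> nat \<Rightarrow> nat) set \<Rightarrow> 'f"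
    where \<mu>: "is_partition 9 \<mu>" and V: "stable_subgroup ?G T V" and NV: "relation_kernel ?G ?H \<subseteq> V" and fV: "f \<in> V"
      and onto: "\<pi> ` V = carrier (specht_module \<mu>)"
      and add: "\<And>u h. u \<in> V \<Longrightarrow> h \<in> V \<Longrightarrow> \<pi> (u \<oplus>\<^bsub>T\<^esub> h) = \<pi> u \<oplus>\<^bsub>specht_module \<mu>\<^esub> \<pi> h"
      and act: "\<And>g u. g \<in> carrier ?G \<Longrightarrow> u \<in> V \<Longrightarrow> \<pi> (act T g u) = act (specht_module \<mu>) g (\<pi> u)"
      and ker: "\<And>u. u \<in> relation_kernel ?G ?H \<Longrightarrow> \<pi> u = \<pi> \<zero>\<^bsub>T\<^esub>" and nonzero: "\<pi> f \<noteq> \<pi> \<zero>\<^bsub>T\<^esub>"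
    apply (rule filtration_factor[OF T_additive_action relation_kernel_stable filt' f \<open>f \<notin> relation_kernel _ _\<close>])
    subgoal premises p by (rule p(1)[OF p(2-10)])
    done
  interpret shape 9 \<mu> by unfold_locales (rule \<mu>)
  interpret TG: abelian_group "T :: ('f, _, _) group_module" by (rule T_abelian_group)
  have VT: "V \<subseteq> carrier T"
    using V subgroup.subset by (fastforce simp: stable_subgroup_def)
  have zeroV: "\<zero>\<^bsub>T\<^esub> \<in> V"
    using V subgroup.one_closed by (fastforce simp: stable_subgroup_def)
  \<comment> \<open>Cancellation takes place in the field, value by value.\<close>
  have \<pi>0: "\<pi> \<zero>\<^bsub>T\<^esub> = (\<lambda>x. 0)"
  proof
    fix x
    have "\<pi> \<zero>\<^bsub>T\<^esub> x = \<pi> \<zero>\<^bsub>T\<^esub> x + \<pi> \<zero>\<^bsub>T\<^esub> x"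
      using fun_cong[OF add[OF zeroV zeroV], of x] TG.l_zero[OF TG.zero_closed] by (simp only: specht_module_simps)
    then show "\<pi> \<zero>\<^bsub>T\<^esub> x = 0" by (rule iffD1[OF add_cancel_right_right])
  qed
  \<comment> \<open>A relation among the class sums of u passes to the coefficients of its image.
    Both actions evaluate at translates by the inverse, hence the inverted list
    \<open>?gs\<close>.\<close>
  have transfer: "(\<Sum>h\<leftarrow>hs. \<pi> u (tabloid \<mu> (tact h t))) = 0"
    if u: "u \<in> V" and hs: "\<And>h. h \<in> set hs \<Longrightarrow> h permutes {1..9}" and t: "t \<in> tableaux \<mu>"
      and sum: "\<And>x. x permutes {1..9} \<Longrightarrow> (\<Sum>h\<leftarrow>hs. class_sum ?G ?H u (h \<circ> x)) = 0" for u hs t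
  proof -
    let ?gs = "map inv' hs"
    have gs: "set ?gs \<subseteq> carrier ?G" using hs by (auto simp: sym_group_carrier permutes_inv)
    have inv_inv: "inv' (inv' h) = h" if "h \<in> set hs" for h
      using hs[OF that] by (rule permutes_inv_inv)
    have inv_G: "inv\<^bsub>?G\<^esub> (inv' h) = h" if "h \<in> set hs" for h
      using sym_group_inv_equality[of "inv' h" 9] permutes_inv[OF hs[OF that]] inv_inv[OF that]
      by (simp add: sym_group_carrier)
    have "(\<Sum>g\<leftarrow>?gs. class_sum ?G ?H u (inv\<^bsub>?G\<^esub> g \<otimes>\<^bsub>?G\<^esub> x)) = 0" if "x \<in> carrier ?G" for x
    proof -
      have "(\<Sum>g\<leftarrow>?gs. class_sum ?G ?H u (inv\<^bsub>?G\<^esub> g \<otimes>\<^bsub>?G\<^esub> x)) = (\<Sum>h\<leftarrow>hs. class_sum ?G ?H u (h \<circ> x))"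
        unfolding map_map comp_def
        by (intro arg_cong[of _ _ sum_list] map_cong refl)
           (simp add: inv_G sym_group_mult comp_def)
      then show ?thesis using sum that by (simp add: sym_group_carrier)
    qed
    then have "group_sum T ?gs u \<in> relation_kernel ?G ?H"
      using group_sum_in_kernel_iff[OF gs] u VT by blast
    then have "\<pi> (group_sum T ?gs u) = (\<lambda>x. 0)" using ker \<pi>0 by simp
    moreover have "\<pi> (group_sum T ?gs u) = group_sum (specht_module \<mu>) ?gs (\<pi> u)"
      by (rule group_sum_hom[OF V gs u, where \<pi> = \<pi> and S = "specht_module \<mu>"])
         (simp_all add: add act \<pi>0, simp add: specht_module_simps)
    ultimately have "group_sum (specht_module \<mu>) ?gs (\<pi> u) (tabloid \<mu> t) = 0" by simp
    then have "(\<Sum>g\<leftarrow>?gs. \<pi> u (tabloid \<mu> (tact (inv' g) t))) = 0"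
      using specht_group_sum[OF _ t, of ?gs "\<pi> u"] gs by (fastforce simp: sym_group_carrier)
    moreover have "(\<Sum>g\<leftarrow>?gs. \<pi> u (tabloid \<mu> (tact (inv' g) t))) = (\<Sum>h\<leftarrow>hs. \<pi> u (tabloid \<mu> (tact h t)))"
      unfolding map_map comp_def
      by (intro arg_cong[of _ _ sum_list] map_cong refl) (simp add: inv_inv)
    ultimately show ?thesis by simp
  qed
  \<comment> \<open>Since \<pi> is onto, what annihilates the induced module annihilates the whole
    Specht module and not only the image of f.\<close>
  have annihilated: "(\<Sum>h\<leftarrow>annihilator. w (tabloid \<mu> (tact h t))) = 0"
    if "w \<in> carrier (specht_module \<mu>)" "t \<in> tableaux \<mu>" for w :: "_ \<Rightarrow> 'f" and t
  proof -
    have "w \<in> \<pi> ` V" unfolding onto by (rule that(1))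
    then obtain u where u: "u \<in> V" "w = \<pi> u" by (elim imageE)
    show ?thesis
      unfolding u(2)
    proof (rule transfer[OF u(1) annihilator_permutes that(2)])
      fix x :: "nat \<Rightarrow> nat" assume x: "x permutes {1..9}"
      have "class_sum ?G ?H u (y \<circ> h) = class_sum ?G ?H u y" if "y permutes {1..9}" "h \<in> ?H" for y h
        using class_sum_right_mult[of y h u] that by (simp add: sym_group_def)
      then show "(\<Sum>h\<leftarrow>annihilator. class_sum ?G ?H u (h \<circ> x)) = 0"
        by (rule annihilator_sum_zero[OF char x])
    qed
  qed
  define w where "w = \<pi> f"
  have w: "w \<in> carrier (specht_module \<mu>)" using fV onto by (auto simp: w_def)
  have relation: "(\<Sum>h\<leftarrow>hs. w (tabloid \<mu> (tact h t))) = 0"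
    if "\<And>h. h \<in> set hs \<Longrightarrow> h permutes {1..9}" "t \<in> tableaux \<mu>"
      "\<And>x. x permutes {1..9} \<Longrightarrow> (\<Sum>h\<leftarrow>hs. \<beta> (h \<circ> x)) = 0" for hs t
    unfolding w_def
  proof (rule transfer[OF fV that(1,2)])
    fix x :: "nat \<Rightarrow> nat" assume x: "x permutes {1..9}"
    have "(\<Sum>h\<leftarrow>hs. class_sum ?G ?H f (h \<circ> x)) = (\<Sum>h\<leftarrow>hs. \<beta> (h \<circ> x))"
      using that(1) x
      by (intro arg_cong[of _ _ sum_list] map_cong refl f_sum) (simp add: sym_group_carrier permutes_compose)
    then show "(\<Sum>h\<leftarrow>hs. class_sum ?G ?H f (h \<circ> x)) = 0" using that(3)[OF x] by simp
  qed
  have \<beta>_swap: "\<beta> (swap i j \<circ> x) = of_int (coboundary (labelling x \<circ> swap i j) div 3)"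
    if "i \<in> {1..9}" "j \<in> {1..9}" "x permutes {1..9}" for i j x
    using labelling_compose[OF that(3) swap_permutes[OF that(1,2)]] by (simp add: \<beta>_def)
  interpret relation_vector \<mu> w
  proof
    show "CHAR('f) = 3" by (rule char)
  next
    fix t and i j :: nat assume t: "t \<in> tableaux \<mu>" and ij: "i \<in> {1..5}" "j \<in> {1..5}" "i \<noteq> j"
    have p: "swap i j permutes {1..9}" using ij by (intro swap_permutes) auto
    have "\<beta> x + \<beta> (swap i j \<circ> x) = 0" if x: "x permutes {1..9}" for x
    proof -
      have "coboundary (labelling x \<circ> swap i j) div 3 = - (coboundary (labelling x) div 3)"
        using coboundary_swap[OF labelling_numbering[OF x] ij] coboundary_values[OF labelling_numbering[OF x]] by auto
      then show ?thesis using \<beta>_swap[of i j x] ij x by (simp add: \<beta>_def)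
    qed
    then have "(\<Sum>h\<leftarrow>[id, swap i j]. w (tabloid \<mu> (tact h t))) = 0"
      using p t by (intro relation) (auto simp: permutes_id)
    then show "w (tabloid \<mu> t) + w (tabloid \<mu> (tact (swap i j) t)) = 0" by (simp add: tact_id[OF t])
  next
    fix t and i j :: nat assume t: "t \<in> tableaux \<mu>" and ij: "i \<in> {6..9}" "j \<in> {6..9}"
    have p: "swap i j permutes {1..9}" using ij by (intro swap_permutes) auto
    \<comment> \<open>Symmetry is the relation id - (i j), written with nonnegative coefficients as
      id + (i j) + (i j).\<close>
    have "\<beta> x + (\<beta> (swap i j \<circ> x) + \<beta> (swap i j \<circ> x)) = 0" if x: "x permutes {1..9}" for x
    proof -
      have "coboundary (labelling x \<circ> swap i j) = coboundary (labelling x)"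
        using ij by (simp add: coboundary_def Transposition.transpose_def)
      then have "\<beta> (swap i j \<circ> x) = \<beta> x" using \<beta>_swap[of i j x] ij x by (simp add: \<beta>_def)
      then show ?thesis by (simp flip: char_3_simps(4)[OF char])
    qed
    then have "(\<Sum>h\<leftarrow>[id, swap i j, swap i j]. w (tabloid \<mu> (tact h t))) = 0"
      using p t by (intro relation) (auto simp: permutes_id)
    then have "w (tabloid \<mu> t) + - w (tabloid \<mu> (tact (swap i j) t)) = 0"
      unfolding char_3_simps(4)[OF char] by (simp add: tact_id[OF t])
    then show "w (tabloid \<mu> (tact (swap i j) t)) = w (tabloid \<mu> t)" by simp
  next
    fix t assume t: "t \<in> tableaux \<mu>"
    have p: "swap 5 j permutes {1..9}" if "j \<in> {5..9}" for j
      using that by (intro swap_permutes) auto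
    let ?hs = "[id, swap 5 6, swap 5 7, swap 5 8, swap 5 9]"
    have five: "(\<Sum>j\<in>{5..9}. g j) = g 5 + (g 6 + (g 7 + (g 8 + g 9)))" for g :: "nat \<Rightarrow> int"
    proof -
      have "{5..9} = {5, 6, 7, 8, 9 :: nat}" by (intro equalityI subsetI; simp; presburger)
      then show ?thesis by simp
    qed
    have "(\<Sum>h\<leftarrow>?hs. \<beta> (h \<circ> x)) = 0" if x: "x permutes {1..9}" for x
    proof -
      let ?d = "\<lambda>j. coboundary (labelling x \<circ> swap 5 j) div 3"
      have num: "numbering (labelling x \<circ> swap 5 j)" if "j \<in> {5..9}" for j
        using that by (intro numbering_permute labelling_numbering[OF x] swap_permutes) auto
      \<comment> \<open>Dividing the factor 9 of \<open>coboundary_sum\<close> by 3 leaves a factor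
        3, which is zero in the field.\<close>
      have "3 * (\<Sum>j\<in>{5..9}. ?d j) = (\<Sum>j\<in>{5..9}. coboundary (labelling x \<circ> swap 5 j))"
        unfolding sum_distrib_left by (intro sum.cong refl three num)
      also have "\<dots> = 9 * cross_sign (labelling x 1) (labelling x 2) (labelling x 3) (labelling x 4)"
        by (rule coboundary_sum[OF labelling_numbering[OF x]])
      finally have "(\<Sum>j\<in>{5..9}. ?d j) =
          3 * cross_sign (labelling x 1) (labelling x 2) (labelling x 3) (labelling x 4)" by simp
      then have "(of_int (\<Sum>j\<in>{5..9}. ?d j) :: 'f) = 0"
        using char_3_simps(1)[OF char] by simp
      then have "(of_int (?d 5) + (of_int (?d 6) + (of_int (?d 7) + (of_int (?d 8) + of_int (?d 9)))) :: 'f) = 0"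
        unfolding five by (simp only: of_int_add)
      moreover have "\<beta> x = of_int (?d 5)" by (simp add: \<beta>_def)
      moreover have "\<beta> (swap 5 j \<circ> x) = of_int (?d j)" if "j \<in> {5..9}" for j
        using \<beta>_swap[of 5 j x] that x by simp
      ultimately show ?thesis by simp
    qed
    then have "(\<Sum>h\<leftarrow>?hs. w (tabloid \<mu> (tact h t))) = 0"
      using t p[of 6] p[of 7] p[of 8] p[of 9] by (intro relation) (auto simp: permutes_id)
    moreover have "{6..9} = {6, 7, 8, 9 :: nat}" by (intro equalityI subsetI; simp; presburger)
    ultimately show "w (tabloid \<mu> t) + (\<Sum>j\<in>{6..9}. w (tabloid \<mu> (tact (swap 5 j) t))) = 0"
      by (simp add: tact_id[OF t])
  qed
  have "w \<noteq> (\<lambda>x. 0)" using nonzero \<pi>0 by (simp add: w_def)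
  then obtain x where "w x \<noteq> 0" by blast
  moreover have "w x = 0" if "x \<notin> \<Omega>" for x
    using that w specht_subset_tabloid[where 'f = 'f] by (auto simp: tabloid_module_simps)
  ultimately have "x \<in> \<Omega>" by metis
  then obtain t where "t \<in> tableaux \<mu>" "x = tabloid \<mu> t" by (elim imageE)
  then have t: "t \<in> tableaux \<mu>" "w (tabloid \<mu> t) \<noteq> 0" using \<open>w x \<noteq> 0\<close> by simp_all
  have len: "6 \<le> length \<mu>"
    using few_rows[OF _ t(1)] five_rows[OF _ t(1)] t(2) by linarith
  have first: "3 \<le> \<mu> ! 0"
    using two_columns[OF w _ t(1)] t(2) by linarith
  obtain v u where "v \<in> carrier (specht_module \<mu>)" "u \<in> tableaux \<mu>"
    "(\<Sum>h\<leftarrow>annihilator. v (tabloid \<mu> (tact h u)) :: 'f) \<noteq> 0"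
    using char refl len first by (rule annihilator_nonzero)
  then show False using annihilated by simp
qed

end

theorem mainTheorem5:
  fixes b :: "(('k::field)^2) set \<Rightarrow> nat"
  assumes "CHAR('f::alg_closed_field) = 3"
    and "CARD('k) = 8"
    and "bij_betw b projective_line {1..9}"
  shows "\<not> has_specht_filtration 9
    (induced_module (sym_group 9) (PGammaL2_perms b)
       (trivial_module :: ('f, 'f, nat \<Rightarrow> nat) group_module))"
proof -
  interpret numbered_line "TYPE('k)" b
    using assms(2,3) by unfold_locales
  show ?thesis using assms(1) by (rule specht_filtration_impossible)
qed

end
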